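(* Let $\mathcal{W}_H^0=\{f=h+\bar g\in\mathcal{H}:\operatorname{Re}(h'(z)+zh''(z))>|g'(z)+zg''(z)|\text{ for all }z\in\mathbb{D}\}$, and let $f=h+\bar g\in\mathcal{W}_H^0$ with $h(z)=z+\sum_{n\ge2}a_nz^n$, $g(z)=\sum_{n\ge2}b_nz^n$. Then $\big||a_n|-|b_n|\big|\le2/n^2$ for $n=2,3,\dots$ and $$-|z|+2\int_0^{|z|}\frac{\log(1+t)}{t}\,dt\le|f(z)|\le-|z|-2\int_0^{|z|}\frac{\log(1-t)}{t}\,dt,\quad z\in\mathbb{D};$$ in particular $f(\mathbb{D})$ contains the disk $|w|<\pi^2/6-1$. All these are sharp for $f_0(z)=-z-2\int_0^{z}\frac{\log(1-t)}{t}\,dt=z+\sum_{n\ge2}\frac{2}{n^2}z^n$. Moreover: (i) $\mathcal{W}_H^0$ is compact with respect to the topology of locally uniform convergence; (ii) $r_S(\mathcal{W}_H^0)=1=r_{CC}(\mathcal{W}_H^0)$; (iii) $\mathcal{W}_H^0$ is closed under (harmonic) convolution; (iv)(a) if $\varphi\in\mathcal{K}$ and $f\in\mathcal{W}_H^0$ then $\varphi\,\tilde{*}\,f\in\mathcal{W}_H^0$; (b) if $\varphi\in\mathcal{A}$ with $\operatorname{Re}\varphi(z)/z>1/2$ in $\mathbb{D}$ and $f\in\mathcal{W}_H^0$ then $\varphi\,\tilde{*}\,f\in\mathcal{W}_H^0$; (c) if $\varphi\in\mathcal{W}$ and $f\in\mathcal{W}_H^0$ then $\varphi\,\tilde{*}\,f\in\mathcal{W}_H^0\cap\mathcal{SK}_H^0$;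 (v) $\mathcal{W}_H^0$ is closed under convex combinations.
   Context: $\mathbb{D}$ is the open unit disk. $\mathcal{H}$ is the class of harmonic $f=h+\bar g$ in $\mathbb{D}$ ($h,g$ analytic) with $f(0)=0$, $f_z(0)=1$, $f_{\bar z}(0)=0$. $\mathcal{A}$ is the class of analytic $f$ in $\mathbb{D}$ with $f(0)=0$, $f'(0)=1$; $\mathcal{K}$ the functions in $\mathcal{A}$ mapping $\mathbb{D}$ univalently onto a convex domain; $\mathcal{W}=\{f\in\mathcal{A}:\operatorname{Re}(f'(z)+zf''(z))>0,\ z\in\mathbb{D}\}$. $\mathcal{SK}_H^0$ is the class of sense-preserving ($|g'|<|h'|$) univalent $f=h+\bar g\in\mathcal{H}$ such that $h+\lambda\bar g$ maps $\mathbb{D}$ univalently onto a convex domain for every $|\lambda|=1$. $r_S$, $r_{CC}$: largest $r\le1$ such that every member of the class maps $|z|<r$ univalently onto a domain starlike w.r.t. $0$ (resp. close-to-convex). For analytic $f=\sum a_nz^n$, $F=\sum A_nz^n$, $f*F=\sum a_nA_nz^n$; for harmonic $f=h+\bar g$, $F=H+\bar G$, $f*F=h*H+\overline{g*G}$; for analytic $\varphi$, $\varphi\,\tilde{*}\,f=h*\varphi+\overline{g*\varphi}$. Closed under convex combinations: $\sum t_nf_n$ in the class whenever all $f_n$ are, $t_n\ge0$, $\sum t_n=1$. *)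

theory Defs
  imports "HOL-Complex_Analysis.Complex_Analysis"
begin

abbreviation disk :: "complex set" where "disk \<equiv> ball 0 1"

definition coef :: "(complex \<Rightarrow> complex) \<Rightarrow> nat \<Rightarrow> complex" where
  "coef h n = (deriv ^^ n) h 0 / of_nat (fact n)"

definition hconv :: "(complex \<Rightarrow> complex) \<Rightarrow> (complex \<Rightarrow> complex) \<Rightarrow> complex \<Rightarrow> complex" where
  "hconv h H z = (\<Sum>n. coef h n * coef H n * z ^ n)"

text \<open>A harmonic map f = h + conj g is represented by the pair (h, g).\<close>
definition harmf :: "(complex \<Rightarrow> complex) \<times> (complex \<Rightarrow> complex) \<Rightarrow> complex \<Rightarrow> complex" where
  "harmf p z = fst p z + cnj (snd p z)"

definition harm_conv ::
  "(complex \<Rightarrow> complex) \<times> (complex \<Rightarrow> complex) \<Rightarrow> (complex \<Rightarrow> complex) \<times> (complex \<Rightarrow> complex)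
     \<Rightarrow> (complex \<Rightarrow> complex) \<times> (complex \<Rightarrow> complex)" where
  "harm_conv p q = (hconv (fst p) (fst q), hconv (snd p) (snd q))"

definition tconv ::
  "(complex \<Rightarrow> complex) \<Rightarrow> (complex \<Rightarrow> complex) \<times> (complex \<Rightarrow> complex)
     \<Rightarrow> (complex \<Rightarrow> complex) \<times> (complex \<Rightarrow> complex)" where
  "tconv \<phi> p = (hconv (fst p) \<phi>, hconv (snd p) \<phi>)"

definition classH :: "((complex \<Rightarrow> complex) \<times> (complex \<Rightarrow> complex)) set" where
  "classH = {(h, g). h holomorphic_on disk \<and> g holomorphic_on disk \<and>
      h 0 = 0 \<and> g 0 = 0 \<and> deriv h 0 = 1 \<and> deriv g 0 = 0}"

definition WH0 :: "((complex \<Rightarrow> complex) \<times> (complex \<Rightarrow> complex)) set" where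
  "WH0 = {(h, g). (h, g) \<in> classH \<and>
      (\<forall>z\<in>disk. Re (deriv h z + z * deriv (deriv h) z) > cmod (deriv g z + z * deriv (deriv g) z))}"

definition classA :: "(complex \<Rightarrow> complex) set" where
  "classA = {\<phi>. \<phi> holomorphic_on disk \<and> \<phi> 0 = 0 \<and> deriv \<phi> 0 = 1}"

definition classK :: "(complex \<Rightarrow> complex) set" where
  "classK = {\<phi>. \<phi> \<in> classA \<and> inj_on \<phi> disk \<and> convex (\<phi> ` disk)}"

definition classW :: "(complex \<Rightarrow> complex) set" where
  "classW = {\<phi>. \<phi> \<in> classA \<and> (\<forall>z\<in>disk. Re (deriv \<phi> z + z * deriv (deriv \<phi>) z) > 0)}"

definition SKH0 :: "((complex \<Rightarrow> complex) \<times> (complex \<Rightarrow> complex)) set" where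
  "SKH0 = {(h, g). (h, g) \<in> classH \<and>
      (\<forall>z\<in>disk. cmod (deriv g z) < cmod (deriv h z)) \<and>
      inj_on (harmf (h, g)) disk \<and>
      (\<forall>c. cmod c = 1 \<longrightarrow>
         inj_on (\<lambda>z. h z + c * cnj (g z)) disk \<and> convex ((\<lambda>z. h z + c * cnj (g z)) ` disk))}"

definition starlike0 :: "complex set \<Rightarrow> bool" where
  "starlike0 S \<longleftrightarrow> 0 \<in> S \<and> (\<forall>w\<in>S. closed_segment 0 w \<subseteq> S)"

definition halfline :: "complex \<Rightarrow> complex \<Rightarrow> complex set" where
  "halfline a d = {a + of_real t * d | t. t \<ge> 0}"

text \<open>Close-to-convex domain (Kaplan): the complement is a union of
  non-crossing (pairwise disjoint) closed half-lines.\<close>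
definition close_to_convex_dom :: "complex set \<Rightarrow> bool" where
  "close_to_convex_dom S \<longleftrightarrow> (\<exists>R. (\<forall>L\<in>R. \<exists>a d. d \<noteq> 0 \<and> L = halfline a d) \<and>
      (\<forall>L1\<in>R. \<forall>L2\<in>R. L1 \<noteq> L2 \<longrightarrow> L1 \<inter> L2 = {}) \<and> - S = \<Union>R)"

definition is_domain :: "complex set \<Rightarrow> bool" where
  "is_domain S \<longleftrightarrow> open S \<and> connected S \<and> S \<noteq> {}"

definition radius_S :: "((complex \<Rightarrow> complex) \<times> (complex \<Rightarrow> complex)) set \<Rightarrow> real" where
  "radius_S C = Sup {r. 0 < r \<and> r \<le> 1 \<and> (\<forall>p\<in>C. inj_on (harmf p) (ball 0 r) \<and>
      is_domain (harmf p ` ball 0 r) \<and> starlike0 (harmf p ` ball 0 r))}"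

definition radius_CC :: "((complex \<Rightarrow> complex) \<times> (complex \<Rightarrow> complex)) set \<Rightarrow> real" where
  "radius_CC C = Sup {r. 0 < r \<and> r \<le> 1 \<and> (\<forall>p\<in>C. inj_on (harmf p) (ball 0 r) \<and>
      is_domain (harmf p ` ball 0 r) \<and> close_to_convex_dom (harmf p ` ball 0 r))}"

definition f0 :: "complex \<Rightarrow> complex" where
  "f0 z = z + (\<Sum>n. 2 / (of_nat (n + 2))\<^sup>2 * z ^ (n + 2))"

end

theory Submission
  imports Defs
begin

text \<open>
  A pair \<open>(h, g)\<close> lies in the class iff every \<open>F = h + l g\<close> with \<open>|l| = 1\<close> satisfies
  \<open>Re (F' + z F'') > 0\<close>, so all estimates reduce to analytic functions.  The convolution of two
  functions normalised to 1 at 0 with real parts at least \<open>\<alpha>\<close> and \<open>\<beta>\<close> has real part at least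
  \<open>1 - 2 (1 - \<alpha>) (1 - \<beta>)\<close>; this yields the coefficient bound and all convolution statements, since
  \<open>Re (\<phi>(z) / z) \<ge> 1/2\<close> for convex \<open>\<phi>\<close> and for \<open>\<phi>\<close> in the analytic class.  The growth bounds come from
  integrating Harnack's inequality along radii.  Starlikeness of each \<open>F\<close>, and convexity of each
  convolution of two such functions, follow by a first-contact argument; both pass from the family
  \<open>h + l g\<close> to the harmonic maps by choosing \<open>l\<close> depending on the point.
\<close>

section \<open>Taylor coefficients and convolution\<close>

text \<open>The threshold 1/2 is forced by the convolution bound, which equals 0 exactly for
  \<alpha> = 0 and \<beta> = 1/2: a factor with Re (\<phi>(z) / z) \<ge> 1/2 preserves Re (F' + z
  F'') \<ge> 0. Convolutions and limits give only weak inequalities; the strict one that defines the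
  class returns through Harnack's inequality, because all functions involved are normalised to 1 at
  0. The delicate point is convexity of a convolution of two members. The real part to be controlled
  there is only known to be at least 1 - 2 (1 - 0.38) = - 0.24, so a contact argument that merely
  finds a nonpositive radial derivative would fail. Harnack's inequality along the radius improves 0
  to - 1/2 at the contact point, and this slack absorbs the deficit. Univalence of the harmonic maps
  is obtained separately, from |g'| < Re h' on a convex domain. Harmonic convolution needs one more
  device, since multiplying out (h + a g) * (H + b G) produces mixed terms that do not belong to the
  result.\<close>

lemma coef_sums:
  assumes "f holomorphic_on disk" "z \<in> disk"
  shows "(\<lambda>n. coef f n * z ^ n) sums f z"
  using holomorphic_power_series[OF assms] by (simp add: coef_def)

text \<open>With \<open>coef_eqI\<close> this reduces most operator identities below to a comparison
  of Taylor coefficients.\<close>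

lemma power_series_coef:
  assumes "\<And>z. z \<in> disk \<Longrightarrow> (\<lambda>n. c n * z ^ n) sums f z"
  shows "f holomorphic_on disk" "coef f n = c n"
proof -
  show hol: "f holomorphic_on disk"
    by (rule power_series_holomorphic[where a=c]) (use assms in auto)
  have "f has_fps_expansion Abs_fps c"
  proof (rule has_fps_expansionI)
    show "\<forall>\<^sub>F u in nhds 0. (\<lambda>n. fps_nth (Abs_fps c) n * u ^ n) sums f u"
      by (rule eventually_mono[OF eventually_nhds_in_open[of disk 0]]) (use assms in auto)
  qed
  from fps_nth_fps_expansion[OF this, of n] show "coef f n = c n" by (simp add: coef_def)
qed

lemma coef_0 [simp]: "coef f 0 = f 0" by (simp add: coef_def)

lemma coef_1: "coef f (Suc 0) = deriv f 0" by (simp add: coef_def)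

lemma coef_eqI:
  assumes "f holomorphic_on disk" "g holomorphic_on disk" "\<And>n. coef f n = coef g n" "z \<in> disk"
  shows "f z = g z"
  using coef_sums[OF assms(1,4)] coef_sums[OF assms(2,4)] sums_unique2 by (simp add: assms(3))

lemma coef_cong:
  assumes "\<And>z. z \<in> disk \<Longrightarrow> f z = g z"
  shows "coef f n = coef g n"
proof -
  have "eventually (\<lambda>z. f z = g z) (nhds 0)"
    by (rule eventually_mono[OF eventually_nhds_in_open[of disk 0]]) (use assms in auto)
  then show ?thesis unfolding coef_def using higher_deriv_cong_ev by metis
qed

lemma coef_add:
  assumes "f holomorphic_on disk" "g holomorphic_on disk"
  shows "coef (\<lambda>z. f z + l * g z) n = coef f n + l * coef g n"
proof (rule power_series_coef)
  fix z assume z: "z \<in> disk"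
  have "(\<lambda>n. coef f n * z ^ n + l * (coef g n * z ^ n)) sums (f z + l * g z)"
    by (intro sums_add sums_mult coef_sums assms z)
  then show "(\<lambda>n. (coef f n + l * coef g n) * z ^ n) sums (f z + l * g z)"
    by (simp add: algebra_simps)
qed

lemma coef_deriv: "coef (deriv f) n = of_nat (Suc n) * coef f (Suc n)"
proof -
  have "(deriv ^^ n) (deriv f) 0 = (deriv ^^ Suc n) f 0" by (simp add: funpow_Suc_right del: funpow.simps)
  moreover have "complex_of_nat (fact (Suc n)) = of_nat (Suc n) * of_nat (fact n)"
    by (metis fact_Suc of_nat_mult of_nat_id)
  ultimately show ?thesis
    unfolding coef_def by (simp del: of_nat_Suc of_nat_fact fact_Suc funpow.simps)
qed

lemma coef_times_z:
  assumes "f holomorphic_on disk"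
  shows "coef (\<lambda>z. z * f z) (Suc n) = coef f n"
proof -
  define c where "c = (\<lambda>n. case n of 0 \<Rightarrow> 0 | Suc m \<Rightarrow> coef f m)"
  have "coef (\<lambda>z. z * f z) (Suc n) = c (Suc n)"
  proof (rule power_series_coef)
    fix z assume "z \<in> disk"
    have "(\<lambda>n. z * (coef f n * z ^ n)) sums (z * f z)"
      by (intro sums_mult coef_sums assms \<open>z \<in> disk\<close>)
    then have "(\<lambda>n. c (Suc n) * z ^ Suc n) sums (z * f z)"
      by (simp add: c_def algebra_simps)
    then show "(\<lambda>n. c n * z ^ n) sums (z * f z)"
      by (subst (asm) sums_Suc_iff) (simp add: c_def)
  qed
  then show ?thesis by (simp add: c_def)
qed

lemma coef_abs_summable:
  assumes "f holomorphic_on disk" "cmod z < 1"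
  shows "summable (\<lambda>n. cmod (coef f n) * cmod z ^ n)"
proof -
  define r where "r = (1 + cmod z) / 2"
  have r: "cmod z < r" "r < 1" "r > 0" using assms(2) norm_ge_zero[of z] unfolding r_def by (simp_all add: field_simps del: norm_ge_zero)
  have "summable (\<lambda>n. coef f n * complex_of_real r ^ n)"
    using coef_sums[OF assms(1), of "of_real r"] r by (auto simp: sums_iff)
  from powser_insidea[OF this, of z] show ?thesis using r by (simp add: norm_mult norm_power)
qed

lemma coef_bounded:
  assumes "f holomorphic_on disk" "0 \<le> r" "r < 1"
  obtains C where "\<And>n. cmod (coef f n) * r ^ n \<le> C"
proof -
  have "summable (\<lambda>n. cmod (coef f n) * r ^ n)"
    using coef_abs_summable[OF assms(1), of "of_real r"] assms by simp
  then have "(\<lambda>n. cmod (coef f n) * r ^ n) \<longlonglongrightarrow> 0" by (rule summable_LIMSEQ_zero)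
  then have "Bseq (\<lambda>n. cmod (coef f n) * r ^ n)" by (metis convergentI convergent_imp_Bseq)
  then show ?thesis using that unfolding Bseq_def
    by (metis abs_le_D1 real_norm_def)
qed

lemma hconv_summable:
  assumes "f holomorphic_on disk" "g holomorphic_on disk" "cmod z < 1"
  shows "summable (\<lambda>n. cmod (coef f n) * cmod (coef g n) * cmod z ^ n)"
proof -
  \<comment> \<open>The power \<open>cmod z ^ n\<close> splits into two halves \<open>r ^ n\<close>:
    one keeps the coefficients of \<open>f\<close> bounded, the other makes those of
    \<open>g\<close> summable.\<close>
  define r where "r = sqrt (cmod z)"
  have r: "0 \<le> r" "r < 1" "cmod z = r * r" using assms(3) by (auto simp: r_def)
  obtain C where C: "\<And>n. cmod (coef f n) * r ^ n \<le> C" using coef_bounded[OF assms(1) r(1,2)] by blast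
  have "summable (\<lambda>n. C * (cmod (coef g n) * r ^ n))"
    using coef_abs_summable[OF assms(2), of "of_real r"] r by (intro summable_mult) simp
  then show ?thesis
  proof (rule summable_comparison_test')
    fix n
    have "cmod (coef f n) * cmod (coef g n) * cmod z ^ n
        = (cmod (coef f n) * r ^ n) * (cmod (coef g n) * r ^ n)"
      by (simp add: r(3) power_mult_distrib algebra_simps)
    also have "\<dots> \<le> C * (cmod (coef g n) * r ^ n)"
      by (intro mult_right_mono C) (use r in auto)
    finally show "norm (cmod (coef f n) * cmod (coef g n) * cmod z ^ n) \<le> C * (cmod (coef g n) * r ^ n)"
      by simp
  qed
qed

lemma hconv_sums:
  assumes "f holomorphic_on disk" "g holomorphic_on disk" "z \<in> disk"
  shows "(\<lambda>n. (coef f n * coef g n) * z ^ n) sums hconv f g z"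
proof -
  have "summable (\<lambda>n. cmod (coef f n * coef g n * z ^ n))"
    using hconv_summable[OF assms(1,2), of z] assms(3) by (simp only: norm_mult norm_power) simp
  then show ?thesis unfolding hconv_def by (rule summable_sums[OF summable_norm_cancel])
qed

lemma
  assumes "f holomorphic_on disk" "g holomorphic_on disk"
  shows holomorphic_hconv: "hconv f g holomorphic_on disk"
    and coef_hconv: "coef (hconv f g) n = coef f n * coef g n"
proof -
  have *: "(\<lambda>n. coef f n * coef g n * z ^ n) sums hconv f g z" if "z \<in> disk" for z
    using hconv_sums[OF assms that] .
  show "hconv f g holomorphic_on disk" by (rule power_series_coef[OF *])
  show "coef (hconv f g) n = coef f n * coef g n" by (rule power_series_coef[OF *])
qed

lemma hconv_commute: "hconv f g z = hconv g f z"
  by (simp add: hconv_def mult.commute)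

lemma hconv_add:
  assumes "f holomorphic_on disk" "g holomorphic_on disk" "k holomorphic_on disk" "z \<in> disk"
  shows "hconv (\<lambda>z. f z + l * g z) k z = hconv f k z + l * hconv g k z"
proof -
  have "(\<lambda>n. coef f n * coef k n * z ^ n + l * (coef g n * coef k n * z ^ n))
      sums (hconv f k z + l * hconv g k z)"
    by (intro sums_add sums_mult hconv_sums assms)
  then have "(\<lambda>n. coef (\<lambda>z. f z + l * g z) n * coef k n * z ^ n) sums (hconv f k z + l * hconv g k z)"
    by (simp add: coef_add assms algebra_simps)
  then show ?thesis unfolding hconv_def by (simp add: sums_iff)
qed

text \<open>This is (z f'(z))'. It multiplies the coefficient of z^(n+1) by (n+1)^2 and lowers the
  index by one, so a convolution can hand the whole weight to one factor.\<close>

definition Lop :: "(complex \<Rightarrow> complex) \<Rightarrow> complex \<Rightarrow> complex" where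
  "Lop f z = deriv f z + z * deriv (deriv f) z"

text \<open>For f(0) = 0 this is f(z) / z with the singularity removed. It lowers the index without
  a weight, which is what remains for one convolution factor when the other carries
  \<open>Lop\<close> or \<open>deriv\<close>.\<close>

definition dquot :: "(complex \<Rightarrow> complex) \<Rightarrow> complex \<Rightarrow> complex" where
  "dquot f z = (if z = 0 then deriv f 0 else f z / z)"

lemma holomorphic_Lop: "f holomorphic_on disk \<Longrightarrow> Lop f holomorphic_on disk"
  unfolding Lop_def by (intro holomorphic_intros) auto

lemma coef_Lop:
  assumes "f holomorphic_on disk"
  shows "coef (Lop f) n = (of_nat (Suc n))\<^sup>2 * coef f (Suc n)"
proof -
  have h: "deriv f holomorphic_on disk" "deriv (deriv f) holomorphic_on disk"
    using assms by (auto intro!: holomorphic_intros)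
  have "coef (Lop f) n = coef (deriv f) n + 1 * coef (\<lambda>z. z * deriv (deriv f) z) n"
    using coef_add[OF h(1), of "\<lambda>z. z * deriv (deriv f) z" 1 n] h
    by (simp add: Lop_def[abs_def] holomorphic_intros)
  also have "coef (\<lambda>z. z * deriv (deriv f) z) n = of_nat n * coef (deriv f) n"
    by (cases n) (simp_all add: coef_times_z h coef_deriv[of "deriv f"] del: of_nat_Suc)
  finally show ?thesis by (simp add: coef_deriv power2_eq_square algebra_simps)
qed

lemma holomorphic_dquot:
  assumes "f holomorphic_on disk" "f 0 = 0"
  shows "dquot f holomorphic_on disk"
proof -
  have "dquot f = (\<lambda>z. if z = 0 then deriv f 0 else (f z - f 0) / (z - 0))"
    using assms(2) by (auto simp: dquot_def)
  then show ?thesis using pole_lemma_open[OF assms(1), of 0] by simp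
qed

lemma dquot_mult: "f 0 = 0 \<Longrightarrow> z * dquot f z = f z" by (simp add: dquot_def)

lemma coef_dquot:
  assumes "f holomorphic_on disk" "f 0 = 0"
  shows "coef (dquot f) n = coef f (Suc n)"
  using coef_times_z[OF holomorphic_dquot[OF assms], of n] assms(2) by (simp add: dquot_mult)

lemma Lop_hconv:
  assumes "f holomorphic_on disk" "g holomorphic_on disk" "g 0 = 0" "z \<in> disk"
  shows "Lop (hconv f g) z = hconv (Lop f) (dquot g) z"
  by (rule coef_eqI[OF _ _ _ assms(4)])
     (simp_all add: assms holomorphic_Lop holomorphic_hconv holomorphic_dquot coef_Lop coef_hconv coef_dquot)

lemma deriv_hconv:
  assumes "f holomorphic_on disk" "g holomorphic_on disk" "g 0 = 0" "z \<in> disk"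
  shows "deriv (hconv f g) z = hconv (deriv f) (dquot g) z"
  by (rule coef_eqI[OF _ _ _ assms(4)])
     (simp_all add: assms holomorphic_hconv holomorphic_dquot coef_hconv coef_dquot coef_deriv holomorphic_deriv)

section \<open>Positivity of convolutions\<close>

lemma sums_at:
  assumes "\<And>m. m \<noteq> n \<Longrightarrow> f m = 0" "f n = s"
  shows "f sums s"
  using sums_finite[of "{n}" f] assms by simp

text \<open>Since \<open>cmod a < 1\<close>, the series converges uniformly on the circle and may be
  integrated term by term. The abstract \<open>e\<close> covers both \<open>cis t\<close> and
  \<open>cis (- t)\<close>; \<open>J\<close> collects the moments of the other factor
  \<open>g\<close>.\<close>

lemma has_integral_circle_power_series:
  assumes f: "f holomorphic_on disk" and a: "cmod a < 1"
    and e: "continuous_on UNIV e" "\<And>t. cmod (e t) = 1"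
    and g: "continuous_on UNIV g"
    and J: "\<And>n. ((\<lambda>t::real. e t ^ n * g t) has_integral J n) {0..2*pi}"
    and S: "(\<lambda>n. coef f n * a ^ n * J n) sums S"
  shows "((\<lambda>t. f (a * e t) * g t) has_integral S) {0..2*pi}"
proof -
  define F where "F = (\<lambda>n t. coef f n * (a * e t) ^ n * g t)"
  have "compact (g ` {0..2*pi})"
    using g by (intro compact_continuous_image) (auto intro: continuous_on_subset)
  then obtain B where B: "\<And>t. t \<in> {0..2*pi} \<Longrightarrow> cmod (g t) \<le> B"
    by (metis bounded_iff compact_imp_bounded imageI)
  have cF: "continuous_on {0..2*pi} (F n)" for n
    unfolding F_def by (intro continuous_intros continuous_on_subset[OF e(1)] continuous_on_subset[OF g]) auto
  have sF: "(\<lambda>n. F n t) sums (f (a * e t) * g t)" for t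
    unfolding F_def by (intro sums_mult2 coef_sums[OF f]) (simp add: norm_mult e a)
  have "uniform_limit {0..2*pi} (\<lambda>N t. \<Sum>n<N. F n t) (\<lambda>t. \<Sum>n. F n t) sequentially"
  proof (rule Weierstrass_m_test)
    show "cmod (F n t) \<le> cmod (coef f n) * cmod a ^ n * B" if "t \<in> {0..2*pi}" for n t
      unfolding F_def by (auto simp: norm_mult norm_power e intro!: mult_left_mono B that)
    show "summable (\<lambda>n. cmod (coef f n) * cmod a ^ n * B)"
      by (intro summable_mult2 coef_abs_summable f a)
  qed
  moreover have "(\<lambda>t. \<Sum>n. F n t) = (\<lambda>t. f (a * e t) * g t)"
    using sF by (auto simp: sums_iff)
  ultimately have u: "uniform_limit {0..2*pi} (\<lambda>N t. \<Sum>n<N. F n t) (\<lambda>t. f (a * e t) * g t) sequentially"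
    by simp
  have cs: "continuous_on {0..2*pi} (\<lambda>t. \<Sum>n<N. F n t)" for N
    by (intro continuous_intros cF)
  obtain I K where IK: "\<And>N. ((\<lambda>t. \<Sum>n<N. F n t) has_integral I N) {0..2*pi}"
    "((\<lambda>t. f (a * e t) * g t) has_integral K) {0..2*pi}" "I \<longlonglongrightarrow> K"
    by (rule uniform_limit_integral[OF u cs sequentially_bot]) (rule that)
  have iF: "(F n has_integral coef f n * a ^ n * J n) {0..2*pi}" for n
    using has_integral_mult_right[OF J[of n], of "coef f n * a ^ n"]
    unfolding F_def by (simp add: algebra_simps)
  have "((\<lambda>t. \<Sum>n<N. F n t) has_integral (\<Sum>n<N. coef f n * a ^ n * J n)) {0..2*pi}" for N
    by (intro has_integral_sum iF) auto
  then have "I = (\<lambda>N. \<Sum>n<N. coef f n * a ^ n * J n)" using IK(1) has_integral_unique by blast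
  then have "K = S" using IK(3) S unfolding sums_def by (simp add: LIMSEQ_unique)
  then show ?thesis using IK(2) by simp
qed

lemma has_integral_cis_multiple:
  fixes k :: int
  shows "((\<lambda>t. cis (of_int k * t)) has_integral (if k = 0 then 2 * of_real pi else 0)) {0..2*pi}"
proof (cases "k = 0")
  case True
  then show ?thesis using has_integral_const_real[of "1::complex" 0 "2*pi"]
    by (simp add: scaleR_conv_of_real)
next
  case False
  have "((\<lambda>t. cis (of_int k * t)) has_integral
      (cis (of_int k * (2*pi)) / (\<i> * of_int k) - cis (of_int k * 0) / (\<i> * of_int k))) {0..2*pi}"
  proof (rule fundamental_theorem_of_calculus)
    fix t :: real assume "t \<in> {0..2*pi}"
    show "((\<lambda>t. cis (of_int k * t) / (\<i> * of_int k)) has_vector_derivative cis (of_int k * t)) (at t within {0..2*pi})"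
      unfolding cis_conv_exp using False
      by (auto intro!: derivative_eq_intros has_vector_derivative_real_field simp: field_simps)
  qed auto
  moreover have "cis (of_int k * (2*pi)) = 1"
    using cis_multiple_2pi[of "of_int k"] by (simp add: mult_ac)
  ultimately show ?thesis using False by simp
qed

lemma has_integral_cis_power:
  "((\<lambda>t. cis t ^ n * cis (- t) ^ m) has_integral (if n = m then 2 * of_real pi else 0)) {0..2*pi}"
proof -
  have "cis t ^ n * cis (- t) ^ m = cis (of_int (int n - int m) * t)" for t
    by (simp add: Complex.DeMoivre cis_mult algebra_simps)
  then show ?thesis using has_integral_cis_multiple[of "int n - int m"] by simp
qed

lemma cis_minus_power: "cis (- t) ^ n = cnj (cis t ^ n)"
  by (simp add: cis_cnj)

text \<open>Write z = a \<rho>, u(t) = A (a cis (- t)) and v(t) = B (\<rho> cis t). The mean of u v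
  is the convolution at z and the mean of u cnj v is 1, so the mean of the nonnegative function (Re
  u - \<alpha>) (2 Re v - 2 \<beta>) is the real part of the convolution plus 1 - 2 \<alpha> - 2
  \<beta> + 2 \<alpha> \<beta>.\<close>

lemma hconv_Re_ge:
  assumes A: "A holomorphic_on disk" "A 0 = 1" "\<And>z. z \<in> disk \<Longrightarrow> Re (A z) \<ge> \<alpha>"
    and B: "B holomorphic_on disk" "B 0 = 1" "\<And>z. z \<in> disk \<Longrightarrow> Re (B z) \<ge> \<beta>"
    and z: "z \<in> disk"
  shows "Re (hconv A B z) \<ge> 1 - 2 * (1 - \<alpha>) * (1 - \<beta>)"
proof -
  \<comment> \<open>Any \<rho> strictly between \<open>cmod z\<close> and 1 keeps both circles, of
    radius \<open>cmod a\<close> and \<rho>, inside the disk.\<close>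
  define \<rho> where "\<rho> = (1 + cmod z) / 2"
  define a where "a = z / of_real \<rho>"
  have \<rho>: "0 < \<rho>" "\<rho> < 1" "cmod z < \<rho>"
    using z norm_ge_zero[of z] by (auto simp: \<rho>_def field_simps simp del: norm_ge_zero)
  have a: "cmod a < 1" "a * of_real \<rho> = z" using \<rho> by (auto simp: a_def norm_divide)
  define u where "u = (\<lambda>t. A (a * cis (- t)))"
  define v where "v = (\<lambda>t. B (of_real \<rho> * cis t))"
  have in_disk: "a * cis (- t) \<in> disk" "of_real \<rho> * cis t \<in> disk" for t
    using a \<rho> by (auto simp: norm_mult)
  have cu: "continuous_on UNIV u" unfolding u_def
    by (rule continuous_on_compose2[OF holomorphic_on_imp_continuous_on[OF A(1)]])
       (use in_disk in \<open>auto intro!: continuous_intros\<close>)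
  have cv: "continuous_on UNIV v" unfolding v_def
    by (rule continuous_on_compose2[OF holomorphic_on_imp_continuous_on[OF B(1)]])
       (use in_disk in \<open>auto intro!: continuous_intros\<close>)
  have J: "((\<lambda>t. cis t ^ n * u t) has_integral 2 * pi * coef A n * a ^ n) {0..2*pi}" for n
  proof -
    have "(\<lambda>m. coef A m * a ^ m * (if n = m then 2 * of_real pi else 0)) sums (coef A n * a ^ n * (2 * of_real pi))"
      by (rule sums_at[of n]) auto
    from has_integral_circle_power_series[OF A(1) a(1) _ _ _ _ this, of "\<lambda>t. cis (- t)" "\<lambda>t. cis t ^ n"]
    show ?thesis using has_integral_cis_power[of n]
      by (simp add: u_def continuous_intros algebra_simps)
  qed
  have iu: "(u has_integral 2 * pi) {0..2*pi}" using J[of 0] A(2) by simp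
  have vn: "((\<lambda>t. v t * cis t ^ n) has_integral (if n = 0 then 2 * pi else 0)) {0..2*pi}" for n
  proof -
    have "(\<lambda>m. coef B m * of_real \<rho> ^ m * (if m + n = 0 then 2 * of_real pi else 0)) sums
        (if n = 0 then 2 * pi else 0)"
      by (rule sums_at[of 0]) (auto simp: B)
    note * = has_integral_circle_power_series[OF B(1) _ _ _ _ _ this]
    have "((\<lambda>t. v t * cis t ^ n) has_integral (if n = 0 then 2 * pi else 0)) {0..2*pi}"
      if "\<And>m. ((\<lambda>t. cis t ^ m * cis t ^ n) has_integral (if m + n = 0 then 2 * of_real pi else 0)) {0..2*pi}"
    proof -
      have "continuous_on UNIV (\<lambda>t. cis t)" by (intro continuous_intros)
      moreover have "continuous_on UNIV (\<lambda>t. cis t ^ n)" by (intro continuous_intros)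
      ultimately show ?thesis
        using that \<rho> *[of "cis" "\<lambda>t. cis t ^ n"] by (simp add: v_def)
    qed
    moreover have "((\<lambda>t. cis t ^ m * cis t ^ n) has_integral (if m + n = 0 then 2 * of_real pi else 0)) {0..2*pi}" for m
      using has_integral_cis_power[of "m + n" 0] by (simp add: power_add)
    ultimately show ?thesis by blast
  qed
  have iv: "(v has_integral 2 * pi) {0..2*pi}" using vn[of 0] by simp
  have icv: "((\<lambda>t. cnj (v t)) has_integral 2 * pi) {0..2*pi}"
    using has_integral_cnj[THEN iffD2, OF iv] by (simp add: o_def)
  have iuv: "((\<lambda>t. v t * u t) has_integral 2 * pi * hconv A B z) {0..2*pi}"
  proof -
    have "(\<lambda>n. coef B n * of_real \<rho> ^ n * (2 * pi * coef A n * a ^ n)) sums (2 * pi * hconv A B z)"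
      using sums_mult[OF hconv_sums[OF A(1) B(1) z], of "2 * pi"]
      by (simp add: a(2)[symmetric] power_mult_distrib algebra_simps)
    from has_integral_circle_power_series[OF B(1) _ _ _ cu J this] show ?thesis
      using \<rho> by (simp add: v_def continuous_intros)
  qed
  \<comment> \<open>Both \<open>u\<close> and \<open>cnj v\<close> contain only the frequencies - n
    with n \<ge> 0, so only the product of their constant terms survives.\<close>
  have iucv: "((\<lambda>t. u t * cnj (v t)) has_integral 2 * pi) {0..2*pi}"
  proof -
    have c: "((\<lambda>t. cis (- t) ^ n * cnj (v t)) has_integral (if n = 0 then 2 * pi else 0)) {0..2*pi}" for n
      using has_integral_cnj[THEN iffD2, OF vn[of n]]
      by (simp add: o_def cis_minus_power mult.commute if_distrib cong: if_cong)
    have "(\<lambda>n. coef A n * a ^ n * (if n = 0 then 2 * pi else 0)) sums (2 * pi)"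
      by (rule sums_at[of 0]) (auto simp: A)
    from has_integral_circle_power_series[OF A(1) a(1) _ _ _ c this] show ?thesis
      using cv by (simp add: u_def continuous_intros)
  qed
  have "((\<lambda>t. (u t - \<alpha>) * (v t + cnj (v t) - 2 * \<beta>)) has_integral
      2 * complex_of_real pi * (hconv A B z + of_real (1 - 2 * \<beta> - 2 * \<alpha> + 2 * \<alpha> * \<beta>))) {0..2*pi}"
  proof -
    define p where "p = complex_of_real \<alpha>"
    define q where "q = complex_of_real \<beta>"
    define c where "c = 2 * p * q"
    have "((\<lambda>t. v t * u t + u t * cnj (v t) - (2 * q) * u t - p * v t - p * cnj (v t) + c) has_integral
      2 * complex_of_real pi * hconv A B z + 2 * pi - (2 * q) * (2 * pi) - p * (2 * pi) - p * (2 * pi)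
        + (2 * pi) *\<^sub>R c) {0..2*pi}"
      using has_integral_const_real[of c 0 "2*pi"]
      by (intro has_integral_add has_integral_diff has_integral_mult_right iuv[simplified of_real_mult of_real_numeral] iucv iu iv icv) auto
    then have "((\<lambda>t. (u t - p) * (v t + cnj (v t) - 2 * q)) has_integral
      2 * complex_of_real pi * (hconv A B z + (1 - 2 * q - 2 * p + 2 * p * q))) {0..2*pi}"
      by (simp add: algebra_simps scaleR_conv_of_real c_def)
    then show ?thesis by (simp add: p_def q_def)
  qed
  from has_integral_Re[OF this]
  have "((\<lambda>t. (Re (u t) - \<alpha>) * (2 * Re (v t) - 2 * \<beta>)) has_integral
      2 * pi * (Re (hconv A B z) + (1 - 2 * \<beta> - 2 * \<alpha> + 2 * \<alpha> * \<beta>))) {0..2*pi}"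
    by simp
  moreover have "(Re (u t) - \<alpha>) * (2 * Re (v t) - 2 * \<beta>) \<ge> 0" for t
    using A(3)[OF in_disk(1)] B(3)[OF in_disk(2)] by (simp add: u_def v_def)
  ultimately have "0 \<le> 2 * pi * (Re (hconv A B z) + (1 - 2 * \<beta> - 2 * \<alpha> + 2 * \<alpha> * \<beta>))"
    by (rule has_integral_nonneg)
  then have "0 \<le> Re (hconv A B z) + (1 - 2 * \<beta> - 2 * \<alpha> + 2 * \<alpha> * \<beta>)"
    using pi_gt_zero by (auto simp: zero_le_mult_iff)
  then show ?thesis by (simp add: algebra_simps)
qed

text \<open>The Cayley transform (P - 1) / (P + 1) maps the half-plane to the disk and sends P(0) =
  1 to 0; Schwarz's lemma bounds it by \<open>cmod z\<close>.\<close>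

lemma Harnack_Re_lower:
  assumes P: "P holomorphic_on disk" "P 0 = 1" "\<And>z. z \<in> disk \<Longrightarrow> Re (P z) \<ge> 0" and z: "z \<in> disk"
  shows "Re (P z) \<ge> (1 - cmod z) / (1 + cmod z)"
proof -
  define \<omega> where "\<omega> = (\<lambda>z. (P z - 1) / (P z + 1))"
  have nz: "P w + 1 \<noteq> 0" if "w \<in> disk" for w
    using P(3)[OF that] by (auto simp: complex_eq_iff)
  have le1: "cmod (P w - 1) \<le> cmod (P w + 1)" if "w \<in> disk" for w
    unfolding cmod_def by (rule real_sqrt_le_mono) (use P(3)[OF that] in \<open>simp add: power2_eq_square algebra_simps\<close>)
  \<comment> \<open>A weak bound on Re P gives only \<open>cmod (\<omega> w) \<le> 1\<close>, while
    Schwarz's lemma wants a strict one; hence the factor t < 1, which then tends to 1.\<close>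
  have "cmod (\<omega> z) \<le> cmod z"
  proof (rule field_le_mult_one_interval)
    fix t :: real assume t: "0 < t" "t < 1"
    have "cmod (of_real t * \<omega> z) \<le> cmod z"
    proof (rule Schwarz_Lemma(1))
      show "(\<lambda>z. of_real t * \<omega> z) holomorphic_on disk"
        unfolding \<omega>_def using nz by (intro holomorphic_intros P) auto
      show "of_real t * \<omega> 0 = 0" by (simp add: \<omega>_def P)
      show "cmod z < 1" using z by simp
      fix w :: complex assume "cmod w < 1"
      then have "cmod (\<omega> w) \<le> 1" using le1[of w] nz[of w] by (simp add: \<omega>_def norm_divide)
      then have "t * cmod (\<omega> w) \<le> t" using t by (intro mult_left_le) auto
      moreover have "cmod (of_real t * \<omega> w) = t * cmod (\<omega> w)" using t by (simp add: norm_mult)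
      ultimately show "cmod (of_real t * \<omega> w) < 1" using t by linarith
    qed
    then show "t * cmod (\<omega> z) \<le> cmod z" using t by (simp add: norm_mult)
  qed
  have "cmod (P z - 1) \<le> cmod z * cmod (P z + 1)"
    using \<open>cmod (\<omega> z) \<le> cmod z\<close> nz[OF z] by (simp add: \<omega>_def norm_divide field_simps)
  define r where "r = cmod z"
  have r: "0 \<le> r" "r < 1" using z by (auto simp: r_def)
  define x where "x = Re (P z)"
  define y where "y = Im (P z)"
  have "(x - 1)\<^sup>2 + y\<^sup>2 \<le> r\<^sup>2 * ((x + 1)\<^sup>2 + y\<^sup>2)"
    using power_mono[OF \<open>cmod (P z - 1) \<le> cmod z * cmod (P z + 1)\<close>, of 2]
    by (simp add: power_mult_distrib cmod_power2 x_def y_def r_def)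
  then have "(x - 1)\<^sup>2 + (1 - r\<^sup>2) * y\<^sup>2 \<le> (r * (x + 1))\<^sup>2"
    by (simp add: power_mult_distrib) (simp add: algebra_simps)
  moreover have "(1 - r\<^sup>2) * y\<^sup>2 \<ge> 0" using r by (simp add: power_le_one)
  ultimately have "(x - 1)\<^sup>2 \<le> (r * (x + 1))\<^sup>2" by simp
  moreover have "r * (x + 1) \<ge> 0" using r P(3)[OF z] by (simp add: x_def)
  ultimately have "\<bar>x - 1\<bar> \<le> r * (x + 1)" by (metis abs_le_square_iff abs_of_nonneg)
  then have "1 - x \<le> r * (x + 1)" by simp
  then show ?thesis using r unfolding r_def[symmetric] x_def[symmetric] by (simp add: field_simps)
qed

text \<open>Turns the weak inequalities left by limits and convolutions back into the strict
  inequality of the class.\<close>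

lemma Re_pos_of_Re_nonneg:
  assumes "P holomorphic_on disk" "P 0 = 1" "\<And>z. z \<in> disk \<Longrightarrow> Re (P z) \<ge> 0" "z \<in> disk"
  shows "Re (P z) > 0"
proof -
  have "0 < (1 - cmod z) / (1 + cmod z)"
    using assms(4) by (auto intro!: divide_pos_pos add_pos_nonneg)
  then show ?thesis using Harnack_Re_lower[OF assms] by linarith
qed

section \<open>Rotations of the co-analytic part, and coefficient bounds\<close>

lemma ex_unit_mult_eq_neg_norm:
  obtains c where "cmod c = 1" "c * y = - of_real (cmod y)"
proof (cases "y = 0")
  case True
  then show ?thesis using that[of 1] by simp
next
  case False
  define c where "c = - cnj y / of_real (cmod y)"
  have "cmod c = 1" using False by (simp add: c_def norm_divide)
  moreover have "c * y = - of_real (cmod y)"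
    using False complex_norm_square[of y] by (simp add: c_def field_simps power2_eq_square)
  ultimately show ?thesis by (rule that)
qed

lemma Re_mult_unit_ge: "cmod c = 1 \<Longrightarrow> - cmod y \<le> Re (c * y)"
  using abs_Re_le_cmod[of "c * y"] by (simp add: norm_mult)

text \<open>The worst c turns c y onto the negative real axis. This equivalence and its strict
  version pass between a pair and its family of rotations at a fixed point.\<close>

lemma Re_add_mult_unit_ge_iff:
  "(\<forall>c. cmod c = 1 \<longrightarrow> Re (x + c * y) \<ge> m) \<longleftrightarrow> Re x - cmod y \<ge> m"
proof (intro iffI allI impI)
  obtain c where c: "cmod c = 1" "c * y = - of_real (cmod y)" by (rule ex_unit_mult_eq_neg_norm)
  assume "\<forall>c. cmod c = 1 \<longrightarrow> Re (x + c * y) \<ge> m"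
  then have "Re (x + c * y) \<ge> m" using c(1) by blast
  then show "Re x - cmod y \<ge> m" by (simp add: c(2) del: times_complex.sel)
next
  fix c :: complex assume "m \<le> Re x - cmod y" "cmod c = 1"
  then show "m \<le> Re (x + c * y)" using Re_mult_unit_ge[of c y] by (simp del: times_complex.sel)
qed

lemma Re_add_mult_unit_gt_iff:
  "(\<forall>c. cmod c = 1 \<longrightarrow> Re (x + c * y) > 0) \<longleftrightarrow> cmod y < Re x"
proof (intro iffI allI impI)
  obtain c where c: "cmod c = 1" "c * y = - of_real (cmod y)" by (rule ex_unit_mult_eq_neg_norm)
  assume "\<forall>c. cmod c = 1 \<longrightarrow> Re (x + c * y) > 0"
  then have "Re (x + c * y) > 0" using c(1) by blast
  then show "cmod y < Re x" by (simp add: c(2) del: times_complex.sel)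
next
  fix c :: complex assume "cmod y < Re x" "cmod c = 1"
  then show "0 < Re (x + c * y)" using Re_mult_unit_ge[of c y] by (simp del: times_complex.sel)
qed

text \<open>Convolve P with 1 + (c/2) z^n, whose real part is at least 1/2. The result 1 + (c/2) p_n
  z^n has nonnegative real part for every unimodular c, so |p_n| r^n \<le> 2; then r tends to
  1.\<close>

lemma Caratheodory_coef_le:
  assumes P: "P holomorphic_on disk" "P 0 = 1" "\<And>z. z \<in> disk \<Longrightarrow> Re (P z) \<ge> 0" and n: "n > 0"
  shows "cmod (coef P n) \<le> 2"
proof -
  have key: "Re (1 + c * (coef P n / 2 * z ^ n)) \<ge> 0" if c: "cmod c = 1" and z: "z \<in> disk" for c z
  proof -
    define B where "B = (\<lambda>z. 1 + c / 2 * z ^ n)"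
    define b where "b = (\<lambda>m. if m = 0 then 1 else if m = n then c / 2 else 0)"
    have fin: "(\<lambda>m. d m * b m * w ^ m) sums (d 0 + d n * (c / 2) * w ^ n)" for w d
      using sums_finite[of "{0, n}" "\<lambda>m. d m * b m * w ^ m"] n by (auto simp: b_def algebra_simps)
    have Bs: "(\<lambda>m. b m * w ^ m) sums B w" for w
      using fin[of "\<lambda>_. 1" w] by (simp add: B_def)
    have B: "B holomorphic_on disk" "B 0 = 1" "coef B m = b m" for m
      using power_series_coef[OF Bs] n by (auto simp: B_def)
    have "Re (hconv P B z) \<ge> 1 - 2 * (1 - 0) * (1 - 1/2)"
    proof (rule hconv_Re_ge[OF P B(1,2) _ z])
      fix w assume "w \<in> disk"
      have "\<bar>Re (c / 2 * w ^ n)\<bar> \<le> cmod (c / 2 * w ^ n)" by (rule abs_Re_le_cmod)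
      also have "\<dots> \<le> 1/2" using \<open>w \<in> disk\<close> c by (simp add: norm_mult norm_power norm_divide power_le_one)
      finally have "\<bar>Re (c / 2 * w ^ n)\<bar> \<le> 1/2" .
      moreover have "Re (B w) = 1 + Re (c / 2 * w ^ n)" unfolding B_def by (simp only: plus_complex.sel one_complex.sel)
      ultimately show "1/2 \<le> Re (B w)" by linarith
    qed
    moreover have "hconv P B z = 1 + c * (coef P n / 2 * z ^ n)"
      using sums_unique2[OF hconv_sums[OF P(1) B(1) z], of "1 + c * (coef P n / 2 * z ^ n)"]
        fin[of "coef P" z] by (simp add: B(3) P(2) algebra_simps)
    ultimately show ?thesis by simp
  qed
  have "cmod (coef P n) / 2 * r ^ n \<le> 1" if r: "0 \<le> r" "r < 1" for r
    using Re_add_mult_unit_ge_iff[of 0 1 "coef P n / 2 * of_real r ^ n"] key[of _ "of_real r"] r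
    by (simp add: norm_mult norm_power norm_divide)
  moreover have "((\<lambda>r. cmod (coef P n) / 2 * r ^ n) \<longlongrightarrow> cmod (coef P n) / 2 * 1 ^ n) (at_left 1)"
    by (intro tendsto_intros)
  moreover have "eventually (\<lambda>r. 0 \<le> r \<and> r < (1::real)) (at_left 1)"
    by (rule eventually_at_leftI[of 0]) auto
  ultimately have "cmod (coef P n) / 2 * 1 ^ n \<le> 1"
    by (intro tendsto_upperbound[where F="at_left (1::real)"]) (auto elim: eventually_mono)
  then show ?thesis by simp
qed

section \<open>The class of functions with Re(F' + z F'') > 0\<close>

lemma has_field_derivative_deriv_disk:
  assumes "f holomorphic_on disk" "z \<in> disk"
  shows "(f has_field_derivative deriv f z) (at z)"
  using holomorphic_derivI[OF assms(1) _ assms(2)] by simp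

lemma deriv_add_cmult:
  assumes "f holomorphic_on disk" "g holomorphic_on disk" "z \<in> disk"
  shows "deriv (\<lambda>z. f z + c * g z) z = deriv f z + c * deriv g z"
  by (rule DERIV_imp_deriv)
     (auto intro!: derivative_eq_intros has_field_derivative_deriv_disk assms)

lemma Lop_add_cmult:
  assumes "f holomorphic_on disk" "g holomorphic_on disk" "z \<in> disk"
  shows "Lop (\<lambda>z. f z + c * g z) z = Lop f z + c * Lop g z"
proof (rule coef_eqI[OF _ _ _ assms(3)])
  have hol: "(\<lambda>z. f z + c * g z) holomorphic_on disk" by (intro holomorphic_intros assms)
  then show "Lop (\<lambda>z. f z + c * g z) holomorphic_on disk" by (rule holomorphic_Lop)
  show "(\<lambda>z. Lop f z + c * Lop g z) holomorphic_on disk" by (intro holomorphic_intros holomorphic_Lop assms)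
  show "coef (Lop (\<lambda>z. f z + c * g z)) n = coef (\<lambda>z. Lop f z + c * Lop g z) n" for n
    using assms by (simp add: coef_Lop[OF hol] coef_Lop coef_add holomorphic_Lop algebra_simps)
qed

lemma Lop_0: "Lop f 0 = deriv f 0" by (simp add: Lop_def)

lemma classW_iff:
  "F \<in> classW \<longleftrightarrow> F holomorphic_on disk \<and> F 0 = 0 \<and> deriv F 0 = 1 \<and> (\<forall>z\<in>disk. Re (Lop F z) > 0)"
  by (auto simp: classW_def classA_def Lop_def)

text \<open>Identities for \<open>hconv\<close> are available only on the disk, since the series may
  diverge outside; membership must not depend on values there.\<close>

lemma classW_cong:
  assumes F: "F \<in> classW" and eq: "\<And>z. z \<in> disk \<Longrightarrow> F z = G z"
  shows "G \<in> classW"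
proof -
  have F': "F holomorphic_on disk" using F by (simp add: classW_iff)
  have G: "G holomorphic_on disk" using F' eq by (rule holomorphic_transform)
  have c: "coef F n = coef G n" for n by (rule coef_cong[OF eq])
  have "Lop F z = Lop G z" if "z \<in> disk" for z
    by (rule coef_eqI[OF _ _ _ that]) (auto simp: holomorphic_Lop F' G coef_Lop c)
  then show ?thesis using F G c[of 0] c[of "Suc 0"] by (simp add: classW_iff coef_1)
qed

lemma WH0_iff:
  "(h, g) \<in> WH0 \<longleftrightarrow> (h, g) \<in> classH \<and> (\<forall>c. cmod c = 1 \<longrightarrow> (\<lambda>z. h z + c * g z) \<in> classW)"
proof (cases "(h, g) \<in> classH")
  case True
  then have hg: "h holomorphic_on disk" "g holomorphic_on disk" "h 0 = 0" "g 0 = 0" "deriv h 0 = 1" "deriv g 0 = 0"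
    by (auto simp: classH_def)
  have "(\<lambda>z. h z + c * g z) \<in> classW \<longleftrightarrow> (\<forall>z\<in>disk. Re (Lop h z + c * Lop g z) > 0)" for c
    using hg by (auto simp: classW_iff deriv_add_cmult Lop_add_cmult intro!: holomorphic_intros)
  then have "(\<forall>c. cmod c = 1 \<longrightarrow> (\<lambda>z. h z + c * g z) \<in> classW) \<longleftrightarrow>
      (\<forall>z\<in>disk. \<forall>c. cmod c = 1 \<longrightarrow> Re (Lop h z + c * Lop g z) > 0)" by blast
  also have "\<dots> \<longleftrightarrow> (\<forall>z\<in>disk. cmod (Lop g z) < Re (Lop h z))"
    by (simp only: Re_add_mult_unit_gt_iff)
  finally show ?thesis using True by (auto simp: WH0_def Lop_def)
qed (auto simp: WH0_def)

lemma WH0_holomorphic: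
  assumes "(h, g) \<in> WH0"
  shows "h holomorphic_on disk" "g holomorphic_on disk" "h 0 = 0" "g 0 = 0" "deriv h 0 = 1" "deriv g 0 = 0"
  using assms by (auto simp: WH0_def classH_def)

lemma classW_coef_le:
  assumes "F \<in> classW" "n \<ge> 2"
  shows "cmod (coef F n) \<le> 2 / (real n)\<^sup>2"
proof -
  have F: "F holomorphic_on disk" "Lop F 0 = 1" "\<And>z. z \<in> disk \<Longrightarrow> Re (Lop F z) \<ge> 0"
    using assms(1) by (auto simp: classW_iff Lop_0 less_imp_le)
  obtain m where m: "n = Suc m" "m > 0" using assms(2) by (cases n) auto
  have "cmod (coef (Lop F) m) \<le> 2"
    by (rule Caratheodory_coef_le[OF holomorphic_Lop[OF F(1)] F(2,3) m(2)])
  then have "(real n)\<^sup>2 * cmod (coef F n) \<le> 2"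
    by (simp add: coef_Lop[OF F(1)] m norm_mult norm_power del: of_nat_Suc)
  then show ?thesis using m by (simp add: field_simps del: of_nat_Suc)
qed

text \<open>The sum is bounded rather than the difference, because the upper growth estimate needs
  both coefficients together.\<close>

lemma WH0_coef_le:
  assumes "(h, g) \<in> WH0" "n \<ge> 2"
  shows "cmod (coef h n) + cmod (coef g n) \<le> 2 / (real n)\<^sup>2"
proof -
  note hg = WH0_holomorphic[OF assms(1)]
  define a where "a = coef h n"
  define b where "b = coef g n"
  have "cmod (a + c * b) \<le> 2 / (real n)\<^sup>2" if "cmod c = 1" for c
    using classW_coef_le[OF _ assms(2), of "\<lambda>z. h z + c * g z"] assms(1) that
    by (simp add: WH0_iff coef_add hg a_def b_def)
  moreover have "\<exists>c. cmod c = 1 \<and> cmod (a + c * b) = cmod a + cmod b"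
  proof (cases "a = 0 \<or> b = 0")
    case True then show ?thesis by (intro exI[of _ 1]) auto
  next
    case False
    \<comment> \<open>This rotation gives \<open>c * b\<close> the argument of \<open>a\<close>, so
      that the triangle inequality becomes an equality.\<close>
    define c where "c = sgn a / sgn b"
    have "a + c * b = sgn a * of_real (cmod a + cmod b)"
      using False by (simp add: c_def sgn_eq algebra_simps)
    then have "cmod (a + c * b) = cmod a + cmod b"
      using False by (simp add: norm_mult norm_sgn del: of_real_add)
    moreover have "cmod c = 1" using False by (simp add: c_def norm_divide norm_sgn)
    ultimately show ?thesis by blast
  qed
  ultimately show ?thesis by (metis a_def b_def)
qed

text \<open>The term \<open>n = 0\<close> is \<open>1 / 0 = 0\<close>.\<close>

definition dilog :: "complex \<Rightarrow> complex" where
  "dilog z = (\<Sum>n. z ^ n / (of_nat n)\<^sup>2)"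

lemma summable_inverse_square: "summable (\<lambda>n. 1 / (real n)\<^sup>2)"
  using inverse_power_summable[of 2, where 'a=real] by (simp add: inverse_eq_divide)

lemma dilog_sums:
  assumes "cmod z \<le> 1"
  shows "(\<lambda>n. z ^ n / (of_nat n)\<^sup>2) sums dilog z"
  unfolding dilog_def
proof (rule summable_sums, rule summable_norm_cancel, rule summable_comparison_test'[OF summable_inverse_square])
  show "norm (cmod (z ^ n / (of_nat n)\<^sup>2)) \<le> 1 / (real n)\<^sup>2" for n
    using assms by (auto simp: norm_divide norm_power power_le_one intro!: divide_right_mono)
qed

text \<open>Continuity is needed up to the boundary: the covering radius comes from the value at -
  1.\<close>

lemma continuous_on_dilog: "continuous_on (cball 0 1) dilog"
proof -
  have "uniform_limit (cball 0 1) (\<lambda>N z. \<Sum>n<N. z ^ n / (of_nat n)\<^sup>2) dilog sequentially"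
    unfolding dilog_def[abs_def]
    by (rule Weierstrass_m_test[OF _ summable_inverse_square])
       (auto simp: norm_divide norm_power power_le_one intro!: divide_right_mono)
  then show ?thesis
    by (rule uniform_limit_theorem[rotated])
       (auto intro!: continuous_intros always_eventually simp: divide_inverse)
qed

lemma dilog_sums': "z \<in> disk \<Longrightarrow> (\<lambda>n. 1 / (of_nat n)\<^sup>2 * z ^ n) sums dilog z"
  using dilog_sums[of z] by simp

lemma holomorphic_dilog: "dilog holomorphic_on disk"
  by (rule power_series_coef[OF dilog_sums'])

lemma coef_dilog: "coef dilog n = 1 / (of_nat n)\<^sup>2"
  by (rule power_series_coef[OF dilog_sums'])

lemma dilog_0 [simp]: "dilog 0 = 0"
  using coef_dilog[of 0] by simp

lemma deriv_dilog:
  assumes z: "z \<in> disk"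
  shows "z * deriv dilog z = - Ln (1 - z)"
proof -
  have "(\<lambda>n. z * (coef (deriv dilog) n * z ^ n)) sums (z * deriv dilog z)"
    by (intro sums_mult coef_sums holomorphic_deriv holomorphic_dilog z) auto
  moreover have "z * (coef (deriv dilog) n * z ^ n) = z ^ Suc n / of_nat (Suc n)" for n
    by (simp add: coef_deriv coef_dilog power2_eq_square del: of_nat_Suc)
  ultimately have "(\<lambda>n. z ^ Suc n / of_nat (Suc n)) sums (z * deriv dilog z)" by simp
  then have "(\<lambda>n. z ^ n / of_nat n) sums (z * deriv dilog z)"
    by (subst (asm) sums_Suc_iff[of "\<lambda>n. z ^ n / of_nat n"]) simp
  moreover have "(\<lambda>n. - (- (z ^ n) / of_nat n)) sums (- Ln (1 - z))"
    using sums_minus[OF Ln_series'[of "- z"]] z by simp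
  ultimately show ?thesis using sums_unique2 by fastforce
qed

definition rdilog :: "real \<Rightarrow> real" where
  "rdilog x = Re (dilog (of_real x))"

lemma dilog_of_real: 
  assumes "\<bar>x\<bar> \<le> 1"
  shows "dilog (of_real x) = of_real (rdilog x)" "(\<lambda>n. x ^ n / (real n)\<^sup>2) sums rdilog x"
proof -
  have *: "(\<lambda>n. complex_of_real (x ^ n / (real n)\<^sup>2)) sums dilog (of_real x)"
    using dilog_sums[of "of_real x"] assms by simp
  from sums_Re[OF this] show "(\<lambda>n. x ^ n / (real n)\<^sup>2) sums rdilog x" by (simp add: rdilog_def)
  from sums_of_real[OF this, where 'a=complex] sums_unique2[OF *]
  show "dilog (of_real x) = of_real (rdilog x)" by simp
qed

lemma has_real_derivative_Re_ray:
  assumes "(f has_field_derivative f') (at (of_real s * e))"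
  shows "((\<lambda>s. Re (f (of_real s * e) * c)) has_real_derivative Re (f' * e * c)) (at s)"
proof -
  have "((\<lambda>s. of_real s * e) has_vector_derivative e) (at s)"
    by (auto intro!: derivative_eq_intros has_vector_derivative_real_field)
  from field_vector_diff_chain_at[OF this assms]
  have "((\<lambda>s. f (of_real s * e)) has_vector_derivative (e * f')) (at s)" by (simp add: o_def)
  then have "((\<lambda>s. f (of_real s * e) * c) has_vector_derivative (e * f' * c)) (at s)"
    by (rule has_vector_derivative_mult_left)
  then have "((\<lambda>s. Re (f (of_real s * e) * c)) has_vector_derivative Re (e * f' * c)) (at s)"
    by (rule bounded_linear.has_vector_derivative[OF bounded_linear_Re])
  then show ?thesis by (simp add: has_real_derivative_iff_has_vector_derivative mult.commute)
qed

lemma rdilog_derivative: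
  assumes "\<bar>x\<bar> < 1" "x \<noteq> 0"
  shows "(rdilog has_real_derivative - ln (1 - x) / x) (at x)"
proof -
  have x: "of_real x \<in> disk" using assms by simp
  have "(rdilog has_real_derivative Re (deriv dilog (of_real x))) (at x)"
    using has_real_derivative_Re_ray[of dilog _ x 1 1] has_field_derivative_deriv_disk[OF holomorphic_dilog x]
    by (simp add: rdilog_def[abs_def])
  moreover have "deriv dilog (of_real x) = of_real (- ln (1 - x) / x)"
    using deriv_dilog[OF x] assms Ln_of_real[of "1 - x"] by (simp add: field_simps)
  ultimately show ?thesis by simp
qed

lemma rdilog_uminus_derivative:
  assumes "0 < x" "x < 1"
  shows "((\<lambda>x. rdilog (- x)) has_real_derivative - ln (1 + x) / x) (at x)"
proof -
  have "(rdilog has_real_derivative - ln (1 - (- x)) / (- x)) (at (- x))"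
    by (rule rdilog_derivative) (use assms in auto)
  moreover have "(uminus has_real_derivative - 1) (at x)" by (auto intro!: derivative_eq_intros)
  ultimately have "((\<lambda>x. rdilog (- x)) has_real_derivative - ln (1 - (- x)) / (- x) * - 1) (at x)"
    by (rule DERIV_chain2)
  then show ?thesis by simp
qed

lemma continuous_on_rdilog: "continuous_on {-1..1} rdilog"
  unfolding rdilog_def
  by (intro continuous_intros continuous_on_compose2[OF continuous_on_dilog]) auto

lemma integral_rdilog:
  assumes "0 \<le> r" "r < 1"
  shows "integral {0..r} (\<lambda>t. ln (1 - t) / t) = - rdilog r"
    and "integral {0..r} (\<lambda>t. ln (1 + t) / t) = - rdilog (- r)"
proof -
  have z: "rdilog 0 = 0" by (simp add: rdilog_def)
  \<comment> \<open>At t = 0 the integrand has the default value 0 instead of its limit - 1, so the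
    antiderivative is differentiated only in the interior and continuity covers the end
    point.\<close>
  have "((\<lambda>t. ln (1 - t) / t) has_integral (- rdilog r - - rdilog 0)) {0..r}"
  proof (rule fundamental_theorem_of_calculus_interior)
    show "continuous_on {0..r} (\<lambda>t. - rdilog t)"
      by (intro continuous_intros continuous_on_subset[OF continuous_on_rdilog]) (use assms in auto)
    fix x assume "x \<in> {0<..<r}"
    then have "((\<lambda>t. - rdilog t) has_real_derivative - (- ln (1 - x) / x)) (at x)"
      using assms by (intro DERIV_minus rdilog_derivative) auto
    then show "((\<lambda>t. - rdilog t) has_vector_derivative ln (1 - x) / x) (at x)"
      by (simp add: has_real_derivative_iff_has_vector_derivative)
  qed (use assms in auto)
  then show "integral {0..r} (\<lambda>t. ln (1 - t) / t) = - rdilog r" using z by (simp add: integral_unique)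
  have "((\<lambda>t. ln (1 + t) / t) has_integral (- rdilog (- r) - - rdilog (- 0))) {0..r}"
  proof (rule fundamental_theorem_of_calculus_interior)
    show "continuous_on {0..r} (\<lambda>t. - rdilog (- t))"
      by (intro continuous_intros continuous_on_compose2[OF continuous_on_rdilog]) (use assms in auto)
    fix x assume x: "x \<in> {0<..<r}"
    have "((\<lambda>t. - rdilog (- t)) has_real_derivative ln (1 + x) / x) (at x)"
      using x assms DERIV_minus[OF rdilog_uminus_derivative[of x]] by simp
    then show "((\<lambda>t. - rdilog (- t)) has_vector_derivative ln (1 + x) / x) (at x)"
      by (simp add: has_real_derivative_iff_has_vector_derivative)
  qed (use assms in auto)
  then show "integral {0..r} (\<lambda>t. ln (1 + t) / t) = - rdilog (- r)" using z by (simp add: integral_unique)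
qed

text \<open>On a ray s e with \<open>cmod e = 1\<close>, the function Re (f(s e) cnj e) has
  derivative Re (f'(s e)), so a radial minorant of Re f' integrates. The origin is excluded because
  logarithmic minorants divide by s; continuity of \<psi> covers it.\<close>

lemma Re_radial_lower:
  assumes f: "f holomorphic_on disk" "f 0 = 0"
    and \<psi>: "continuous_on {0..<1} \<psi>" "\<psi> 0 = 0"
      "\<And>s. 0 < s \<Longrightarrow> s < 1 \<Longrightarrow> (\<psi> has_real_derivative \<psi>' s) (at s)"
    and le: "\<And>z. z \<in> disk \<Longrightarrow> z \<noteq> 0 \<Longrightarrow> \<psi>' (cmod z) \<le> Re (deriv f z)"
    and z: "z \<in> disk"
  shows "cmod z * \<psi> (cmod z) \<le> Re (f z * cnj z)"
proof (cases "z = 0")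
  case False
  define r where "r = cmod z"
  define e where "e = z / of_real r"
  have r: "0 < r" "r < 1" using False z by (auto simp: r_def)
  have e: "cmod e = 1" "of_real r * e = z" using r by (auto simp: e_def r_def norm_divide)
  have ee: "e * cnj e = 1" using e(1) complex_norm_square[of e] by simp
  define D where "D = (\<lambda>s. Re (f (of_real s * e) * cnj e) - \<psi> s)"
  have "D 0 \<le> D r"
  proof (rule DERIV_nonneg_imp_increasing_open[of 0 r D])
    show "0 \<le> r" using r by simp
    fix s assume s: "0 < s" "s < r"
    then have sd: "of_real s * e \<in> disk" "of_real s * e \<noteq> 0" "cmod (of_real s * e) = s"
      using r e by (auto simp: norm_mult)
    have "(D has_real_derivative Re (deriv f (of_real s * e) * e * cnj e) - \<psi>' s) (at s)"
      unfolding D_def using s r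
      by (intro DERIV_diff has_real_derivative_Re_ray has_field_derivative_deriv_disk f \<psi> sd) auto
    moreover have "deriv f (of_real s * e) * e * cnj e = deriv f (of_real s * e)"
      by (simp add: ee mult.assoc)
    moreover have "\<psi>' s \<le> Re (deriv f (of_real s * e))" using le[OF sd(1,2)] sd(3) by simp
    ultimately show "\<exists>y. (D has_real_derivative y) (at s) \<and> 0 \<le> y" by (metis diff_ge_0_iff_ge)
  next
    show "continuous_on {0..r} D" unfolding D_def
    proof (intro continuous_intros)
      show "continuous_on {0..r} (\<lambda>s. f (of_real s * e))"
        by (rule continuous_on_compose2[OF holomorphic_on_imp_continuous_on[OF f(1)]])
           (use r e in \<open>auto intro!: continuous_intros simp: norm_mult\<close>)
      show "continuous_on {0..r} \<psi>" by (rule continuous_on_subset[OF \<psi>(1)]) (use r in auto)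
    qed
  qed
  then have "\<psi> r \<le> Re (f z * cnj e)" by (simp add: D_def f \<psi> e)
  then have "r * \<psi> r \<le> r * Re (f z * cnj e)" using r by simp
  also have "r * Re (f z * cnj e) = Re (f z * cnj (of_real r * e))" by (simp add: algebra_simps)
  finally have "r * \<psi> r \<le> Re (f z * cnj z)" by (simp only: e(2))
  then show ?thesis by (simp add: r_def)
qed auto

lemma Re_dquot_ge:
  assumes "f 0 = 0" "z \<noteq> 0" "cmod z * \<psi> \<le> Re (f z * cnj z)"
  shows "\<psi> / cmod z \<le> Re (dquot f z)"
proof -
  have "f z * cnj z = dquot f z * of_real ((cmod z)\<^sup>2)"
    using assms(2) by (simp add: dquot_def field_simps complex_norm_square del: of_real_power)
  then have "cmod z * \<psi> \<le> Re (dquot f z) * (cmod z)\<^sup>2" using assms(3) by simp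
  then show ?thesis using assms(2) by (simp add: field_simps power2_eq_square)
qed

lemma deriv_times_self:
  assumes "F holomorphic_on disk" "z \<in> disk"
  shows "deriv (\<lambda>z. z * deriv F z) z = Lop F z"
  by (rule DERIV_imp_deriv)
     (use assms in \<open>auto simp: Lop_def intro!: derivative_eq_intros has_field_derivative_deriv_disk holomorphic_deriv\<close>)

lemma classW_Re_Lop:
  assumes "F \<in> classW" "z \<in> disk"
  shows "(1 - cmod z) / (1 + cmod z) \<le> Re (Lop F z)"
  using assms by (intro Harnack_Re_lower holomorphic_Lop) (auto simp: classW_iff Lop_0 less_imp_le)

text \<open>Radial integration applied to z F'(z), whose derivative is \<open>Lop F\<close>. The
  function \<psi> is left free so that the exact antiderivative of Harnack's bound and a polynomial
  below it can both be inserted.\<close>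

lemma classW_Re_deriv_radial:
  assumes F: "F \<in> classW"
    and \<psi>: "continuous_on {0..<1} \<psi>" "\<psi> 0 = 0"
      "\<And>s. 0 < s \<Longrightarrow> s < 1 \<Longrightarrow> (\<psi> has_real_derivative \<psi>' s) (at s)"
    and le: "\<And>s. 0 < s \<Longrightarrow> s < 1 \<Longrightarrow> \<psi>' s \<le> (1 - s) / (1 + s)"
    and z: "z \<in> disk" "z \<noteq> 0"
  shows "\<psi> (cmod z) / cmod z \<le> Re (deriv F z)"
proof -
  have F': "F holomorphic_on disk" using F by (simp add: classW_iff)
  have "cmod z * \<psi> (cmod z) \<le> Re (z * deriv F z * cnj z)"
  proof (rule Re_radial_lower[OF _ _ \<psi> _ z(1)])
    fix w assume w: "w \<in> disk" "w \<noteq> 0"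
    show "\<psi>' (cmod w) \<le> Re (deriv (\<lambda>z. z * deriv F z) w)"
      using order_trans[OF le classW_Re_Lop[OF F w(1)]] w by (simp add: deriv_times_self[OF F' w(1)])
  qed (use F' in \<open>auto intro!: holomorphic_intros\<close>)
  then show ?thesis using Re_dquot_ge[of "\<lambda>z. z * deriv F z" z "\<psi> (cmod z)"] z by (simp add: dquot_def)
qed

lemma classW_Re_deriv:
  assumes F: "F \<in> classW" and z: "z \<in> disk" "z \<noteq> 0"
  shows "2 * ln (1 + cmod z) / cmod z - 1 \<le> Re (deriv F z)"
proof -
  have "(2 * ln (1 + cmod z) - cmod z) / cmod z \<le> Re (deriv F z)"
    by (rule classW_Re_deriv_radial[OF F _ _ _ _ z, of _ "\<lambda>s. 2 / (1 + s) - 1"])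
       (auto intro!: continuous_intros derivative_eq_intros simp: field_simps)
  then show ?thesis using z by (simp add: diff_divide_distrib)
qed

text \<open>Harnack's bound (1 - s) / (1 + s) is replaced by the start 1 - 2 s + 2 s^2 - 2 s^3 of
  its power series. Integrating and dividing by s twice gives 1 - s/2 + 2 s^2/9 - s^3/8, whose value
  at s = 1 is 43/72. A rational constant is convenient for the comparison in the convexity
  proof.\<close>

lemma classW_Re_dquot_poly:
  assumes F: "F \<in> classW" and z: "z \<in> disk"
  shows "43/72 \<le> Re (dquot F z)"
proof (cases "z = 0")
  case True then show ?thesis using F by (simp add: dquot_def classW_iff)
next
  case False
  have F': "F holomorphic_on disk" "F 0 = 0" using F by (auto simp: classW_iff)
  have d: "1 - cmod w + 2/3 * cmod w ^ 2 - 1/2 * cmod w ^ 3 \<le> Re (deriv F w)" if w: "w \<in> disk" "w \<noteq> 0" for w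
  proof -
    let ?s = "cmod w"
    have "(?s - ?s ^ 2 + 2/3 * ?s ^ 3 - 1/2 * ?s ^ 4) / ?s \<le> Re (deriv F w)"
    proof (rule classW_Re_deriv_radial[OF F _ _ _ _ w, of _ "\<lambda>s. 1 - 2 * s + 2 * s ^ 2 - 2 * s ^ 3"])
      fix s :: real assume "0 < s" "s < 1"
      \<comment> \<open>The remainder - 2 s^4 is negative, so this truncation lies below the full
        quotient.\<close>
      moreover have "(1 - 2 * s + 2 * s\<^sup>2 - 2 * s ^ 3) * (1 + s) = 1 - s - 2 * s ^ 4"
        by algebra
      ultimately show "1 - 2 * s + 2 * s\<^sup>2 - 2 * s ^ 3 \<le> (1 - s) / (1 + s)"
        by (subst pos_le_divide_eq) auto
    qed (auto intro!: continuous_intros derivative_eq_intros)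
    then show ?thesis using w by (simp add: diff_divide_distrib add_divide_distrib power2_eq_square power3_eq_cube power4_eq_xxxx)
  qed
  let ?s = "cmod z"
  have s: "0 < ?s" "?s < 1" using z False by auto
  have "?s * (?s - 1/2 * ?s ^ 2 + 2/9 * ?s ^ 3 - 1/8 * ?s ^ 4) \<le> Re (F z * cnj z)"
    by (rule Re_radial_lower[OF F' _ _ _ d z]) (auto intro!: continuous_intros derivative_eq_intros)
  from Re_dquot_ge[where f=F and z=z, OF F'(2) False this]
  have "1 - 1/2 * ?s + 2/9 * ?s ^ 2 - 1/8 * ?s ^ 3 \<le> Re (dquot F z)"
    using s by (simp add: diff_divide_distrib add_divide_distrib power2_eq_square power3_eq_cube power4_eq_xxxx)
  \<comment> \<open>Splitting off the factor 1 - s leaves a quadratic that is positive on [0, 1];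
    hence the cubic is smallest at s = 1.\<close>
  moreover have "0 \<le> (1 - ?s) * (29/72 - 7/72 * ?s + 1/8 * ?s\<^sup>2)"
    using s by (intro mult_nonneg_nonneg add_nonneg_nonneg) auto
  moreover have "1 - 1/2 * ?s + 2/9 * ?s ^ 2 - 1/8 * ?s ^ 3 = 43/72 + (1 - ?s) * (29/72 - 7/72 * ?s + 1/8 * ?s\<^sup>2)"
    by (simp add: field_simps power2_eq_square power3_eq_cube)
  ultimately show ?thesis by linarith
qed

text \<open>This is \<open>- s + 2 \<integral>\<^sub>0\<^sup>s ln (1 + t) / t dt\<close>.\<close>

definition Qlow :: "real \<Rightarrow> real" where "Qlow s = - s - 2 * rdilog (- s)"

lemma Qlow_0 [simp]: "Qlow 0 = 0" by (simp add: Qlow_def rdilog_def)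

lemma continuous_on_Qlow: "continuous_on {0..1} Qlow"
  unfolding Qlow_def
  by (intro continuous_intros continuous_on_compose2[OF continuous_on_rdilog]) auto

lemma Qlow_derivative:
  assumes "0 < s" "s < 1"
  shows "(Qlow has_real_derivative 2 * ln (1 + s) / s - 1) (at s)"
  unfolding Qlow_def using assms
  by (auto intro!: derivative_eq_intros rdilog_uminus_derivative)

text \<open>The second radial integration with the exact antiderivative; this is the source of the
  sharp lower growth bound.\<close>

lemma classW_Re_dquot:
  assumes F: "F \<in> classW" and z: "z \<in> disk" "z \<noteq> 0"
  shows "Qlow (cmod z) / cmod z \<le> Re (dquot F z)"
proof -
  have F': "F holomorphic_on disk" "F 0 = 0" using F by (auto simp: classW_iff)
  have "cmod z * Qlow (cmod z) \<le> Re (F z * cnj z)"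
    by (rule Re_radial_lower[OF F' _ _ Qlow_derivative classW_Re_deriv[OF F] z(1)])
       (auto intro: continuous_on_subset[OF continuous_on_Qlow])
  then show ?thesis by (rule Re_dquot_ge[where f=F and z=z, OF F'(2) z(2)])
qed

lemma ln_2_lower: "69/100 \<le> ln (2::real)"
  using ln_approx_bounds[of 2 3] by (simp add: eval_nat_numeral)

lemma mult_ln_2_le:
  assumes "0 \<le> s" "s \<le> (1::real)"
  shows "s * ln 2 \<le> ln (1 + s)"
proof -
  have "exp ((1 - s) *\<^sub>R 0 + s *\<^sub>R ln 2) \<le> (1 - s) * exp 0 + s * exp (ln (2::real))"
    by (rule convex_onD[OF exp_convex]) (use assms in auto)
  then have "exp (s * ln 2) \<le> 1 + s" by simp
  then show ?thesis using assms by (subst ln_ge_iff) auto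
qed

text \<open>By concavity ln (1 + s) / s is at least ln 2 on (0, 1], and 2 (0.69) - 1 = 0.38.\<close>

lemma classW_Re_deriv_const:
  assumes F: "F \<in> classW" and z: "z \<in> disk"
  shows "38/100 \<le> Re (deriv F z)"
proof (cases "z = 0")
  case True then show ?thesis using F by (simp add: classW_iff)
next
  case False
  have "69/100 * cmod z \<le> ln (1 + cmod z)"
    using mult_ln_2_le[of "cmod z"] ln_2_lower mult_left_mono[OF ln_2_lower, of "cmod z"] z by simp
  then have "69/100 \<le> ln (1 + cmod z) / cmod z" using False by (simp add: field_simps)
  then show ?thesis
    using classW_Re_deriv[OF F z False] unfolding times_divide_eq_right[symmetric] by linarith
qed

section \<open>Stability under convolution\<close>

lemma holomorphic_on_compose':
  assumes "f holomorphic_on B" "g holomorphic_on A" "\<And>x. x \<in> A \<Longrightarrow> g x \<in> B"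
  shows "(\<lambda>x. f (g x)) holomorphic_on A"
  using holomorphic_on_compose_gen[OF assms(2,1)] assms(3) by (auto simp: o_def)

lemma classA_iff: "\<phi> \<in> classA \<longleftrightarrow> \<phi> holomorphic_on disk \<and> \<phi> 0 = 0 \<and> deriv \<phi> 0 = 1"
  by (auto simp: classA_def)

lemma hconv_0: "f holomorphic_on disk \<Longrightarrow> g holomorphic_on disk \<Longrightarrow> hconv f g 0 = f 0 * g 0"
  using coef_hconv[of f g 0] by simp

lemma deriv_hconv_0:
  "f holomorphic_on disk \<Longrightarrow> g holomorphic_on disk \<Longrightarrow> deriv (hconv f g) 0 = deriv f 0 * deriv g 0"
  using coef_hconv[of f g "Suc 0"] by (simp add: coef_1)

text \<open>Moving \<open>Lop\<close> to F and \<open>dquot\<close> to \<phi> puts the convolution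
  bound at its threshold 1 - 2 (1 - 0) (1 - 1/2) = 0; strictness follows from the
  normalisation.\<close>

lemma classW_hconv:
  assumes F: "F \<in> classW" and \<phi>: "\<phi> \<in> classA" and ge: "\<And>z. z \<in> disk \<Longrightarrow> Re (dquot \<phi> z) \<ge> 1/2"
  shows "hconv F \<phi> \<in> classW"
proof -
  have F': "F holomorphic_on disk" "F 0 = 0" "deriv F 0 = 1" "\<And>z. z \<in> disk \<Longrightarrow> Re (Lop F z) > 0"
    using F by (auto simp: classW_iff)
  have \<phi>': "\<phi> holomorphic_on disk" "\<phi> 0 = 0" "deriv \<phi> 0 = 1" using \<phi> by (auto simp: classA_iff)
  have hol: "hconv F \<phi> holomorphic_on disk" by (rule holomorphic_hconv[OF F'(1) \<phi>'(1)])
  have d0: "deriv (hconv F \<phi>) 0 = 1" by (simp add: deriv_hconv_0 F' \<phi>')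
  have "Re (Lop (hconv F \<phi>) z) \<ge> 0" if z: "z \<in> disk" for z
    using hconv_Re_ge[of "Lop F" 0 "dquot \<phi>" "1/2" z] ge F'(4) z
    by (simp add: Lop_hconv F' \<phi>' holomorphic_Lop holomorphic_dquot Lop_0 dquot_def[of _ 0] less_imp_le)
  then have "Re (Lop (hconv F \<phi>) z) > 0" if "z \<in> disk" for z
    using that Re_pos_of_Re_nonneg[OF holomorphic_Lop[OF hol]] by (simp add: Lop_0 d0)
  then show ?thesis by (simp add: classW_iff hol d0 hconv_0 F' \<phi>')
qed

lemma WH0_tconv:
  assumes p: "p \<in> WH0" and \<phi>: "\<phi> \<in> classA" and ge: "\<And>z. z \<in> disk \<Longrightarrow> Re (dquot \<phi> z) \<ge> 1/2"
  shows "tconv \<phi> p \<in> WH0"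
proof -
  obtain h g where p': "p = (h, g)" by (cases p)
  note hg = WH0_holomorphic[OF p[unfolded p']]
  have \<phi>': "\<phi> holomorphic_on disk" "\<phi> 0 = 0" "deriv \<phi> 0 = 1" using \<phi> by (auto simp: classA_iff)
  have "(hconv h \<phi>, hconv g \<phi>) \<in> WH0"
    unfolding WH0_iff
  proof safe
    show "(hconv h \<phi>, hconv g \<phi>) \<in> classH"
      by (simp add: classH_def holomorphic_hconv hg \<phi>' hconv_0 deriv_hconv_0)
    fix c :: complex assume c: "cmod c = 1"
    have "hconv (\<lambda>z. h z + c * g z) \<phi> \<in> classW"
      using p c by (intro classW_hconv \<phi> ge) (auto simp: p' WH0_iff)
    moreover have eq: "hconv (\<lambda>z. h z + c * g z) \<phi> z = hconv h \<phi> z + c * hconv g \<phi> z" if "z \<in> disk" for z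
      by (rule hconv_add) (use hg \<phi>' that in auto)
    ultimately show "(\<lambda>z. hconv h \<phi> z + c * hconv g \<phi> z) \<in> classW"
      by (rule classW_cong)
  qed
  then show ?thesis by (simp add: tconv_def p')
qed

lemma classW_dquot: "F \<in> classW \<Longrightarrow> z \<in> disk \<Longrightarrow> Re (dquot F z) \<ge> 1/2"
  using classW_Re_dquot_poly[of F z] by simp

lemma classW_classA: "F \<in> classW \<Longrightarrow> F \<in> classA" by (simp add: classW_def)

lemma classW_convex2:
  assumes "F \<in> classW" "G \<in> classW"
  shows "(\<lambda>z. (F z + G z) / 2) \<in> classW"
proof -
  have FG: "F holomorphic_on disk" "G holomorphic_on disk" using assms by (auto simp: classW_iff)
  define K where "K = (\<lambda>z. F z + 1 * G z)"
  have K: "K holomorphic_on disk" unfolding K_def by (intro holomorphic_intros FG)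
  have dK: "deriv K z = deriv F z + 1 * deriv G z" "Lop K z = Lop F z + 1 * Lop G z" if "z \<in> disk" for z
    unfolding K_def by (rule deriv_add_cmult Lop_add_cmult; use FG that in simp)+
  define M where "M = (\<lambda>z. 0 + 1/2 * K z)"
  have M: "M holomorphic_on disk" unfolding M_def by (intro holomorphic_intros K)
  have dM: "deriv M z = deriv (\<lambda>_. 0) z + 1/2 * deriv K z" "Lop M z = Lop (\<lambda>_. 0) z + 1/2 * Lop K z"
    if "z \<in> disk" for z
    unfolding M_def by (rule deriv_add_cmult Lop_add_cmult; use K that in simp)+
  have "Lop (\<lambda>_. 0) z = 0" for z by (simp add: Lop_def)
  then have "M \<in> classW"
    using assms M by (simp add: classW_iff dM dK add_pos_pos) (simp add: M_def K_def)
  moreover have "(\<lambda>z. (F z + G z) / 2) = M" by (auto simp: M_def K_def)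
  ultimately show ?thesis by simp
qed

text \<open>The convolution of h + a g with H + b G contains the mixed terms b h * G and a g * H.
  Averaging over (a, b) = (1, c) and (- 1, - c) cancels them and leaves h * H + c g * G, and the
  class is closed under this mean.\<close>

lemma WH0_harm_conv:
  assumes p: "p \<in> WH0" and q: "q \<in> WH0"
  shows "harm_conv p q \<in> WH0"
proof -
  obtain h g where p': "p = (h, g)" by (cases p)
  obtain H G where q': "q = (H, G)" by (cases q)
  note hg = WH0_holomorphic[OF p[unfolded p']]
  note HG = WH0_holomorphic[OF q[unfolded q']]
  have "(hconv h H, hconv g G) \<in> WH0"
    unfolding WH0_iff
  proof safe
    show "(hconv h H, hconv g G) \<in> classH"
      by (simp add: classH_def holomorphic_hconv hg HG hconv_0 deriv_hconv_0)
    fix c :: complex assume c: "cmod c = 1"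
    have W: "hconv (\<lambda>z. h z + a * g z) (\<lambda>z. H z + b * G z) \<in> classW" if "cmod a = 1" "cmod b = 1" for a b
    proof -
      have "(\<lambda>z. h z + a * g z) \<in> classW" "(\<lambda>z. H z + b * G z) \<in> classW"
        using p q that by (auto simp: p' q' WH0_iff)
      then show ?thesis by (intro classW_hconv classW_dquot classW_classA)
    qed
    define A where "A = hconv (\<lambda>z. h z + (-1) * g z) (\<lambda>z. H z + (- c) * G z)"
    define B where "B = hconv (\<lambda>z. h z + 1 * g z) (\<lambda>z. H z + c * G z)"
    have "A \<in> classW" "B \<in> classW" unfolding A_def B_def by (intro W; use c in simp)+
    then have "(\<lambda>z. (A z + B z) / 2) \<in> classW" by (rule classW_convex2)
    moreover have "(A z + B z) / 2 = hconv h H z + c * hconv g G z" if z: "z \<in> disk" for z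
    proof -
      have e: "hconv (\<lambda>z. h z + a * g z) (\<lambda>z. H z + b * G z) z
          = hconv h H z + b * hconv h G z + a * (hconv g H z + b * hconv g G z)" for a b
      proof -
        have "hconv (\<lambda>z. h z + a * g z) (\<lambda>z. H z + b * G z) z
          = hconv h (\<lambda>z. H z + b * G z) z + a * hconv g (\<lambda>z. H z + b * G z) z"
          by (rule hconv_add) (use hg HG z in \<open>auto intro!: holomorphic_intros\<close>)
        also have "hconv h (\<lambda>z. H z + b * G z) z = hconv h H z + b * hconv h G z"
          by (subst (1 2 3) hconv_commute, rule hconv_add) (use hg HG z in auto)
        also have "hconv g (\<lambda>z. H z + b * G z) z = hconv g H z + b * hconv g G z"
          by (subst (1 2 3) hconv_commute, rule hconv_add) (use hg HG z in auto)
        finally show ?thesis .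
      qed
      show ?thesis unfolding A_def B_def e by (simp add: algebra_simps)
    qed
    ultimately show "(\<lambda>z. hconv h H z + c * hconv g G z) \<in> classW"
      by (rule classW_cong)
  qed
  then show ?thesis by (simp add: harm_conv_def p' q')
qed

section \<open>First contact: starlikeness and convexity of analytic functions\<close>

lemma has_real_derivative_Re_arc:
  assumes "(p has_field_derivative p') (at (z * cis t))"
  shows "((\<lambda>t. Re (p (z * cis t) * c)) has_real_derivative Re (\<i> * (z * cis t) * p' * c)) (at t)"
proof -
  have "((\<lambda>t. z * cis t) has_vector_derivative z * (\<i> * cis t)) (at t)"
    unfolding cis_conv_exp
    by (auto intro!: derivative_eq_intros has_vector_derivative_real_field)
  from field_vector_diff_chain_at[OF this assms]
  have "((\<lambda>t. p (z * cis t)) has_vector_derivative (z * (\<i> * cis t) * p')) (at t)" by (simp add: o_def)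
  then have "((\<lambda>t. p (z * cis t) * c) has_vector_derivative (z * (\<i> * cis t) * p' * c)) (at t)"
    by (rule has_vector_derivative_mult_left)
  then have "((\<lambda>t. Re (p (z * cis t) * c)) has_vector_derivative Re (z * (\<i> * cis t) * p' * c)) (at t)"
    by (rule bounded_linear.has_vector_derivative[OF bounded_linear_Re])
  moreover have "z * (\<i> * cis t) * p' * c = \<i> * (z * cis t) * p' * c" by (simp add: mult_ac)
  ultimately show ?thesis by (simp add: has_real_derivative_iff_has_vector_derivative)
qed

text \<open>
  At a point of minimal modulus where \<open>Re p\<close> vanishes, the tangential derivative of \<open>Re p\<close> is
  zero, and the Harnack bound \<open>(1 - s) / (1 + s)\<close> along the radius forces the radial derivative
  to be at most \<open>- 1/2\<close>.
\<close>

lemma Re_pos_first_contact: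
  assumes p: "p holomorphic_on disk" "p 0 = 1"
    and no: "\<And>z. z \<in> disk \<Longrightarrow> Re (p z) = 0 \<Longrightarrow> Im (z * deriv p z) = 0 \<Longrightarrow> Re (z * deriv p z) \<le> - 1/2 \<Longrightarrow> False"
    and z: "z \<in> disk"
  shows "Re (p z) > 0"
proof (rule ccontr)
  assume "\<not> Re (p z) > 0"
  define S where "S = {w \<in> cball 0 (cmod z). Re (p w) \<le> 0}"
  have sub: "cball 0 (cmod z) \<subseteq> disk" using z by auto
  have contp: "continuous_on disk p" by (rule holomorphic_on_imp_continuous_on[OF p(1)])
  have "closed S" unfolding S_def
    by (intro continuous_on_closed_Collect_le) (auto intro!: continuous_intros continuous_on_subset[OF contp sub])
  then have "compact S"
    by (metis (no_types, lifting) S_def bounded_cball bounded_subset compact_eq_bounded_closed mem_Collect_eq subsetI)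
  moreover have "z \<in> S" using \<open>\<not> Re (p z) > 0\<close> by (simp add: S_def)
  ultimately obtain z0 where z0: "z0 \<in> S" "\<And>w. w \<in> S \<Longrightarrow> cmod z0 \<le> cmod w"
    using continuous_attains_inf[of S cmod] by (auto intro!: continuous_intros)
  have z0d: "z0 \<in> disk" and z0le: "cmod z0 \<le> cmod z" using z0(1) sub by (auto simp: S_def)
  have pos: "Re (p w) > 0" if "cmod w < cmod z0" for w
    using z0(2)[of w] that z0le by (force simp: S_def)
  have "z0 \<noteq> 0" using z0(1) p(2) by (auto simp: S_def)
  have ray: "s *\<^sub>R z0 \<in> disk" if "0 \<le> s" "s \<le> 1" for s
    using that z0d by (auto intro: le_less_trans[OF mult_left_le_one_le])
  define r where "r = (\<lambda>s. Re (p (of_real s * z0) * 1))"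
  have rd: "(r has_real_derivative Re (deriv p z0 * z0)) (at 1)"
    using has_real_derivative_Re_ray[of p "deriv p z0" 1 z0 1] has_field_derivative_deriv_disk[OF p(1) z0d]
    by (simp add: r_def)
  \<comment> \<open>Harnack's inequality is applied to \<open>p (w * z0)\<close> as a function of w:
    for \<open>cmod w < 1\<close> the argument is closer to 0 than \<open>z0\<close>, where Re p is
    positive.\<close>
  have rlow: "(1 - s) / (1 + s) \<le> r s" if s: "0 \<le> s" "s < 1" for s
  proof -
    have "(1 - cmod (of_real s)) / (1 + cmod (of_real s)) \<le> Re ((\<lambda>w. p (w * z0)) (of_real s))"
    proof (rule Harnack_Re_lower)
      have in_disk: "w * z0 \<in> disk" if "w \<in> disk" for w
        using that z0d by (auto simp: norm_mult intro: le_less_trans[OF mult_left_le_one_le])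
      show "(\<lambda>w. p (w * z0)) holomorphic_on disk"
        by (rule holomorphic_on_compose'[OF p(1) _ in_disk]) (intro holomorphic_intros)
      show "Re (p (w * z0)) \<ge> 0" if "w \<in> disk" for w
        using that \<open>z0 \<noteq> 0\<close> by (intro less_imp_le pos) (simp add: norm_mult)
    qed (use p s in auto)
    then show ?thesis using s by (simp add: r_def)
  qed
  have lim: "(r \<longlongrightarrow> r 1) (at_left 1)"
    using DERIV_isCont[OF rd] by (simp add: isCont_def filterlim_at_split)
  moreover have "eventually (\<lambda>s. 0 \<le> r s) (at_left 1)"
    by (rule eventually_at_leftI[of 0]) (auto intro!: order_trans[OF _ rlow])
  ultimately have "r 1 \<ge> 0" by (intro tendsto_lowerbound[OF lim]) auto
  then have re0: "Re (p z0) = 0" using z0(1) by (simp add: r_def S_def)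
  \<comment> \<open>D is nonnegative below 1 and vanishes at 1, so D'(1) \<le> 0; the summand 1/2 is
    minus the slope of (1 - s) / (1 + s) at 1.\<close>
  define D where "D = (\<lambda>s. r s - (1 - s) / (1 + s))"
  have Dd: "(D has_real_derivative Re (z0 * deriv p z0) + 1/2) (at 1)"
    unfolding D_def by (auto intro!: derivative_eq_intros rd simp: mult.commute)
  have le: "Re (z0 * deriv p z0) \<le> - 1/2"
  proof (rule ccontr)
    assume "\<not> ?thesis"
    then obtain d where d: "d > 0" "\<And>h. 0 < h \<Longrightarrow> h < d \<Longrightarrow> D (1 - h) < D 1"
      using DERIV_pos_inc_left[OF Dd] by fastforce
    define h where "h = min (d / 2) 1"
    have h: "0 < h" "h < d" "h \<le> 1" using d(1) by (auto simp: h_def)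
    have "D 1 = 0" using re0 by (simp add: D_def r_def)
    with d(2)[OF h(1,2)] rlow[of "1 - h"] h show False by (simp add: D_def)
  qed
  define q where "q = (\<lambda>t. Re (p (z0 * cis t) * 1))"
  have qd: "(q has_real_derivative Re (\<i> * z0 * deriv p z0)) (at 0)"
    using has_real_derivative_Re_arc[of p "deriv p z0" z0 0 1] has_field_derivative_deriv_disk[OF p(1) z0d]
    by (simp add: q_def)
  have q0: "q t \<ge> 0" for t
  proof -
    have "((\<lambda>s. Re (p (of_real s * (z0 * cis t)))) \<longlongrightarrow> Re (p (of_real 1 * (z0 * cis t)))) (at_left 1)"
    proof -
      have "isCont p (of_real 1 * (z0 * cis t))"
        using contp z0d by (simp add: continuous_on_eq_continuous_at norm_mult)
      then have "isCont (\<lambda>s. p (of_real s * (z0 * cis t))) 1"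
        by (intro isCont_o2[where g=p and f="\<lambda>s. of_real s * (z0 * cis t)"]) (auto intro!: continuous_intros)
      then have "isCont (\<lambda>s. Re (p (of_real s * (z0 * cis t)))) 1"
        by (rule isCont_Re)
      then show ?thesis by (simp add: isCont_def filterlim_at_split)
    qed
    moreover have "eventually (\<lambda>s. 0 \<le> Re (p (of_real s * (z0 * cis t)))) (at_left 1)"
      by (rule eventually_at_leftI[of 0]) (auto intro!: less_imp_le[OF pos] simp: norm_mult \<open>z0 \<noteq> 0\<close>)
    ultimately show ?thesis unfolding q_def by (auto dest: tendsto_lowerbound)
  qed
  have "Re (\<i> * z0 * deriv p z0) = 0"
    by (rule DERIV_local_min[OF qd, of 1]) (use q0 re0 in \<open>auto simp: q_def\<close>)
  then have im: "Im (z0 * deriv p z0) = 0" by (simp add: algebra_simps)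
  show False by (rule no[OF z0d re0 im le])
qed

lemma Re_divide_pos_iff: "y \<noteq> 0 \<Longrightarrow> Re (x / y) > 0 \<longleftrightarrow> Re (x * cnj y) > 0"
  by (simp add: Re_complex_div_gt_0)

lemma Re_divide_nonneg_iff: "y \<noteq> 0 \<Longrightarrow> Re (x / y) \<ge> 0 \<longleftrightarrow> Re (x * cnj y) \<ge> 0"
  by (simp add: Re_complex_div_ge_0)

text \<open>
  With \<open>p = V / U\<close> one has \<open>V + z V' = U (p\<^sup>2 + z p')\<close>, which contradicts \<open>W\<close> at a contact
  point.  For \<open>U = F / z\<close> the conclusion is starlikeness of \<open>F\<close>, for \<open>U = F'\<close> it is convexity.
\<close>

lemma Re_quotient_pos:
  assumes U: "U holomorphic_on disk" "U 0 = 1" "\<And>z. z \<in> disk \<Longrightarrow> Re (U z) > 0"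
    and V: "V holomorphic_on disk" "\<And>z. z \<in> disk \<Longrightarrow> V z = U z + z * deriv U z"
    and W: "\<And>z. z \<in> disk \<Longrightarrow> Re (V z + z * deriv V z) > - 1/2 * Re (U z)"
    and z: "z \<in> disk"
  shows "Re (V z / U z) > 0"
proof (rule Re_pos_first_contact[where p="\<lambda>z. V z / U z"])
  have nz: "U z \<noteq> 0" if "z \<in> disk" for z using U(3)[OF that] by auto
  show "(\<lambda>z. V z / U z) holomorphic_on disk" using nz by (intro holomorphic_intros U V) auto
  show "V 0 / U 0 = 1" by (simp add: V U)
  fix z assume z: "z \<in> disk"
  define p where "p = V z / U z"
  define y where "y = z * deriv (\<lambda>z. V z / U z) z"
  have "deriv (\<lambda>z. V z / U z) z = (deriv V z * U z - V z * deriv U z) / (U z * U z)"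
    by (rule DERIV_imp_deriv)
       (use nz[OF z] in \<open>auto intro!: derivative_eq_intros has_field_derivative_deriv_disk U V z\<close>)
  moreover have "v + z * v' = u * ((v / u) * (v / u) + z * ((v' * u - v * u') / (u * u)))"
    if "u \<noteq> 0" "v = u + z * u'" for u u' v v'
    using that(1) unfolding that(2) by (simp add: field_simps)
  ultimately have "V z + z * deriv V z = U z * (p * p + y)"
    using nz[OF z] V(2)[OF z] by (simp add: y_def p_def)
  assume re: "Re (V z / U z) = 0" and im: "Im (z * deriv (\<lambda>z. V z / U z) z) = 0"
    and le: "Re (z * deriv (\<lambda>z. V z / U z) z) \<le> - 1/2"
  \<comment> \<open>At a contact point p is purely imaginary and y is real, so U is multiplied by
    the real number y - (Im p)^2, which is at most - 1/2.\<close>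
  have "p * p + y = of_real (Re y - (Im p)\<^sup>2)"
    using re im by (simp add: complex_eq_iff p_def[symmetric] y_def[symmetric] power2_eq_square)
  then have "Re (V z + z * deriv V z) = Re (U z) * (Re y - (Im p)\<^sup>2)"
    using \<open>V z + z * deriv V z = U z * (p * p + y)\<close> by simp
  also have "\<dots> \<le> Re (U z) * (- 1/2)"
    using U(3)[OF z] le zero_le_power2[of "Im p"] unfolding y_def[symmetric]
    by (intro mult_left_mono) linarith+
  finally show False using W[OF z] by simp
qed (rule z)

text \<open>For U = F / z and V = F' the quantity V + z V' is \<open>Lop F\<close>, whose real part
  is positive; the slack - 1/2 is far from being used up.\<close>

lemma classW_starlike:
  assumes F: "F \<in> classW" and z: "z \<in> disk"
  shows "Re (deriv F z / dquot F z) > 0"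
proof (rule Re_quotient_pos[OF _ _ _ _ _ _ z])
  have F': "F holomorphic_on disk" "F 0 = 0" "deriv F 0 = 1" "\<And>z. z \<in> disk \<Longrightarrow> Re (Lop F z) > 0"
    using F by (auto simp: classW_iff)
  have hol: "dquot F holomorphic_on disk" by (rule holomorphic_dquot[OF F'(1,2)])
  then show "dquot F holomorphic_on disk" .
  show "dquot F 0 = 1" using F' by (simp add: dquot_def)
  show pos: "0 < Re (dquot F z)" if "z \<in> disk" for z using classW_dquot[OF F that] by simp
  show "deriv F holomorphic_on disk" using F' by (intro holomorphic_deriv) auto
  show "deriv F z = dquot F z + z * deriv (dquot F) z" if "z \<in> disk" for z
  proof -
    have "F = (\<lambda>z. z * dquot F z)" using F' by (simp add: dquot_mult)
    moreover have "((\<lambda>z. z * dquot F z) has_field_derivative dquot F z + z * deriv (dquot F) z) (at z)"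
      using that by (auto intro!: derivative_eq_intros has_field_derivative_deriv_disk hol)
    ultimately show ?thesis by (metis DERIV_imp_deriv)
  qed
  show "Re (deriv F z + z * deriv (deriv F) z) > - 1/2 * Re (dquot F z)" if "z \<in> disk" for z
    using F'(4)[OF that] pos[OF that] by (simp add: Lop_def)
qed

lemma coef_add_times_deriv:
  assumes "V holomorphic_on disk"
  shows "coef (\<lambda>z. V z + z * deriv V z) n = of_nat (Suc n) * coef V n"
proof -
  have h: "deriv V holomorphic_on disk" using assms by (intro holomorphic_deriv) auto
  have "coef (\<lambda>z. V z + 1 * (z * deriv V z)) n = coef V n + 1 * coef (\<lambda>z. z * deriv V z) n"
    by (rule coef_add) (intro assms holomorphic_intros h)+
  moreover have "coef (\<lambda>z. z * deriv V z) n = of_nat n * coef V n"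
    by (cases n) (simp_all add: coef_times_z h coef_deriv del: of_nat_Suc)
  ultimately show ?thesis by (simp add: algebra_simps)
qed

text \<open>
  The numerical bounds for \<open>F'\<close> and \<open>F / z\<close> barely suffice: half of \<open>1 - 2 (0.62) (29/72)\<close> is \<open>0.2503\<close>,
  which exceeds \<open>0.24\<close>.
\<close>

lemma classW_hconv_convex:
  assumes F: "F \<in> classW" and G: "G \<in> classW" and z: "z \<in> disk"
  shows "Re (Lop (hconv F G) z / deriv (hconv F G) z) > 0"
proof -
  have F': "F holomorphic_on disk" "F 0 = 0" "deriv F 0 = 1" "\<And>z. z \<in> disk \<Longrightarrow> Re (Lop F z) > 0"
    using F by (auto simp: classW_iff)
  have G': "G holomorphic_on disk" "G 0 = 0" "deriv G 0 = 1" using G by (auto simp: classW_iff)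
  have dF: "deriv F holomorphic_on disk" and dG: "deriv G holomorphic_on disk"
    using F' G' by (auto intro!: holomorphic_deriv)
  have H: "hconv F G holomorphic_on disk" by (rule holomorphic_hconv[OF F'(1) G'(1)])
  then have dH: "deriv (hconv F G) holomorphic_on disk" by (intro holomorphic_deriv) auto
  have U: "Re (deriv (hconv F G) z) \<ge> 1 - 2 * (62/100) * (29/72)" if "z \<in> disk" for z
  proof -
    have "Re (hconv (deriv F) (dquot G) z) \<ge> 1 - 2 * (1 - 38/100) * (1 - 43/72)"
      by (rule hconv_Re_ge[OF dF _ classW_Re_deriv_const[OF F] holomorphic_dquot _ classW_Re_dquot_poly[OF G] that])
         (simp_all add: F' G' dquot_def)
    then show ?thesis by (simp add: deriv_hconv[OF F'(1) G'(1,2) that])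
  qed
  have W: "Re (Lop (hconv F G) z + z * deriv (Lop (hconv F G)) z) \<ge> - 24/100" if "z \<in> disk" for z
  proof -
    \<comment> \<open>The total weight (n+1)^3 is shared: (n+1)^2 goes to F as \<open>Lop F\<close>,
      and n+1 goes to G as \<open>deriv G\<close>.\<close>
    have "Lop (hconv F G) z + z * deriv (Lop (hconv F G)) z = hconv (Lop F) (deriv G) z"
    proof (rule coef_eqI[OF _ _ _ that])
      show "(\<lambda>z. Lop (hconv F G) z + z * deriv (Lop (hconv F G)) z) holomorphic_on disk"
        by (intro holomorphic_intros holomorphic_Lop H) auto
      show "hconv (Lop F) (deriv G) holomorphic_on disk"
        by (intro holomorphic_hconv holomorphic_Lop F' dG)
      show "coef (\<lambda>z. Lop (hconv F G) z + z * deriv (Lop (hconv F G)) z) n = coef (hconv (Lop F) (deriv G)) n" for n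
        by (simp add: coef_add_times_deriv coef_hconv holomorphic_Lop H F' G' dG coef_Lop coef_deriv del: of_nat_Suc)
    qed
    moreover have "Re (hconv (Lop F) (deriv G) z) \<ge> 1 - 2 * (1 - 0) * (1 - 38/100)"
      by (rule hconv_Re_ge[OF holomorphic_Lop[OF F'(1)] _ less_imp_le[OF F'(4)] dG _ classW_Re_deriv_const[OF G] that])
         (simp_all add: Lop_0 F' G')
    ultimately show ?thesis by simp
  qed
  show ?thesis
  proof (rule Re_quotient_pos[OF dH _ _ holomorphic_Lop[OF H] _ _ z])
    show "deriv (hconv F G) 0 = 1" by (simp add: deriv_hconv_0 F' G')
    show "0 < Re (deriv (hconv F G) z)" if "z \<in> disk" for z using U[OF that] by simp
    show "Lop (hconv F G) z = deriv (hconv F G) z + z * deriv (deriv (hconv F G)) z" for z by (simp add: Lop_def)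
    show "Re (Lop (hconv F G) z + z * deriv (Lop (hconv F G)) z) > - 1/2 * Re (deriv (hconv F G) z)"
      if "z \<in> disk" for z using U[OF that] W[OF that] by simp
  qed
qed

section \<open>Convex univalent functions\<close>

lemma Re_nonneg_cball:
  assumes f: "f holomorphic_on S" "open S" "cball 0 r \<subseteq> S"
    and ge: "\<And>z. cmod z = r \<Longrightarrow> Re (f z) \<ge> 0" and z: "cmod z \<le> r" and r: "r > 0"
  shows "Re (f z) \<ge> 0"
proof -
  \<comment> \<open>The modulus of exp (- f) is exp (- Re f), so the maximum modulus principle
    becomes a minimum principle for Re f.\<close>
  have h: "(\<lambda>z. exp (- f z)) holomorphic_on S" by (intro holomorphic_intros f)
  have "cmod (exp (- f z)) \<le> 1"
  proof (rule maximum_modulus_frontier[of "\<lambda>z. exp (- f z)" "cball 0 r"])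
    show "(\<lambda>z. exp (- f z)) holomorphic_on interior (cball 0 r)"
      by (rule holomorphic_on_subset[OF h]) (use f(3) interior_subset in blast)
    show "continuous_on (closure (cball 0 r)) (\<lambda>z. exp (- f z))"
      using f(3) by (intro holomorphic_on_imp_continuous_on holomorphic_on_subset[OF h]) simp
    show "cmod (exp (- f z)) \<le> 1" if "z \<in> frontier (cball 0 r)" for z
      using that r ge[of z] by (simp add: frontier_cball)
  qed (use z in auto)
  then show ?thesis by simp
qed

text \<open>
  The Schwarz lemma applied to \<open>\<phi>\<^sup>-\<^sup>1 ((1 - t) \<phi>(w) + t \<phi>(x w))\<close> with \<open>x = \<zeta> / z\<close>, differentiated at \<open>t = 0\<close>.
\<close>

lemma classK_support:
  assumes \<phi>: "\<phi> \<in> classK" and z: "z \<in> disk" and \<zeta>: "cmod \<zeta> \<le> cmod z"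
  shows "Re ((\<phi> \<zeta> - \<phi> z) * cnj (z * deriv \<phi> z)) \<le> 0"
proof (cases "z = 0")
  case False
  have P: "\<phi> holomorphic_on disk" "\<phi> 0 = 0" "inj_on \<phi> disk" "convex (\<phi> ` disk)"
    using \<phi> by (auto simp: classK_def classA_def)
  obtain g where g: "g holomorphic_on (\<phi> ` disk)" "\<And>z. z \<in> disk \<Longrightarrow> deriv \<phi> z * deriv g (\<phi> z) = 1"
    "\<And>z. z \<in> disk \<Longrightarrow> g (\<phi> z) = z"
    by (rule holomorphic_has_inverse[OF P(1) open_ball P(3)]) blast
  have op: "open (\<phi> ` disk)" by (rule open_mapping_thm3[OF P(1) open_ball P(3)])
  define x where "x = \<zeta> / z"
  have x: "cmod x \<le> 1" "x * z = \<zeta>" using \<zeta> False by (auto simp: x_def norm_divide)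
  have xd: "x * w \<in> disk" if "w \<in> disk" for w
    using that x by (auto simp: norm_mult intro: le_less_trans[OF mult_left_le_one_le])
  have le: "cmod (g (\<phi> z + of_real t * (\<phi> \<zeta> - \<phi> z))) \<le> cmod z" if t: "0 \<le> t" "t \<le> 1" for t
  proof -
    define G where "G = (\<lambda>w. g ((1 - t) *\<^sub>R \<phi> w + t *\<^sub>R \<phi> (x * w)))"
    have mem: "(1 - t) *\<^sub>R \<phi> w + t *\<^sub>R \<phi> (x * w) \<in> \<phi> ` disk" if "w \<in> disk" for w
      using convexD[OF P(4), of "\<phi> w" "\<phi> (x * w)" "1 - t" t] xd that t by auto
    have xh: "(\<lambda>w. \<phi> (x * w)) holomorphic_on disk"
      by (rule holomorphic_on_compose'[OF P(1) _ xd]) (intro holomorphic_intros)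
    have "cmod (G z) \<le> cmod z"
    proof (rule Schwarz_Lemma(1))
      show "G holomorphic_on disk" unfolding G_def
        by (rule holomorphic_on_compose'[OF g(1) _ mem])
           (auto simp: scaleR_conv_of_real intro!: holomorphic_intros P xh)
      have "G 0 = g (\<phi> 0)" by (simp add: G_def P)
      then show "G 0 = 0" using g(3)[of 0] by simp
      show "cmod (G w) < 1" if "cmod w < 1" for w
        using mem[of w] that g(3) by (auto simp: G_def)
      show "cmod z < 1" using z by simp
    qed
    then show ?thesis by (simp add: G_def x scaleR_conv_of_real algebra_simps)
  qed
  define u where "u = (\<lambda>t. Re ((\<lambda>y. g (\<phi> z + y)) (of_real t * (\<phi> \<zeta> - \<phi> z)) * cnj z))"
  have "(g has_field_derivative deriv g (\<phi> z)) (at (\<phi> z + of_real 0 * (\<phi> \<zeta> - \<phi> z)))"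
    using holomorphic_derivI[OF g(1) op] z by simp
  then have "((\<lambda>y. g (\<phi> z + y)) has_field_derivative deriv g (\<phi> z)) (at (of_real 0 * (\<phi> \<zeta> - \<phi> z)))"
    using DERIV_shift[of g "deriv g (\<phi> z)" 0 "\<phi> z"] by (simp add: add.commute)
  from has_real_derivative_Re_ray[OF this, of "cnj z"]
  have ud: "(u has_real_derivative Re (deriv g (\<phi> z) * (\<phi> \<zeta> - \<phi> z) * cnj z)) (at 0)"
    by (simp add: u_def)
  \<comment> \<open>By the Schwarz bound \<open>le\<close>, \<open>u\<close> is at most the square
    of \<open>cmod z\<close> on [0, 1], a value it takes at 0; its derivative there cannot be
    positive.\<close>
  have ule: "u t \<le> u 0" if t: "0 \<le> t" "t \<le> 1" for t
  proof -
    have "u t \<le> cmod (g (\<phi> z + of_real t * (\<phi> \<zeta> - \<phi> z)) * cnj z)"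
      unfolding u_def by (rule complex_Re_le_cmod)
    also have "\<dots> \<le> cmod z * cmod z"
      using le[OF t] by (simp add: norm_mult mult_right_mono)
    also have "\<dots> = u 0" using g(3)[OF z] by (simp add: u_def cmod_def flip: power2_eq_square)
    finally show ?thesis .
  qed
  have le0: "Re (deriv g (\<phi> z) * (\<phi> \<zeta> - \<phi> z) * cnj z) \<le> 0"
  proof (rule ccontr)
    assume "\<not> ?thesis"
    then obtain d where d: "d > 0" "\<And>h. 0 < h \<Longrightarrow> h < d \<Longrightarrow> u 0 < u (0 + h)"
      using DERIV_pos_inc_right[OF ud] by auto
    define h where "h = min (d / 2) 1"
    have h: "0 < h" "h < d" "h \<le> 1" using d(1) by (auto simp: h_def)
    then show False using d(2)[of h] ule[of h] by simp
  qed
  \<comment> \<open>Since g'(\<phi>(z)) = 1 / \<phi>'(z), the positive factor |\<phi>'(z)|^2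
    replaces the derivative of the inverse by cnj (\<phi>'(z)).\<close>
  have eq: "(\<phi> \<zeta> - \<phi> z) * cnj (z * deriv \<phi> z) =
      of_real ((cmod (deriv \<phi> z))\<^sup>2) * (deriv g (\<phi> z) * (\<phi> \<zeta> - \<phi> z) * cnj z)"
  proof -
    have "of_real ((cmod (deriv \<phi> z))\<^sup>2) * (deriv g (\<phi> z) * (\<phi> \<zeta> - \<phi> z) * cnj z)
       = (deriv \<phi> z * deriv g (\<phi> z)) * (cnj (deriv \<phi> z) * (\<phi> \<zeta> - \<phi> z) * cnj z)"
      unfolding complex_norm_square by (simp only: mult_ac)
    also have "\<dots> = (\<phi> \<zeta> - \<phi> z) * cnj (z * deriv \<phi> z)"
      unfolding g(2)[OF z] by simp
    finally show ?thesis by (rule sym)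
  qed
  have "Re (of_real c * w) = c * Re w" for c w by simp
  then show ?thesis unfolding eq by (simp only: mult_nonneg_nonpos[OF zero_le_power2 le0])
qed auto

text \<open>
  For fixed \<open>\<zeta>\<close> the function \<open>K(z) = 2 z \<phi>'(z) / (\<phi>(z) - \<phi>(\<zeta>)) - (z + \<zeta>) / (z - \<zeta>)\<close> of Ruscheweyh and
  Sheil-Small has a removable singularity at \<open>\<zeta>\<close> and nonnegative real part on \<open>|z| = |\<zeta>|\<close>, hence
  inside.  Bounding its first Taylor coefficient gives \<open>|1 - \<zeta> / \<phi>(\<zeta>)| \<le> 1\<close>.
\<close>

lemma classK_Re_dquot:
  assumes \<phi>: "\<phi> \<in> classK" and \<zeta>: "\<zeta> \<in> disk"
  shows "Re (dquot \<phi> \<zeta>) \<ge> 1/2"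
proof (cases "\<zeta> = 0")
  case True then show ?thesis using \<phi> by (simp add: dquot_def classK_def classA_def)
next
  case False
  have P: "\<phi> holomorphic_on disk" "\<phi> 0 = 0" "deriv \<phi> 0 = 1" "inj_on \<phi> disk"
    using \<phi> by (auto simp: classK_def classA_def)
  have d0: "deriv \<phi> z \<noteq> 0" if "z \<in> disk" for z
    by (rule holomorphic_injective_imp_regular[OF P(1) open_ball P(4) that])
  have ne: "\<phi> z \<noteq> \<phi> \<zeta>" if "z \<in> disk" "z \<noteq> \<zeta>" for z
    using P(4) that \<zeta> by (auto simp: inj_on_def)
  define D where "D = (\<lambda>z. if z = \<zeta> then deriv \<phi> \<zeta> else (\<phi> z - \<phi> \<zeta>) / (z - \<zeta>))"
  have Dh: "D holomorphic_on disk" unfolding D_def by (rule pole_lemma_open[OF P(1) open_ball])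
  have Dn: "D z \<noteq> 0" if "z \<in> disk" for z using d0[OF \<zeta>] ne that by (simp add: D_def)
  \<comment> \<open>K is N(z) / ((z - \<zeta>) D(z)). The two terms of N cancel at \<zeta>, so a
    second difference quotient E removes the singularity, and D has no zeros by univalence.\<close>
  define N where "N = (\<lambda>z. 2 * z * deriv \<phi> z - (z + \<zeta>) * D z)"
  have Nh: "N holomorphic_on disk" unfolding N_def by (intro holomorphic_intros Dh P) auto
  have N0: "N \<zeta> = 0" by (simp add: N_def D_def)
  define E where "E = (\<lambda>z. if z = \<zeta> then deriv N \<zeta> else (N z - N \<zeta>) / (z - \<zeta>))"
  have Eh: "E holomorphic_on disk" unfolding E_def by (rule pole_lemma_open[OF Nh open_ball])
  define K where "K = (\<lambda>z. E z / D z)"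
  have Kh: "K holomorphic_on disk" unfolding K_def by (intro holomorphic_intros Eh Dh Dn)
  have Keq: "K z = 2 * (z * deriv \<phi> z / (\<phi> z - \<phi> \<zeta>)) - (z + \<zeta>) / (z - \<zeta>)" if "z \<in> disk" "z \<noteq> \<zeta>" for z
  proof -
    have "(2 * x - s * (a / b)) / b / (a / b) = 2 * (x / a) - s / b" if "a \<noteq> 0" "b \<noteq> 0" for a b s x :: complex
      using that by (simp add: field_simps)
    from this[of "\<phi> z - \<phi> \<zeta>" "z - \<zeta>" "z * deriv \<phi> z" "z + \<zeta>"] show ?thesis
      using ne[OF that] that(2) by (simp add: K_def E_def N0) (simp add: N_def D_def mult.assoc)
  qed
  have K1: "Re (K z) \<ge> 0" if z: "cmod z = cmod \<zeta>" "z \<noteq> \<zeta>" for z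
  proof -
    have zd: "z \<in> disk" using z \<zeta> by simp
    have "Re ((z * deriv \<phi> z) * cnj (\<phi> z - \<phi> \<zeta>)) \<ge> 0"
      using classK_support[OF \<phi> zd, of \<zeta>] z by (simp add: algebra_simps)
    then have "Re (z * deriv \<phi> z / (\<phi> z - \<phi> \<zeta>)) \<ge> 0"
      using Re_divide_nonneg_iff[of "\<phi> z - \<phi> \<zeta>"] ne[OF zd z(2)] by simp
    moreover have "Re ((z + \<zeta>) / (z - \<zeta>)) = 0"
    proof -
      have "(Re z)\<^sup>2 + (Im z)\<^sup>2 = (Re \<zeta>)\<^sup>2 + (Im \<zeta>)\<^sup>2" using z(1) by (simp add: cmod_def)
      then have "Re ((z + \<zeta>) * cnj (z - \<zeta>)) = 0" by (simp add: algebra_simps power2_eq_square)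
      then show ?thesis using z(2) by (simp add: Re_complex_div_eq_0)
    qed
    moreover have Re2: "Re (2 * w) = 2 * Re w" for w by simp
    ultimately show ?thesis unfolding Keq[OF zd z(2)] minus_complex.sel Re2 by linarith
  qed
  \<comment> \<open>The formula for K fails at \<zeta> itself, so the sign is carried over by
    continuity along the circle.\<close>
  have K2: "Re (K \<zeta>) \<ge> 0"
  proof -
    have "isCont K (\<zeta> * cis 0)"
      using holomorphic_on_imp_continuous_on[OF Kh] \<zeta> by (simp add: continuous_on_eq_continuous_at)
    moreover have "continuous_on UNIV (\<lambda>t. \<zeta> * cis t)" by (intro continuous_intros)
    then have "isCont (\<lambda>t. \<zeta> * cis t) 0" by (simp add: continuous_on_eq_continuous_at)
    ultimately have "isCont (\<lambda>t. K (\<zeta> * cis t)) 0"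
      by (intro isCont_o2[where g=K and f="\<lambda>t. \<zeta> * cis t"])
    then have "isCont (\<lambda>t. Re (K (\<zeta> * cis t))) 0"
      by (rule isCont_Re)
    then have "((\<lambda>t. Re (K (\<zeta> * cis t))) \<longlongrightarrow> Re (K \<zeta>)) (at_right 0)"
      by (simp add: isCont_def filterlim_at_split)
    moreover have "eventually (\<lambda>t. 0 \<le> Re (K (\<zeta> * cis t))) (at_right 0)"
    proof (rule eventually_at_rightI[of 0 1])
      fix t :: real assume t: "t \<in> {0<..<1}"
      have "sin t > 0" using t pi_gt3 by (intro sin_gt_zero) auto
      then have "cis t \<noteq> 1" by (auto simp: complex_eq_iff)
      then show "0 \<le> Re (K (\<zeta> * cis t))" using False by (intro K1) (auto simp: norm_mult)
    qed simp
    ultimately show ?thesis by (auto dest: tendsto_lowerbound)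
  qed
  have Kpos: "Re (K z) \<ge> 0" if "cmod z \<le> cmod \<zeta>" for z
    by (rule Re_nonneg_cball[OF Kh open_ball _ _ that]) (use K1 K2 \<zeta> False in \<open>force+\<close>)
  define p where "p = (\<lambda>w. K (\<zeta> * w))"
  have sc: "\<zeta> * w \<in> disk" "cmod (\<zeta> * w) \<le> cmod \<zeta>" if "w \<in> disk" for w
    using that \<zeta> by (auto simp: norm_mult mult_left_le intro: le_less_trans[OF mult_left_le])
  have ph: "p holomorphic_on disk" unfolding p_def
    by (rule holomorphic_on_compose'[OF Kh _ sc(1)]) (intro holomorphic_intros)
  have p0: "p 0 = 1" using Keq[of 0] False by (simp add: p_def)
  have "cmod (coef p 1) \<le> 2"
    by (rule Caratheodory_coef_le[OF ph p0]) (use Kpos sc in \<open>auto simp: p_def\<close>)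
  moreover have "deriv p 0 = (2 * (1 / (- \<phi> \<zeta>)) + 2 / \<zeta>) * \<zeta>"
  proof (rule DERIV_imp_deriv)
    have n: "\<phi> \<zeta> \<noteq> 0" using ne[of 0] False P(2) by auto
    have "((\<lambda>z. 2 * (z * deriv \<phi> z / (\<phi> z - \<phi> \<zeta>)) - (z + \<zeta>) / (z - \<zeta>)) has_field_derivative
        2 * (1 / (- \<phi> \<zeta>)) + 2 / \<zeta>) (at 0)"
      using n False
      by (auto intro!: derivative_eq_intros has_field_derivative_deriv_disk P holomorphic_deriv simp: P field_simps)
    then have "(K has_field_derivative 2 * (1 / (- \<phi> \<zeta>)) + 2 / \<zeta>) (at 0)"
      by (rule has_field_derivative_transform_within_open[where S="disk - {\<zeta>}"])
         (use False in \<open>auto simp: Keq intro: open_delete\<close>)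
    then have "(K has_field_derivative 2 * (1 / (- \<phi> \<zeta>)) + 2 / \<zeta>) (at (\<zeta> * 0))" by simp
    then show "(p has_field_derivative (2 * (1 / (- \<phi> \<zeta>)) + 2 / \<zeta>) * \<zeta>) (at 0)"
      unfolding p_def
      by (rule DERIV_chain2[where f=K and g="\<lambda>w. \<zeta> * w" and x=0]) (auto intro!: derivative_eq_intros)
  qed
  ultimately have le: "cmod ((2 * (1 / (- \<phi> \<zeta>)) + 2 / \<zeta>) * \<zeta>) \<le> 2" by (simp add: coef_1)
  define v where "v = \<phi> \<zeta> / \<zeta>"
  have v: "v \<noteq> 0" using ne[of 0] False P(2) by (auto simp: v_def)
  have eq: "(2 * (1 / (- \<phi> \<zeta>)) + 2 / \<zeta>) * \<zeta> = 2 * ((v - 1) / v)"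
    using v False by (simp add: v_def field_simps)
  from le have "2 * (cmod (v - 1) / cmod v) \<le> 2"
    unfolding eq by (simp only: norm_mult norm_divide norm_numeral)
  \<comment> \<open>The point v is no farther from 1 than from 0, which places it in the half-plane
    Re v \<ge> 1/2.\<close>
  then have "cmod (v - 1) \<le> cmod v" using v by (simp add: divide_le_eq)
  then have "(cmod (v - 1))\<^sup>2 \<le> (cmod v)\<^sup>2" by (simp add: power_mono)
  then have "1/2 \<le> Re v" unfolding cmod_power2 by (simp add: power2_eq_square algebra_simps)
  then show ?thesis using False by (simp add: dquot_def v_def)
qed

section \<open>Univalence and starlikeness\<close>

lemma harmf_WH0_0 [simp]:
  "(h, g) \<in> WH0 \<Longrightarrow> harmf (h, g) 0 = 0"
  by (simp add: harmf_def WH0_holomorphic)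

lemma WH0_deriv_gt:
  assumes hg: "(h, g) \<in> WH0" and z: "z \<in> disk"
  shows "cmod (deriv g z) < Re (deriv h z)"
proof -
  have "Re (deriv h z + c * deriv g z) > 0" if "cmod c = 1" for c
  proof -
    have "(\<lambda>z. h z + c * g z) \<in> classW" using hg that by (simp add: WH0_iff)
    from classW_Re_deriv_const[OF this z] show ?thesis
      by (simp add: deriv_add_cmult WH0_holomorphic[OF hg] z[simplified])
  qed
  then show ?thesis using Re_add_mult_unit_gt_iff by blast
qed

lemma WH0_deriv_norm_less:
  assumes "(h, g) \<in> WH0" "z \<in> disk"
  shows "cmod (deriv g z) < cmod (deriv h z)"
  using WH0_deriv_gt[OF assms] complex_Re_le_cmod[of "deriv h z"] by simp

text \<open>The bound m may depend on the fixed point z, so the same transfer serves the constant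
  1/2 and the sharp radial bound.\<close>

lemma WH0_dquot_ge:
  assumes hg: "(h, g) \<in> WH0" and m: "\<And>F. F \<in> classW \<Longrightarrow> m \<le> Re (dquot F z)" and z: "z \<in> disk"
  shows "m \<le> Re (dquot h z) - cmod (dquot g z)"
proof -
  have "m \<le> Re (dquot h z + c * dquot g z)" if "cmod c = 1" for c
  proof -
    have "(\<lambda>z. h z + c * g z) \<in> classW" using hg that by (simp add: WH0_iff)
    moreover have "dquot (\<lambda>z. h z + c * g z) z = dquot h z + c * dquot g z"
      by (simp add: dquot_def deriv_add_cmult WH0_holomorphic[OF hg] add_divide_distrib)
    ultimately show ?thesis using m by metis
  qed
  then show ?thesis using Re_add_mult_unit_ge_iff by blast
qed

lemma WH0_norm_diff_ge:
  assumes hg: "(h, g) \<in> WH0" and m: "\<And>F. F \<in> classW \<Longrightarrow> m \<le> Re (dquot F z)" and z: "z \<in> disk" "z \<noteq> 0"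
  shows "cmod z * m \<le> cmod (h z) - cmod (g z)"
proof -
  have "m \<le> cmod (dquot h z) - cmod (dquot g z)"
    using WH0_dquot_ge[OF hg m z(1)] complex_Re_le_cmod[of "dquot h z"] by simp
  then have "cmod z * m \<le> cmod z * (cmod (dquot h z) - cmod (dquot g z))" by (rule mult_left_mono) simp
  also have "\<dots> = cmod (h z) - cmod (g z)"
    using z(2) by (simp add: dquot_def norm_divide right_diff_distrib)
  finally show ?thesis .
qed

lemma WH0_norm_less:
  assumes hg: "(h, g) \<in> WH0" and z: "z \<in> disk" "z \<noteq> 0"
  shows "cmod (g z) < cmod (h z)"
proof -
  have "0 < cmod z * (1/2)" using z by simp
  also have "\<dots> \<le> cmod (h z) - cmod (g z)" by (rule WH0_norm_diff_ge[OF hg classW_dquot z]) (use z in auto)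
  finally show ?thesis by simp
qed

text \<open>The Noshiro-Warschawski argument: along the segment from a to b the component of the
  image in direction b - a strictly increases, because |g'| cannot outweigh Re h'.\<close>

lemma harmonic_inj_on:
  assumes h: "h holomorphic_on S" and g: "g holomorphic_on S" and S: "open S" "convex S"
    and gt: "\<And>z. z \<in> S \<Longrightarrow> cmod (deriv g z) < Re (deriv h z)" and c: "cmod c = 1"
  shows "inj_on (\<lambda>z. h z + c * cnj (g z)) S"
proof (rule inj_onI, rule ccontr)
  fix a b assume ab: "a \<in> S" "b \<in> S" and eq: "h a + c * cnj (g a) = h b + c * cnj (g b)" and ne: "a \<noteq> b"
  define d where "d = b - a"
  have d: "d \<noteq> 0" using ne by (simp add: d_def)
  \<comment> \<open>Re (c cnj(g) cnj d) is written as Re (g cnj(c) d), so that only holomorphic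
    functions are differentiated.\<close>
  define u where "u = (\<lambda>t. Re ((\<lambda>y. h (a + y)) (of_real t * d) * cnj d) + Re ((\<lambda>y. g (a + y)) (of_real t * d) * (cnj c * d)))"
  have "u 0 < u 1"
  proof (rule DERIV_pos_imp_increasing[of 0 1 u])
    show "(0::real) < 1" by simp
    fix t :: real assume t: "0 \<le> t" "t \<le> 1"
    have "(1 - t) *\<^sub>R a + t *\<^sub>R b \<in> S" using S(2) ab t by (auto simp: convex_def)
    then have mem: "a + of_real t * d \<in> S" by (simp add: d_def scaleR_conv_of_real algebra_simps)
    have D: "((\<lambda>y. f (a + y)) has_field_derivative deriv f (a + of_real t * d)) (at (of_real t * d))"
      if "f holomorphic_on S" for f
      using holomorphic_derivI[OF that S(1) mem]
      using DERIV_shift[of f "deriv f (a + of_real t * d)" "of_real t * d" a] by (simp add: add.commute)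
    define h' where "h' = deriv h (a + of_real t * d)"
    define g' where "g' = deriv g (a + of_real t * d)"
    have "(u has_real_derivative Re (h' * d * cnj d) + Re (g' * d * (cnj c * d))) (at t)"
      unfolding u_def h'_def g'_def by (intro DERIV_add has_real_derivative_Re_ray D h g)
    moreover have "Re (h' * d * cnj d) + Re (g' * d * (cnj c * d)) > 0"
    proof -
      have "Re (h' * d * cnj d) = Re (of_real ((cmod d)\<^sup>2) * h')"
        unfolding complex_norm_square by (simp only: mult_ac)
      then have "Re (h' * d * cnj d) = (cmod d)\<^sup>2 * Re h'"
        by (simp only: times_complex.sel Re_complex_of_real Im_complex_of_real)
      moreover have "\<bar>Re (g' * d * (cnj c * d))\<bar> \<le> (cmod d)\<^sup>2 * cmod g'"
        using abs_Re_le_cmod[of "g' * d * (cnj c * d)"] by (simp add: norm_mult c power2_eq_square mult_ac)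
      moreover have "(cmod d)\<^sup>2 * cmod g' < (cmod d)\<^sup>2 * Re h'"
        using gt[OF mem] d by (simp add: h'_def g'_def)
      ultimately show ?thesis by linarith
    qed
    ultimately show "\<exists>y. (u has_real_derivative y) (at t) \<and> 0 < y" by blast
  qed
  moreover have "u 1 - u 0 = Re ((h b + c * cnj (g b) - (h a + c * cnj (g a))) * cnj d)"
    by (simp add: u_def d_def algebra_simps)
  ultimately show False using eq by simp
qed

lemma WH0_inj_on:
  assumes "(h, g) \<in> WH0" "cmod c = 1"
  shows "inj_on (\<lambda>z. h z + c * cnj (g z)) disk"
  by (rule harmonic_inj_on) (use assms WH0_holomorphic[OF assms(1)] WH0_deriv_gt[OF assms(1)] in auto)

lemma harmonic_continuous_on:
  assumes "h holomorphic_on S" "g holomorphic_on S"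
  shows "continuous_on S (\<lambda>z. h z + c * cnj (g z))"
  by (intro continuous_intros holomorphic_on_imp_continuous_on assms)

lemma harmonic_has_derivative:
  assumes "(h has_field_derivative h') (at z)" "(g has_field_derivative g') (at z)"
  shows "((\<lambda>z. h z + c * cnj (g z)) has_derivative (\<lambda>y. h' * y + c * cnj (g' * y))) (at z)"
  using assms unfolding has_field_derivative_def
  by (intro has_derivative_add has_derivative_mult_right has_derivative_cnj)

text \<open>The map is not holomorphic in general; openness comes from continuity and injectivity
  through invariance of domain.\<close>

lemma WH0_open_image:
  assumes hg: "(h, g) \<in> WH0" and c: "cmod c = 1" and S: "open S" "S \<subseteq> disk"
  shows "open ((\<lambda>z. h z + c * cnj (g z)) ` S)"
  by (rule invariance_of_domain)
     (use S WH0_holomorphic[OF hg] inj_on_subset[OF WH0_inj_on[OF hg c]] in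
       \<open>auto intro!: harmonic_continuous_on intro: holomorphic_on_subset\<close>)

text \<open>
  Starlikeness of the analytic functions \<open>h + l g\<close> is used for the single value
  \<open>l = - s / cnj s\<close> with \<open>s = h(z) + cnj (g(z))\<close>.
\<close>

lemma WH0_starlike:
  assumes hg: "(h, g) \<in> WH0" and z: "z \<in> disk" "z \<noteq> 0"
  shows "Re ((z * deriv h z - cnj (z * deriv g z)) * cnj (h z + cnj (g z))) > 0"
proof -
  define a where "a = h z"
  define b where "b = g z"
  define p where "p = z * deriv h z"
  define q where "q = z * deriv g z"
  define s where "s = a + cnj b"
  define l where "l = - s / cnj s"
  have ba: "cmod b < cmod a" unfolding a_def b_def by (rule WH0_norm_less[OF hg z])
  have s: "s \<noteq> 0"
  proof
    assume "s = 0"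
    then have "a = - cnj b" by (simp add: s_def add_eq_0_iff)
    then show False using ba by simp
  qed
  define N where "N = (cmod a)\<^sup>2 - (cmod b)\<^sup>2"
  have N: "N > 0" using ba by (simp add: N_def power_strict_mono)
  have l: "cmod l = 1" using s by (simp add: l_def norm_divide)
  have W: "(\<lambda>z. h z + l * g z) \<in> classW" using hg l by (simp add: WH0_iff)
  \<comment> \<open>For this l the denominator is N / cnj s with N real and positive, so the sign of
    the quotient is that of Re (p cnj s - q s).\<close>
  have "a + l * b = of_real N / cnj s"
    using s by (simp add: l_def N_def complex_norm_square field_simps del: of_real_power) (simp add: s_def algebra_simps)
  moreover have "p + l * q = (p * cnj s - q * s) / cnj s"
    using s by (simp add: l_def field_simps)
  moreover have "Re ((p + l * q) / (a + l * b)) > 0"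
    using classW_starlike[OF W z(1)] z
    by (simp add: deriv_add_cmult WH0_holomorphic[OF hg] dquot_def a_def b_def p_def q_def algebra_simps)
  ultimately have "Re ((p * cnj s - q * s) / of_real N) > 0" using s by simp
  then have "Re (p * cnj s - q * s) > 0" using N by (simp add: zero_less_divide_iff)
  then show ?thesis by (simp add: p_def q_def s_def a_def b_def algebra_simps)
qed

section \<open>Starlike and close-to-convex images\<close>

lemma open_scaled_Collect:
  fixes S :: "complex set"
  assumes "open S"
  shows "open {t. of_real t * w \<in> S}"
proof -
  have "continuous_on UNIV (\<lambda>t. complex_of_real t * w)" by (intro continuous_intros)
  from open_vimage[OF assms this] show ?thesis by (simp add: vimage_def)
qed

text \<open>
  Let \<open>m\<close> be the supremum of the parameters \<open>t\<close> for which \<open>t w0\<close> leaves the image of the closed disk.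
  By starlikeness \<open>|f\<^sup>-\<^sup>1 (t w0)|\<close> is strictly increasing at \<open>m\<close>, so parameters just below \<open>m\<close> are
  not among them.
\<close>

lemma WH0_segment:
  assumes hg: "(h, g) \<in> WH0" and z0: "z0 \<in> disk" and t1: "0 \<le> t1" "t1 \<le> 1"
  shows "of_real t1 * harmf (h, g) z0 \<in> harmf (h, g) ` cball 0 (cmod z0)"
proof (rule ccontr)
  assume bad1: "\<not> ?thesis"
  note H = WH0_holomorphic[OF hg]
  define f where "f = harmf (h, g)"
  have f: "f = (\<lambda>z. h z + 1 * cnj (g z))" by (auto simp: f_def harmf_def)
  define w0 where "w0 = f z0"
  define C where "C = f ` cball 0 (cmod z0)"
  have sub: "cball 0 (cmod z0) \<subseteq> disk" using z0 by auto
  have cont: "continuous_on disk f" unfolding f by (rule harmonic_continuous_on[OF H(1,2)])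
  have inj: "inj_on f disk" unfolding f by (rule WH0_inj_on[OF hg]) simp
  have cC: "closed C" unfolding C_def
    by (intro compact_imp_closed compact_continuous_image continuous_on_subset[OF cont sub]) auto
  have f0: "f 0 = 0" by (simp add: f_def hg)
  define B where "B = {t \<in> {0..1}. of_real t * w0 \<notin> C}"
  have B: "t1 \<in> B" using bad1 t1 by (simp add: B_def C_def w0_def f_def)
  define m where "m = Sup B"
  have bdd: "bdd_above B" by (rule bdd_aboveI[of _ 1]) (simp add: B_def)
  have "B \<noteq> {}" using B by blast
  then have "m \<le> 1" unfolding m_def by (rule cSup_least) (simp add: B_def)
  moreover have "t1 \<le> m" unfolding m_def by (rule cSup_upper[OF B bdd])
  ultimately have m01: "0 \<le> m" "m \<le> 1" using t1 by linarith+
  \<comment> \<open>The complement of C is open and t = 1 is a good parameter, so a bad m would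
    leave room for larger bad parameters.\<close>
  have mC: "of_real m * w0 \<in> C"
  proof (rule ccontr)
    assume nC: "of_real m * w0 \<notin> C"
    have "of_real 1 * w0 \<in> C" by (simp add: w0_def C_def)
    then have "m < 1" using nC m01 by (cases "m = 1") auto
    have "open {t. of_real t * w0 \<in> - C}"
      using cC by (intro open_scaled_Collect) (simp add: open_Compl)
    moreover have "m \<in> {t. of_real t * w0 \<in> - C}" using nC by simp
    ultimately obtain e where e: "e > 0" "\<And>t. dist t m < e \<Longrightarrow> of_real t * w0 \<notin> C"
      unfolding open_dist by auto
    define t where "t = m + min (e / 2) (1 - m)"
    have t: "m < t" "t \<le> 1" "dist t m < e" using e(1) \<open>m < 1\<close> by (auto simp: t_def dist_real_def)
    then have "t \<in> B" using e(2) m01 by (simp add: B_def)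
    then have "t \<le> m" unfolding m_def by (rule cSup_upper[OF _ bdd])
    then show False using t by simp
  qed
  then obtain z1 where z1: "cmod z1 \<le> cmod z0" "f z1 = of_real m * w0" unfolding C_def by auto
  have z1d: "z1 \<in> disk" using z1(1) z0 by simp
  have "t1 \<noteq> m" using B mC by (auto simp: B_def)
  then have m0: "m > 0" using cSup_upper[OF B bdd] t1 by (simp add: m_def)
  have w0: "w0 \<noteq> 0" using B f0 by (auto simp: B_def C_def intro!: image_eqI[of _ _ 0])
  have z10: "z1 \<noteq> 0" using z1(2) f0 w0 m0 by auto
  define k where "k = inv_into disk f"
  have kf: "k (f z) = z" if "z \<in> disk" for z using inj that by (simp add: k_def)
  define h' where "h' = deriv h z1"
  define g' where "g' = deriv g z1"
  define J where "J = (cmod h')\<^sup>2 - (cmod g')\<^sup>2"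
  have J: "J > 0" using WH0_deriv_norm_less[OF hg z1d] by (simp add: J_def h'_def g'_def power_strict_mono)
  define A where "A = (\<lambda>y. h' * y + 1 * cnj (g' * y))"
  \<comment> \<open>The inverse of the real-linear derivative \<open>A\<close> of \<open>f\<close>
    at \<open>z1\<close>; \<open>J\<close> is the Jacobian determinant.\<close>
  define A' where "A' = (\<lambda>w. (cnj h' * w - cnj g' * cnj w) / of_real J)"
  have "(k has_derivative A') (at (f z1))"
  proof (rule has_derivative_inverse_strong[OF open_ball z1d cont kf])
    show "(f has_derivative A) (at z1)" unfolding f A_def h'_def g'_def
      by (intro harmonic_has_derivative has_field_derivative_deriv_disk H z1d)
    show "A \<circ> A' = id"
    proof
      fix w
      have "A (A' w) = ((h' * cnj h' - g' * cnj g') * w) / of_real J"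
        by (simp add: A_def A'_def diff_divide_distrib algebra_simps)
      also have "h' * cnj h' - g' * cnj g' = of_real J" by (simp add: J_def complex_norm_square del: of_real_power)
      finally show "(A \<circ> A') w = id w" using J by simp
    qed
  qed
  then have kd: "(k has_derivative A') (at (of_real m * w0))" by (simp add: z1(2))
  have "((\<lambda>t. of_real t * w0) has_derivative (\<lambda>t. of_real t * w0)) (at m)"
    by (intro has_derivative_mult_left has_derivative_of_real has_derivative_ident)
  from has_derivative_compose[OF this kd]
  have kt: "((\<lambda>t. k (of_real t * w0)) has_derivative (\<lambda>t. A' (of_real t * w0))) (at m)" .
  have "((\<lambda>t. k (of_real t * w0) \<bullet> k (of_real t * w0)) has_derivative
      (\<lambda>t. 2 * (z1 \<bullet> A' (of_real t * w0)))) (at m)"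
    by (rule has_derivative_eq_rhs[OF has_derivative_inner[OF kt kt]])
       (simp add: z1(2)[symmetric] kf[OF z1d] inner_commute)
  moreover have "(\<lambda>t. 2 * (z1 \<bullet> A' (of_real t * w0))) = (*) (2 * (z1 \<bullet> A' w0))"
    by (rule ext) (simp add: A'_def inner_complex_def Re_divide_of_real Im_divide_of_real field_simps)
  ultimately have rd: "((\<lambda>t. k (of_real t * w0) \<bullet> k (of_real t * w0)) has_real_derivative 2 * (z1 \<bullet> A' w0)) (at m)"
    unfolding has_field_derivative_def by metis
  \<comment> \<open>Half the derivative at m of the squared modulus of the preimage. As m w0 =
    f(z1), it is the quantity of \<open>WH0_starlike\<close> divided by J m.\<close>
  have "z1 \<bullet> A' w0 = Re (cnj z1 * (cnj h' * (of_real m * w0) - cnj g' * cnj (of_real m * w0))) / (J * m)"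
    using m0 J by (simp add: A'_def inner_complex_def field_simps)
  also have "Re (cnj z1 * (cnj h' * (of_real m * w0) - cnj g' * cnj (of_real m * w0)))
      = Re ((z1 * h' - cnj (z1 * g')) * cnj (f z1))"
    unfolding z1(2) by (simp add: algebra_simps)
  also have "\<dots> / (J * m) > 0"
    using WH0_starlike[OF hg z1d z10] J m0 by (simp add: f_def harmf_def h'_def g'_def)
  finally have "2 * (z1 \<bullet> A' w0) > 0" by simp
  from DERIV_pos_inc_left[OF rd this] obtain d where d: "d > 0"
    "\<And>x. 0 < x \<Longrightarrow> x < d \<Longrightarrow> k (of_real (m - x) * w0) \<bullet> k (of_real (m - x) * w0) < k (of_real m * w0) \<bullet> k (of_real m * w0)"
    by auto
  have oU: "open (f ` disk)" unfolding f by (rule WH0_open_image[OF hg]) auto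
  have "open {t. of_real t * w0 \<in> f ` disk}"
    by (rule open_scaled_Collect[OF oU])
  moreover have "m \<in> {t. of_real t * w0 \<in> f ` disk}" using z1(2) z1d by (metis image_eqI mem_Collect_eq)
  ultimately obtain e where e: "e > 0" "\<And>t. dist t m < e \<Longrightarrow> of_real t * w0 \<in> f ` disk"
    unfolding open_dist by auto
  have "m - min d e < m" using d(1) e(1) by simp
  then obtain t where t: "t \<in> B" "m - min d e < t"
    using less_cSup_iff[of B "m - min d e"] B bdd by (auto simp: m_def)
  have "t \<le> m" using cSup_upper[OF t(1) bdd] by (simp add: m_def)
  moreover have "t \<noteq> m" using t(1) mC by (auto simp: B_def)
  ultimately have tm: "t < m" by simp
  have "of_real t * w0 \<in> f ` disk" using e(2)[of t] t tm by (simp add: dist_real_def)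
  then obtain z where z: "z \<in> disk" "of_real t * w0 = f z" by auto
  have "k (of_real (m - (m - t)) * w0) \<bullet> k (of_real (m - (m - t)) * w0) < k (of_real m * w0) \<bullet> k (of_real m * w0)"
    by (rule d(2)) (use t tm in auto)
  then have "z \<bullet> z < z1 \<bullet> z1" by (simp add: z(2) kf[OF z(1)] kf[OF z1d] flip: z1(2))
  then have "cmod z < cmod z1" by (simp add: norm_lt)
  then have "of_real t * w0 \<in> C" using z z1(1) by (simp add: C_def)
  then show False using t(1) by (simp add: B_def)
qed

lemma starlike0_WH0:
  assumes hg: "(h, g) \<in> WH0" and r: "0 < r" "r \<le> 1"
  shows "starlike0 (harmf (h, g) ` ball 0 r)"
  unfolding starlike0_def
proof (intro conjI ballI subsetI)
  show "0 \<in> harmf (h, g) ` ball 0 r" using r hg by (auto intro!: image_eqI[of _ _ 0])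
  fix w y assume "w \<in> harmf (h, g) ` ball 0 r" and y: "y \<in> closed_segment 0 w"
  then obtain z where z: "cmod z < r" "w = harmf (h, g) z" by auto
  from y obtain t where t: "0 \<le> t" "t \<le> 1" "y = of_real t * w"
    by (auto simp: closed_segment_def scaleR_conv_of_real)
  have "y \<in> harmf (h, g) ` cball 0 (cmod z)"
    using WH0_segment[OF hg, of z t] z r t by simp
  then show "y \<in> harmf (h, g) ` ball 0 r" using z(1) by auto
qed

lemma is_domain_WH0:
  assumes hg: "(h, g) \<in> WH0" and r: "0 < r" "r \<le> 1"
  shows "is_domain (harmf (h, g) ` ball 0 r)" "inj_on (harmf (h, g)) (ball 0 r)"
proof -
  have f: "harmf (h, g) = (\<lambda>z. h z + 1 * cnj (g z))" by (auto simp: harmf_def)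
  have sub: "ball 0 r \<subseteq> disk" using r by auto
  have "continuous_on (ball 0 r) (harmf (h, g))"
    unfolding f using WH0_holomorphic[OF hg] holomorphic_on_subset[OF _ sub] by (intro harmonic_continuous_on) auto
  then have "connected (harmf (h, g) ` ball 0 r)" by (rule connected_continuous_image) simp
  moreover have "open (harmf (h, g) ` ball 0 r)" unfolding f using hg sub by (intro WH0_open_image) auto
  ultimately show "is_domain (harmf (h, g) ` ball 0 r)" using r by (simp add: is_domain_def)
  show "inj_on (harmf (h, g)) (ball 0 r)"
    unfolding f by (rule inj_on_subset[OF WH0_inj_on[OF hg] sub]) simp
qed

text \<open>The complement of a starlike open set consists of radial half-lines, one for each
  direction that leaves S; distinct directions give disjoint half-lines.\<close>

lemma starlike0_imp_close_to_convex:
  assumes "open S" "starlike0 S"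
  shows "close_to_convex_dom S"
proof -
  \<comment> \<open>The first exit parameter in direction d. It is attained because S is open, so
    the half-line contains its starting point, and it is positive because 0 lies in S.\<close>
  define \<tau> where "\<tau> = (\<lambda>d. Inf {t. t \<ge> 0 \<and> of_real t * d \<notin> S})"
  define R where "R = {halfline (of_real (\<tau> d) * d) d | d. cmod d = 1 \<and> (\<exists>t\<ge>0. of_real t * d \<notin> S)}"
  have S0: "0 \<in> S" using assms(2) by (simp add: starlike0_def)
  have up: "of_real s * d \<notin> S" if "of_real t * d \<notin> S" "0 \<le> t" "t \<le> s" for s t d
  proof
    assume "of_real s * d \<in> S"
    then have "closed_segment 0 (of_real s * d) \<subseteq> S" using assms(2) by (simp add: starlike0_def)
    moreover have "of_real t * d \<in> closed_segment 0 (of_real s * d)"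
    proof (cases "s = 0")
      case False
      then have "of_real t * d = (1 - t / s) *\<^sub>R 0 + (t / s) *\<^sub>R (of_real s * d)"
        by (simp add: scaleR_conv_of_real)
      then show ?thesis using that False unfolding closed_segment_def by (force intro!: exI[of _ "t / s"])
    qed (use that in auto)
    ultimately show False using that(1) by blast
  qed
  have \<tau>: "0 < \<tau> d" "of_real s * d \<notin> S \<longleftrightarrow> \<tau> d \<le> s"
    if d: "\<exists>t\<ge>0. of_real t * d \<notin> S" and s: "s \<ge> 0" for d s
  proof -
    let ?T = "{t. t \<ge> 0 \<and> of_real t * d \<notin> S}"
    have "closed ?T"
    proof -
      have "open {t. complex_of_real t * d \<in> S}"
        by (rule open_scaled_Collect[OF assms(1)])
      then have "closed (- {t. complex_of_real t * d \<in> S} \<inter> {0..})" by (intro closed_Int) (auto simp: closed_Compl)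
      then show ?thesis by (rule back_subst[of closed]) auto
    qed
    moreover have bdd: "bdd_below ?T" by (rule bdd_belowI[of _ 0]) auto
    ultimately have mem: "\<tau> d \<in> ?T" unfolding \<tau>_def using d by (intro closed_contains_Inf) auto
    then have "\<tau> d \<noteq> 0" using S0 by auto
    with mem show "0 < \<tau> d" by auto
    show "of_real s * d \<notin> S \<longleftrightarrow> \<tau> d \<le> s"
    proof
      assume "of_real s * d \<notin> S"
      then show "\<tau> d \<le> s" unfolding \<tau>_def using s bdd by (intro cInf_lower) auto
    next
      assume "\<tau> d \<le> s"
      then show "of_real s * d \<notin> S" using up[of "\<tau> d" d s] mem by auto
    qed
  qed
  have line: "w \<in> halfline (of_real (\<tau> d) * d) d \<longleftrightarrow> w \<noteq> 0 \<and> sgn w = d \<and> \<tau> d \<le> cmod w"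
    if d: "cmod d = 1" "\<exists>t\<ge>0. of_real t * d \<notin> S" for w d
  proof
    assume "w \<in> halfline (of_real (\<tau> d) * d) d"
    then obtain t where t: "t \<ge> 0" "w = of_real (\<tau> d + t) * d" by (auto simp: halfline_def algebra_simps)
    have "\<tau> d + t > 0" using \<tau>(1)[OF d(2), of 0] t by simp
    moreover have "sgn d = d" using d by (simp add: sgn_eq)
    ultimately show "w \<noteq> 0 \<and> sgn w = d \<and> \<tau> d \<le> cmod w"
      using d t by (auto simp: sgn_mult norm_mult sgn_of_real simp del: of_real_add)
  next
    assume w: "w \<noteq> 0 \<and> sgn w = d \<and> \<tau> d \<le> cmod w"
    then have "w = of_real (cmod w) * d" by (auto simp: sgn_eq)
    then have "w = of_real (\<tau> d) * d + of_real (cmod w - \<tau> d) * d" by (simp add: algebra_simps)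
    then show "w \<in> halfline (of_real (\<tau> d) * d) d" 
      using w unfolding halfline_def by (intro CollectI exI[of _ "cmod w - \<tau> d"] conjI) auto
  qed
  show ?thesis unfolding close_to_convex_dom_def
  proof (intro exI[of _ R] conjI ballI impI)
    show "\<exists>a d. d \<noteq> 0 \<and> L = halfline a d" if L: "L \<in> R" for L
    proof -
      obtain d where "L = halfline (of_real (\<tau> d) * d) d" "cmod d = 1" using L unfolding R_def by blast
      then show ?thesis by (metis norm_zero zero_neq_one)
    qed
    show "L1 \<inter> L2 = {}" if L: "L1 \<in> R" "L2 \<in> R" "L1 \<noteq> L2" for L1 L2
    proof -
      obtain d1 where d1: "cmod d1 = 1" "\<exists>t\<ge>0. of_real t * d1 \<notin> S" "L1 = halfline (of_real (\<tau> d1) * d1) d1"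
        using L(1) unfolding R_def by blast
      obtain d2 where d2: "cmod d2 = 1" "\<exists>t\<ge>0. of_real t * d2 \<notin> S" "L2 = halfline (of_real (\<tau> d2) * d2) d2"
        using L(2) unfolding R_def by blast
      have "d1 = d2" if "w \<in> L1" "w \<in> L2" for w
        using that line[OF d1(1,2)] line[OF d2(1,2)] d1(3) d2(3) by simp
      then show ?thesis using L(3) d1(3) d2(3) by blast
    qed
    show "- S = \<Union> R"
    proof safe
      fix w assume w: "w \<notin> S"
      then have w0: "w \<noteq> 0" using S0 by auto
      have ws: "of_real (cmod w) * sgn w = w" using w0 by (simp add: sgn_eq)
      have ex: "\<exists>t\<ge>0. of_real t * sgn w \<notin> S" using w ws by (intro exI[of _ "cmod w"]) auto
      have n: "cmod (sgn w) = 1" using w0 by (simp add: norm_sgn)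
      have "\<tau> (sgn w) \<le> cmod w" using \<tau>(2)[OF ex, of "cmod w"] w ws by simp
      then have "w \<in> halfline (of_real (\<tau> (sgn w)) * sgn w) (sgn w)" using line[OF n ex] w0 by simp
      then show "w \<in> \<Union> R" using n ex unfolding R_def by blast
    next
      fix w L assume "L \<in> R" "w \<in> L" "w \<in> S"
      then obtain d where d: "cmod d = 1" "\<exists>t\<ge>0. of_real t * d \<notin> S" "w \<in> halfline (of_real (\<tau> d) * d) d"
        unfolding R_def by blast
      then have w: "w \<noteq> 0" "sgn w = d" "\<tau> d \<le> cmod w" using line[OF d(1,2)] by auto
      then have "of_real (cmod w) * d \<notin> S" using \<tau>(2)[OF d(2), of "cmod w"] by simp
      moreover have "of_real (cmod w) * d = w" using w by (auto simp: sgn_eq)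
      ultimately show False using \<open>w \<in> S\<close> by simp
    qed
  qed
qed

lemma radius_WH0: "radius_S WH0 = 1" "radius_CC WH0 = 1"
proof -
  have *: "inj_on (harmf p) disk" "is_domain (harmf p ` disk)" "starlike0 (harmf p ` disk)"
    "close_to_convex_dom (harmf p ` disk)" if "p \<in> WH0" for p
  proof -
    obtain h g where p: "p = (h, g)" by (cases p)
    show "inj_on (harmf p) disk" and d: "is_domain (harmf p ` disk)" and s: "starlike0 (harmf p ` disk)"
      using is_domain_WH0[of h g 1] starlike0_WH0[of h g 1] that p by auto
    show "close_to_convex_dom (harmf p ` disk)"
      using d s by (intro starlike0_imp_close_to_convex) (auto simp: is_domain_def)
  qed
  show "radius_S WH0 = 1" "radius_CC WH0 = 1" unfolding radius_S_def radius_CC_def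
    by (rule cSup_eq_maximum; use * in auto)+
qed

section \<open>Convexity\<close>

text \<open>If a convex combination p lay outside C, the segment from an interior point to p would
  meet the frontier at some b. The support functional at b is negative at the interior point and
  nonpositive at p, yet it vanishes at b, which lies between them and differs from p.\<close>

lemma convex_of_support:
  fixes C :: "'a::euclidean_space set"
  assumes C: "closed C" "interior C \<noteq> {}"
    and sup: "\<And>b. b \<in> frontier C \<Longrightarrow> \<exists>a. a \<noteq> 0 \<and> (\<forall>w\<in>C. a \<bullet> (w - b) \<le> 0)"
  shows "convex C"
proof (rule convexI, rule ccontr)
  fix x y :: 'a and u v :: real
  assume xy: "x \<in> C" "y \<in> C" and uv: "0 \<le> u" "0 \<le> v" "u + v = 1"
  define p where "p = u *\<^sub>R x + v *\<^sub>R y"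
  assume "u *\<^sub>R x + v *\<^sub>R y \<notin> C"
  then have p: "p \<notin> C" by (simp add: p_def)
  obtain w0 e where e: "e > 0" "ball w0 e \<subseteq> C" using C(2) mem_interior by blast
  have w0: "w0 \<in> C" using e by auto
  have "closed_segment w0 p \<inter> frontier C \<noteq> {}"
    by (rule connected_Int_frontier) (use w0 p in auto)
  then obtain b where b: "b \<in> closed_segment w0 p" "b \<in> frontier C" by auto
  obtain s where s: "0 \<le> s" "s \<le> 1" "b = (1 - s) *\<^sub>R w0 + s *\<^sub>R p"
    using b(1) by (auto simp: closed_segment_def)
  have "b \<in> C" using b(2) C(1) by (simp add: frontier_def)
  then have "s \<noteq> 1" using s p by auto
  obtain a where a: "a \<noteq> 0" "\<And>w. w \<in> C \<Longrightarrow> a \<bullet> (w - b) \<le> 0" using sup[OF b(2)] by blast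
  have "a \<bullet> (p - b) = u * (a \<bullet> (x - b)) + v * (a \<bullet> (y - b))"
  proof -
    have "p - b = u *\<^sub>R (x - b) + v *\<^sub>R (y - b)"
      using uv(3) by (simp add: p_def algebra_simps flip: scaleR_left.add)
    then show ?thesis by (simp add: inner_add_right)
  qed
  also have "\<dots> \<le> 0" using a(2) xy uv by (simp add: add_nonpos_nonpos mult_nonneg_nonpos)
  finally have pb: "a \<bullet> (p - b) \<le> 0" .
  \<comment> \<open>Moving \<open>w0\<close> by e/2 in direction \<open>a\<close> stays in C, which
    makes the inequality at \<open>w0\<close> strict.\<close>
  define w1 where "w1 = w0 + (e / (2 * norm a)) *\<^sub>R a"
  have "w1 \<in> C" using e a(1) by (intro subsetD[OF e(2)]) (simp add: w1_def dist_norm)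
  then have "a \<bullet> (w1 - b) \<le> 0" by (rule a(2))
  then have "a \<bullet> (w0 - b) + (e / (2 * norm a)) * (a \<bullet> a) \<le> 0"
    by (simp add: w1_def inner_diff_right inner_add_right)
  moreover have "(e / (2 * norm a)) * (a \<bullet> a) > 0" using e a(1) by simp
  ultimately have wb: "a \<bullet> (w0 - b) < 0" by linarith
  have "(1 - s) *\<^sub>R (w0 - b) + s *\<^sub>R (p - b) = 0" by (simp add: s(3) algebra_simps)
  then have "a \<bullet> ((1 - s) *\<^sub>R (w0 - b) + s *\<^sub>R (p - b)) = 0" by simp
  then have "(1 - s) * (a \<bullet> (w0 - b)) + s * (a \<bullet> (p - b)) = 0" by (simp add: inner_add_right)
  moreover have "(1 - s) * (a \<bullet> (w0 - b)) < 0" using wb s(2) \<open>s \<noteq> 1\<close> by (simp add: mult_pos_neg)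
  moreover have "s * (a \<bullet> (p - b)) \<le> 0" using pb s(1) by (simp add: mult_nonneg_nonpos)
  ultimately show False by linarith
qed

lemma Re_pos_nonpos_Reals: "Re z > 0 \<Longrightarrow> z \<notin> \<real>\<^sub>\<le>\<^sub>0"
  by (auto simp: complex_nonpos_Reals_iff)

text \<open>
  With \<open>L = Ln F'\<close> the tangent direction at \<open>z0 cis t\<close> turns by the angle
  \<open>a(t) = t + Im (L(z0 cis t) - L(z0))\<close>, which increases from \<open>0\<close> to \<open>2 pi\<close>.
\<close>

lemma analytic_convex_support_circle:
  assumes F: "F holomorphic_on disk" "\<And>z. z \<in> disk \<Longrightarrow> Re (deriv F z) > 0"
      "\<And>z. z \<in> disk \<Longrightarrow> Re (Lop F z / deriv F z) > 0"
    and z0: "z0 \<in> disk" "z0 \<noteq> 0" and t: "0 \<le> t" "t \<le> 2 * pi"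
  shows "Re ((F (z0 * cis t) - F z0) * cnj (z0 * deriv F z0)) \<le> 0"
proof -
  have dF: "deriv F holomorphic_on disk" using F(1) by (intro holomorphic_deriv) auto
  define L where "L = (\<lambda>z. Ln (deriv F z))"
  have Ld: "(L has_field_derivative deriv (deriv F) z / deriv F z) (at z)" if "z \<in> disk" for z
    unfolding L_def using F(2)[OF that]
    by (auto intro!: derivative_eq_intros has_field_derivative_deriv_disk dF that Re_pos_nonpos_Reals simp: divide_inverse)
  have Lexp: "deriv F z = exp (L z)" if "z \<in> disk" for z
    unfolding L_def using F(2)[OF that] by (metis exp_Ln less_irrefl zero_complex.sel(1))
  have zd: "z0 * cis s \<in> disk" for s using z0 by (simp add: norm_mult)
  \<comment> \<open>The factor \<open>- \<i>\<close> turns an imaginary part into a real part, the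
    form that the derivative rule along arcs accepts.\<close>
  define a where "a = (\<lambda>s. s + Re (L (z0 * cis s) * (- \<i>)) - Im (L z0))"
  define v where "v = (\<lambda>s. Re (F (z0 * cis s) * cnj (z0 * deriv F z0)))"
  have a': "(a has_real_derivative Re (Lop F (z0 * cis s) / deriv F (z0 * cis s))) (at s)" for s
  proof -
    have "(a has_real_derivative 1 + Re (\<i> * (z0 * cis s) * (deriv (deriv F) (z0 * cis s) / deriv F (z0 * cis s)) * (- \<i>)) - 0) (at s)"
      unfolding a_def by (intro DERIV_add DERIV_diff DERIV_ident DERIV_const has_real_derivative_Re_arc Ld zd)
    moreover have "Lop F z / deriv F z = 1 + \<i> * z * (deriv (deriv F) z / deriv F z) * (- \<i>)" if "z \<in> disk" for z
    proof -
      have "deriv F z \<noteq> 0" using F(2)[OF that] by auto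
      then show ?thesis by (simp add: Lop_def field_simps)
    qed
    ultimately show ?thesis using zd[of s] by simp
  qed
  have amono: "a s < a s'" if "s < s'" for s s'
    by (rule DERIV_pos_imp_increasing[of s s' a]) (use a' F(3)[OF zd] that in blast)+
  have a0: "a 0 = 0" "a (2 * pi) = 2 * pi" by (simp_all add: a_def)
  define M where "M = (\<lambda>s. (cmod z0)\<^sup>2 * exp (Re (L (z0 * cis s)) + Re (L z0)))"
  have v': "(v has_real_derivative - (M s * sin (a s))) (at s)" for s
  proof -
    have "(v has_real_derivative Re (\<i> * (z0 * cis s) * deriv F (z0 * cis s) * cnj (z0 * deriv F z0))) (at s)"
      unfolding v_def by (intro has_real_derivative_Re_arc has_field_derivative_deriv_disk F zd)
    moreover have "\<i> * (z0 * cis s) * deriv F (z0 * cis s) * cnj (z0 * deriv F z0) = \<i> * (of_real (M s) * cis (a s))"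
    proof -
      have "\<i> * (z0 * cis s) * deriv F (z0 * cis s) * cnj (z0 * deriv F z0)
          = \<i> * ((z0 * cnj z0) * (cis s * exp (L (z0 * cis s)) * cnj (exp (L z0))))"
        using Lexp[OF zd] Lexp[OF z0(1)] by (simp add: mult_ac)
      also have "cis s * exp (L (z0 * cis s)) * cnj (exp (L z0)) =
          exp (of_real (Re (L (z0 * cis s)) + Re (L z0))) * cis (a s)"
        unfolding cis_conv_exp exp_cnj
        by (simp flip: exp_add) (rule arg_cong[where f=exp], simp add: complex_eq_iff a_def flip: cis_conv_exp)
      also have "z0 * cnj z0 = of_real ((cmod z0)\<^sup>2)" by (simp only: complex_norm_square)
      also have "exp (complex_of_real (Re (L (z0 * cis s)) + Re (L z0))) =
          of_real (exp (Re (L (z0 * cis s)) + Re (L z0)))" by (rule exp_of_real)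
      finally show ?thesis by (simp only: M_def of_real_mult mult_ac)
    qed
    ultimately have "(v has_real_derivative Re (\<i> * (of_real (M s) * cis (a s)))) (at s)" by metis
    then show ?thesis by simp
  qed
  have M: "M s > 0" for s using z0(2) by (simp add: M_def)
  have v0: "v (2 * pi) = v 0" by (simp add: v_def)
  \<comment> \<open>Since v' = - M sin a with M > 0, v decreases until the angle reaches pi and then
    increases to v(2 pi) = v(0).\<close>
  have "v t \<le> v 0"
  proof (cases "a t \<le> pi")
    case True
    have "v t \<le> v 0"
    proof (rule DERIV_nonpos_imp_nonincreasing[of 0 t v])
      fix x assume x: "0 \<le> x" "x \<le> t"
      have "0 \<le> a x" using amono[of 0 x] a0 x by (cases "x = 0") auto
      moreover have "a x \<le> pi" using amono[of x t] x True by (cases "x = t") auto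
      ultimately have "sin (a x) \<ge> 0" by (rule sin_ge_zero)
      then show "\<exists>y. (v has_real_derivative y) (at x) \<and> y \<le> 0"
        using v'[of x] M[of x] by (intro exI conjI) (auto intro: mult_nonneg_nonneg less_imp_le)
    qed (rule t)
    then show ?thesis .
  next
    case False
    have "v t \<le> v (2 * pi)"
    proof (rule DERIV_nonneg_imp_nondecreasing[of t "2 * pi" v])
      fix x assume x: "t \<le> x" "x \<le> 2 * pi"
      have "pi \<le> a x" using amono[of t x] x False by (cases "x = t") auto
      moreover have "a x \<le> 2 * pi" using amono[of x "2 * pi"] x a0 by (cases "x = 2 * pi") auto
      ultimately have "sin (a x) \<le> 0"
        using sin_ge_zero[of "a x - pi"] by (simp add: sin_diff)
      then show "\<exists>y. (v has_real_derivative y) (at x) \<and> 0 \<le> y"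
        using v'[of x] M[of x] mult_nonneg_nonpos[of "M x" "sin (a x)"] by (intro exI conjI) auto
    qed (rule t)
    then show ?thesis by (simp add: v0)
  qed
  then show ?thesis by (simp add: v_def left_diff_distrib)
qed

text \<open>For a fixed direction the support inequality concerns the real part of a holomorphic
  function, so it extends from the circle to the closed disk.\<close>

lemma analytic_convex_support:
  assumes F: "F holomorphic_on disk" "\<And>z. z \<in> disk \<Longrightarrow> Re (deriv F z) > 0"
      "\<And>z. z \<in> disk \<Longrightarrow> Re (Lop F z / deriv F z) > 0"
    and z0: "z0 \<in> disk" "z0 \<noteq> 0" and \<zeta>: "cmod \<zeta> \<le> cmod z0"
  shows "Re ((F \<zeta> - F z0) * cnj (z0 * deriv F z0)) \<le> 0"
proof -
  have "Re (- ((F \<zeta> - F z0) * cnj (z0 * deriv F z0))) \<ge> 0"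
  proof (rule Re_nonneg_cball[where f="\<lambda>\<zeta>. - ((F \<zeta> - F z0) * cnj (z0 * deriv F z0))"])
    show "(\<lambda>\<zeta>. - ((F \<zeta> - F z0) * cnj (z0 * deriv F z0))) holomorphic_on disk"
      by (intro holomorphic_intros F)
    show "cball 0 (cmod z0) \<subseteq> disk" using z0 by auto
    show "0 \<le> Re (- ((F z - F z0) * cnj (z0 * deriv F z0)))" if z: "cmod z = cmod z0" for z
    proof -
      have "cmod (z / z0) = 1" using z z0(2) by (simp add: norm_divide)
      then have "z / z0 = cis (Arg2pi (z / z0))"
        using Arg2pi_eq[of "z / z0"] by (simp add: cis_conv_exp)
      then have "z = z0 * cis (Arg2pi (z / z0))" using z0(2) by (simp add: field_simps)
      moreover have "Re ((F (z0 * cis (Arg2pi (z / z0))) - F z0) * cnj (z0 * deriv F z0)) \<le> 0"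
        by (rule analytic_convex_support_circle[OF F z0]) (use Arg2pi[of "z / z0"] in auto)
      ultimately show ?thesis by (metis neg_0_le_iff_le uminus_complex.sel(1))
    qed
  qed (use z0 \<zeta> in auto)
  then show ?thesis by (simp only: uminus_complex.sel)
qed

text \<open>
  In a fixed direction \<open>e\<close> the real parts of \<open>cnj e (h + c cnj g)\<close> and \<open>cnj e (h + l g)\<close> agree for
  \<open>l = e\<^sup>2 cnj c\<close>, so support lines of the analytic images are support lines of the harmonic one.
\<close>

lemma harmonic_convex_image:
  assumes hg: "(h, g) \<in> WH0"
    and conv: "\<And>l z. cmod l = 1 \<Longrightarrow> z \<in> disk \<Longrightarrow> Re (Lop (\<lambda>z. h z + l * g z) z / deriv (\<lambda>z. h z + l * g z) z) > 0"
    and c: "cmod c = 1"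
  shows "convex ((\<lambda>z. h z + c * cnj (g z)) ` disk)"
proof -
  note H = WH0_holomorphic[OF hg]
  define f where "f = (\<lambda>z. h z + c * cnj (g z))"
  have sup: "Re ((f \<zeta> - f z0) * cnj (z0 * deriv h z0 - c * cnj (z0 * deriv g z0))) \<le> 0"
      "z0 * deriv h z0 - c * cnj (z0 * deriv g z0) \<noteq> 0"
    if z0: "z0 \<in> disk" "z0 \<noteq> 0" and \<zeta>: "cmod \<zeta> \<le> cmod z0" for z0 \<zeta>
  proof -
    define p where "p = z0 * deriv h z0"
    define q where "q = z0 * deriv g z0"
    define \<nu> where "\<nu> = p - c * cnj q"
    have qp: "cmod q < cmod p"
      using WH0_deriv_norm_less[OF hg z0(1)] z0(2) by (simp add: p_def q_def norm_mult)
    have \<nu>: "\<nu> \<noteq> 0"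
    proof
      assume "\<nu> = 0"
      then have "p = c * cnj q" by (simp add: \<nu>_def)
      then show False using qp by (simp add: norm_mult c)
    qed
    then show "z0 * deriv h z0 - c * cnj (z0 * deriv g z0) \<noteq> 0" by (simp add: \<nu>_def p_def q_def)
    define e where "e = sgn \<nu>"
    have e: "cmod e = 1" "\<nu> = of_real (cmod \<nu>) * e" using \<nu> by (auto simp: e_def sgn_eq norm_divide)
    have ee: "cnj e * e = 1" using e(1) complex_norm_square[of e] by (simp add: mult.commute)
    have cc: "c * cnj c = 1" using c complex_norm_square[of c] by simp
    define l where "l = e * e * cnj c"
    have l: "cmod l = 1" by (simp add: l_def norm_mult e c)
    define F where "F = (\<lambda>z. h z + l * g z)"
    have FW: "F \<in> classW" using hg l by (simp add: F_def WH0_iff)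
    have Fh: "F holomorphic_on disk" using FW by (simp add: classW_iff)
    have dF: "z0 * deriv F z0 = p + l * q"
      using z0(1) by (simp add: F_def deriv_add_cmult H p_def q_def algebra_simps)
    define A where "A = cnj e * p"
    define B where "B = cnj e * (c * cnj q)"
    \<comment> \<open>A - B is real and \<open>cmod B < cmod A\<close>, which together make A + cnj
      B = cnj e z0 F'(z0) real and positive. Thus e is also the direction of z0 F'(z0), the normal
      of the analytic image.\<close>
    have AB: "A - B = of_real (cmod \<nu>)"
    proof -
      have "A - B = cnj e * \<nu>" by (simp add: A_def B_def \<nu>_def algebra_simps)
      also have "\<dots> = of_real (cmod \<nu>) * (cnj e * e)" by (subst e(2)) (simp only: mult_ac)
      finally show ?thesis by (simp add: ee)
    qed
    have eF: "cnj e * (z0 * deriv F z0) = A + cnj B"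
    proof -
      have "cnj e * (l * q) = (cnj e * e) * (e * cnj c * q)" by (simp only: l_def mult_ac)
      also have "\<dots> = cnj B" by (simp add: ee B_def)
      finally show ?thesis by (simp only: dF distrib_left A_def)
    qed
    have im: "Im A = Im B" and re: "Re A > Re B"
    proof -
      have "Im A - Im B = 0" "Re A - Re B = cmod \<nu>"
        using arg_cong[OF AB, of Im] arg_cong[OF AB, of Re] by simp_all
      then show "Im A = Im B" "Re A > Re B" using \<nu> zero_less_norm_iff[of \<nu>] by linarith+
    qed
    have "cmod B < cmod A" using qp by (simp add: A_def B_def norm_mult e c)
    then have "(Re B)\<^sup>2 < (Re A)\<^sup>2"
      using im power_strict_mono[of "cmod B" "cmod A" 2] by (simp add: cmod_power2)
    then have "\<bar>Re B\<bar> < \<bar>Re A\<bar>" using abs_le_square_iff[of "Re A" "Re B"] by linarith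
    then have pos: "Re A + Re B > 0" using re by linarith
    define \<rho> where "\<rho> = Re A + Re B"
    have "cnj e * (z0 * deriv F z0) = of_real \<rho>" unfolding eF using im by (simp add: complex_eq_iff \<rho>_def)
    then have "(cnj e * e) * (z0 * deriv F z0) = of_real \<rho> * e" by (simp add: mult_ac)
    then have zF: "z0 * deriv F z0 = of_real \<rho> * e" by (simp add: ee)
    have "Re ((F \<zeta> - F z0) * cnj (z0 * deriv F z0)) \<le> 0"
      by (rule analytic_convex_support[OF Fh _ _ z0 \<zeta>])
         (use classW_Re_deriv_const[OF FW] conv[OF l] in \<open>force simp: F_def\<close>)+
    then have "\<rho> * Re ((F \<zeta> - F z0) * cnj e) \<le> 0" unfolding zF by (simp add: algebra_simps)
    then have le: "Re ((F \<zeta> - F z0) * cnj e) \<le> 0" using pos by (simp add: \<rho>_def mult_le_0_iff)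
    have same: "Re (f z * cnj e) = Re (F z * cnj e)" for z
    proof -
      have "Re (c * cnj (g z) * cnj e) = Re (cnj (c * cnj (g z) * cnj e))" by (simp only: cnj.sel)
      also have "cnj (c * cnj (g z) * cnj e) = cnj c * g z * e" by simp
      also have "\<dots> = cnj c * g z * e * (cnj e * e)" by (simp add: ee)
      also have "\<dots> = l * g z * cnj e" by (simp only: l_def mult_ac)
      finally show ?thesis unfolding f_def F_def distrib_right plus_complex.sel by simp
    qed
    have "Re ((f \<zeta> - f z0) * cnj e) \<le> 0"
      using le same[of \<zeta>] same[of z0] unfolding left_diff_distrib minus_complex.sel by simp
    then have "cmod \<nu> * Re ((f \<zeta> - f z0) * cnj e) \<le> 0" by (simp add: mult_nonneg_nonpos)
    also have "cmod \<nu> * Re ((f \<zeta> - f z0) * cnj e) = Re ((f \<zeta> - f z0) * cnj (of_real (cmod \<nu>) * e))"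
      by (simp add: algebra_simps)
    finally show "Re ((f \<zeta> - f z0) * cnj (z0 * deriv h z0 - c * cnj (z0 * deriv g z0))) \<le> 0"
      unfolding e(2)[symmetric] by (simp only: \<nu>_def p_def q_def)
  qed
  have cont: "continuous_on disk f" unfolding f_def by (rule harmonic_continuous_on[OF H(1,2)])
  \<comment> \<open>Frontier points require preimages, so convexity is shown for images of closed
    disks; any two points of the full image lie in a common one.\<close>
  have conv: "convex (f ` cball 0 r)" if r: "0 < r" "r < 1" for r
  proof (rule convex_of_support)
    have sub: "cball 0 r \<subseteq> disk" using r by auto
    show cl: "closed (f ` cball 0 r)"
      by (intro compact_imp_closed compact_continuous_image continuous_on_subset[OF cont sub]) auto
    have op: "open (f ` ball 0 r)" unfolding f_def by (rule WH0_open_image[OF hg c]) (use r in auto)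
    have int: "f ` ball 0 r \<subseteq> interior (f ` cball 0 r)" using op by (intro interior_maximal) auto
    then show "interior (f ` cball 0 r) \<noteq> {}" using r by force
    fix b assume b: "b \<in> frontier (f ` cball 0 r)"
    then have "b \<in> f ` cball 0 r" "b \<notin> interior (f ` cball 0 r)" using cl by (auto simp: frontier_def)
    then obtain z0 where z0: "cmod z0 \<le> r" "b = f z0" by auto
    have "\<not> cmod z0 < r"
    proof
      assume "cmod z0 < r"
      then have "f z0 \<in> f ` ball 0 r" by simp
      then show False using \<open>b \<notin> interior _\<close> int z0(2) by blast
    qed
    then have "cmod z0 = r" using z0(1) by simp
    then have "z0 \<in> disk" "z0 \<noteq> 0" using r by auto
    define \<nu> where "\<nu> = z0 * deriv h z0 - c * cnj (z0 * deriv g z0)"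
    have "\<nu> \<bullet> (w - b) \<le> 0" if w: "w \<in> f ` cball 0 r" for w
    proof -
      obtain \<zeta> where \<zeta>: "cmod \<zeta> \<le> r" "w = f \<zeta>" using w by auto
      have "\<nu> \<bullet> (w - b) = Re ((f \<zeta> - f z0) * cnj \<nu>)" by (simp add: z0 \<zeta> inner_complex_def algebra_simps)
      then show ?thesis using sup(1)[OF \<open>z0 \<in> disk\<close> \<open>z0 \<noteq> 0\<close>, of \<zeta>] \<zeta> \<open>cmod z0 = r\<close> by (simp add: \<nu>_def)
    qed
    moreover have "\<nu> \<noteq> 0" unfolding \<nu>_def by (rule sup(2)[OF \<open>z0 \<in> disk\<close> \<open>z0 \<noteq> 0\<close> order_refl])
    ultimately show "\<exists>a. a \<noteq> 0 \<and> (\<forall>w\<in>f ` cball 0 r. a \<bullet> (w - b) \<le> 0)" by blast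
  qed
  show ?thesis unfolding f_def[symmetric]
  proof (rule convexI)
    fix x y :: complex and u v :: real
    assume xy: "x \<in> f ` disk" "y \<in> f ` disk" and uv: "0 \<le> u" "0 \<le> v" "u + v = 1"
    obtain a b where ab: "a \<in> disk" "b \<in> disk" "x = f a" "y = f b" using xy by auto
    define r where "r = max (max (cmod a) (cmod b)) (1/2)"
    have r: "0 < r" "r < 1" "cmod a \<le> r" "cmod b \<le> r" using ab by (auto simp: r_def)
    have "u *\<^sub>R x + v *\<^sub>R y \<in> f ` cball 0 r"
      using convexD[OF conv[OF r(1,2)], of x y u v] ab r uv by auto
    then show "u *\<^sub>R x + v *\<^sub>R y \<in> f ` disk" using r(2) by auto
  qed
qed

text \<open>Each h1 + l g1 is the convolution of h + l g with \<phi>, hence of two members of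
  \<open>classW\<close>; this is the situation of \<open>classW_hconv_convex\<close>.\<close>

lemma SKH0_tconv:
  assumes \<phi>: "\<phi> \<in> classW" and p: "p \<in> WH0"
  shows "tconv \<phi> p \<in> SKH0"
proof -
  obtain h g where p': "p = (h, g)" by (cases p)
  note hg = WH0_holomorphic[OF p[unfolded p']]
  have \<phi>': "\<phi> holomorphic_on disk" using \<phi> by (simp add: classW_iff)
  define h1 where "h1 = hconv h \<phi>"
  define g1 where "g1 = hconv g \<phi>"
  have t: "tconv \<phi> p = (h1, g1)" by (simp add: tconv_def p' h1_def g1_def)
  have W: "(h1, g1) \<in> WH0" unfolding t[symmetric] using classW_dquot[OF \<phi>] classW_classA[OF \<phi>] p by (intro WH0_tconv)
  have conv: "Re (Lop (\<lambda>z. h1 z + l * g1 z) z / deriv (\<lambda>z. h1 z + l * g1 z) z) > 0"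
    if l: "cmod l = 1" and z: "z \<in> disk" for l z
  proof -
    define F where "F = (\<lambda>z. h z + l * g z)"
    have F: "F \<in> classW" using p l by (simp add: F_def p' WH0_iff)
    then have Fh: "F holomorphic_on disk" by (simp add: classW_iff)
    define K where "K = (\<lambda>z. h1 z + l * g1 z)"
    have Kh: "K holomorphic_on disk" unfolding K_def
      by (intro holomorphic_intros WH0_holomorphic[OF W])
    have eq: "hconv F \<phi> z = K z" if "z \<in> disk" for z
      unfolding F_def K_def h1_def g1_def by (rule hconv_add) (use hg \<phi>' that in auto)
    have ceq: "coef (hconv F \<phi>) n = coef K n" for n by (rule coef_cong[OF eq])
    have hh: "hconv F \<phi> holomorphic_on disk" by (rule holomorphic_hconv[OF Fh \<phi>'])
    have "Lop (hconv F \<phi>) z = Lop K z"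
      by (rule coef_eqI[OF _ _ _ z]) (auto simp: holomorphic_Lop hh Kh coef_Lop ceq)
    moreover have "deriv (hconv F \<phi>) z = deriv K z"
      by (rule coef_eqI[OF _ _ _ z]) (auto simp: hh Kh coef_deriv ceq holomorphic_deriv)
    ultimately show ?thesis using classW_hconv_convex[OF F \<phi> z] by (simp add: K_def)
  qed
  have "harmf (h1, g1) = (\<lambda>z. h1 z + 1 * cnj (g1 z))" by (auto simp: harmf_def)
  then have "inj_on (harmf (h1, g1)) disk" using WH0_inj_on[OF W, of 1] by simp
  moreover have "(h1, g1) \<in> classH" using W by (simp add: WH0_def)
  ultimately show ?thesis unfolding t SKH0_def
    using WH0_deriv_norm_less[OF W] WH0_inj_on[OF W] harmonic_convex_image[OF W conv] by auto
qed

section \<open>The extremal function and compactness\<close>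

lemma f0_eq:
  assumes "cmod z \<le> 1"
  shows "f0 z = - z + 2 * dilog z"
proof -
  have "(\<lambda>n. 2 * (z ^ n / (of_nat n)\<^sup>2)) sums (2 * dilog z)"
    by (intro sums_mult dilog_sums assms)
  then have "(\<lambda>n. 2 * (z ^ (n + 2) / (of_nat (n + 2))\<^sup>2)) sums (2 * dilog z - (\<Sum>i<2. 2 * (z ^ i / (of_nat i)\<^sup>2)))"
    by (rule sums_split_initial_segment)
  then have "(\<lambda>n. 2 / (of_nat (n + 2))\<^sup>2 * z ^ (n + 2)) sums (2 * dilog z - 2 * z)"
    by (simp add: numeral_2_eq_2)
  then show ?thesis unfolding f0_def by (simp add: sums_iff)
qed

lemma f0_holomorphic: "f0 holomorphic_on disk"
proof -
  have "(\<lambda>z. - z + 2 * dilog z) holomorphic_on disk" by (intro holomorphic_intros holomorphic_dilog)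
  then show ?thesis by (rule holomorphic_transform) (simp add: f0_eq)
qed

lemma coef_f0: "coef f0 n = (if n = 0 then 0 else if n = 1 then 1 else 2 / (of_nat n)\<^sup>2)"
proof (rule power_series_coef)
  fix z assume z: "z \<in> disk"
  have "(\<lambda>n. 2 * (1 / (of_nat n)\<^sup>2 * z ^ n) + (if n = 1 then - z else 0)) sums (2 * dilog z + - z)"
    by (intro sums_add sums_mult dilog_sums'[OF z] sums_at[of 1]) auto
  moreover have "2 * (1 / (of_nat n)\<^sup>2 * z ^ n) + (if n = 1 then - z else 0)
      = (if n = 0 then 0 else if n = 1 then 1 else 2 / (of_nat n)\<^sup>2) * z ^ n" for n
    by auto
  ultimately show "(\<lambda>n. (if n = 0 then 0 else if n = 1 then 1 else 2 / (of_nat n)\<^sup>2) * z ^ n) sums f0 z"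
    using z by (simp add: f0_eq)
qed

text \<open>\<open>Lop f0\<close> is the half-plane map (1 + z) / (1 - z), the extremal function of
  Harnack's inequality and of the coefficient bound 2.\<close>

lemma f0_WH0: "(f0, \<lambda>_. 0) \<in> WH0"
proof -
  have Lop: "Lop f0 z = (1 + z) / (1 - z)" if z: "z \<in> disk" for z
  proof -
    have "(\<lambda>n. coef (Lop f0) n * z ^ n) sums Lop f0 z"
      by (rule coef_sums[OF holomorphic_Lop[OF f0_holomorphic] z])
    moreover have "coef (Lop f0) n = (if n = 0 then 1 else 2)" for n
      by (auto simp: coef_Lop[OF f0_holomorphic] coef_f0 simp del: of_nat_Suc simp flip: One_nat_def)
    ultimately have "(\<lambda>n. (if n = 0 then 1 else 2) * z ^ n) sums Lop f0 z" by simp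
    moreover have "(\<lambda>n. 2 * z ^ n + (if n = 0 then - 1 else 0)) sums (2 * (1 / (1 - z)) + - 1)"
      using z by (intro sums_add sums_mult geometric_sums sums_at[of 0]) auto
    then have "(\<lambda>n. (if n = 0 then 1 else 2) * z ^ n) sums (2 * (1 / (1 - z)) + - 1)"
      by (rule back_subst[of "\<lambda>f. f sums _"]) auto
    ultimately have "Lop f0 z = 2 * (1 / (1 - z)) + - 1" by (rule sums_unique2)
    moreover have "1 - z \<noteq> 0" using z by auto
    ultimately show ?thesis by (simp add: field_simps)
  qed
  have "Re (Lop f0 z) > 0" if z: "z \<in> disk" for z
  proof -
    have "cmod z < 1" using z by simp
    have "1 - z \<noteq> 0" using z by auto
    moreover have "Re ((1 + z) * cnj (1 - z)) > 0"
    proof -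
      have "Re ((1 + z) * cnj (1 - z)) = 1 - (cmod z)\<^sup>2"
        unfolding cmod_power2 by (simp add: algebra_simps power2_eq_square)
      moreover have "(cmod z)\<^sup>2 < 1" using \<open>cmod z < 1\<close> by (simp add: power_less_one_iff)
      ultimately show ?thesis by simp
    qed
    ultimately show ?thesis using Lop[OF z] Re_divide_pos_iff by simp
  qed
  moreover have "f0 0 = 0" "deriv f0 0 = 1" using coef_f0[of 0] coef_f0[of "Suc 0"] by (simp_all add: coef_1)
  ultimately show ?thesis using f0_holomorphic by (auto simp: WH0_def classH_def Lop_def)
qed

lemma f0_integral:
  assumes z: "z \<in> disk"
  shows "f0 z = - z - 2 * contour_integral (linepath 0 z) (\<lambda>t. Ln (1 - t) / t)"
proof (cases "z = 0")
  case True then show ?thesis by (simp add: f0_eq)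
next
  case False
  have "((\<lambda>x. Ln (1 - linepath 0 z x) / linepath 0 z x * z) has_integral (- dilog (of_real 1 * z) - - dilog (of_real 0 * z))) {0..1}"
  proof (rule fundamental_theorem_of_calculus_interior)
    have sub: "of_real x * z \<in> disk" if "x \<in> {0..1}" for x
      using that z by (auto simp: norm_mult intro: le_less_trans[OF mult_left_le_one_le])
    show "continuous_on {0..1} (\<lambda>x. - dilog (of_real x * z))"
      by (intro continuous_intros continuous_on_compose2[OF continuous_on_dilog]) (use sub in force)
    fix x :: real assume x: "x \<in> {0<..<1}"
    have zx: "of_real x * z \<in> disk" using sub x by simp
    have "deriv dilog (of_real x * z) = - (Ln (1 - of_real x * z) / (of_real x * z))"
      using deriv_dilog[OF zx] x False by (simp add: field_simps)
    moreover have "((\<lambda>x. of_real x * z) has_vector_derivative z) (at x)"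
      by (auto intro!: derivative_eq_intros has_vector_derivative_real_field)
    from field_vector_diff_chain_at[OF this has_field_derivative_deriv_disk[OF holomorphic_dilog zx]]
    have "((\<lambda>x. dilog (of_real x * z)) has_vector_derivative z * deriv dilog (of_real x * z)) (at x)"
      by (simp add: o_def)
    then have "((\<lambda>x. - dilog (of_real x * z)) has_vector_derivative - (z * deriv dilog (of_real x * z))) (at x)"
      by (rule has_vector_derivative_minus)
    ultimately show "((\<lambda>x. - dilog (of_real x * z)) has_vector_derivative
        Ln (1 - linepath 0 z x) / linepath 0 z x * z) (at x)"
      by (simp add: linepath_def scaleR_conv_of_real mult.commute)
  qed simp
  then have "((\<lambda>t. Ln (1 - t) / t) has_contour_integral - dilog z) (linepath 0 z)"
    unfolding has_contour_integral_linepath by simp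
  then have "contour_integral (linepath 0 z) (\<lambda>t. Ln (1 - t) / t) = - dilog z"
    by (rule contour_integral_unique)
  then show ?thesis using z by (simp add: f0_eq)
qed

lemma f0_of_real:
  assumes "\<bar>x\<bar> \<le> 1"
  shows "f0 (of_real x) = of_real (- x + 2 * rdilog x)"
  using assms by (simp add: f0_eq dilog_of_real)

lemma rdilog_nonneg: "0 \<le> x \<Longrightarrow> x \<le> 1 \<Longrightarrow> x \<le> rdilog x"
proof -
  assume x: "0 \<le> x" "x \<le> 1"
  have "(\<Sum>n\<in>{1}. x ^ n / (real n)\<^sup>2) \<le> rdilog x"
    using dilog_of_real(2)[of x] x by (intro sum_le_suminf[of "\<lambda>n. x ^ n / (real n)\<^sup>2" "{1}", THEN order_trans]) (auto simp: sums_iff)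
  then show ?thesis by simp
qed

text \<open>The derivative 2 ln (1 + s) / s - 1 is positive once ln (1 + s) > s / 2, and concavity
  with ln 2 \<ge> 2/3 gives more.\<close>

lemma Qlow_strict_mono:
  assumes "0 \<le> a" "a < b" "b \<le> 1"
  shows "Qlow a < Qlow b"
proof (rule DERIV_pos_imp_increasing_open[of a b Qlow])
  fix s assume s: "a < s" "s < b"
  then have s': "0 < s" "s < 1" using assms by auto
  have "s * (2/3) \<le> s * ln 2" using s' ln2_ge_two_thirds by simp
  also have "\<dots> \<le> ln (1 + s)" using s' by (intro mult_ln_2_le) auto
  finally have "2 * ln (1 + s) / s - 1 > 0" using s' by (simp add: field_simps)
  then show "\<exists>y. (Qlow has_real_derivative y) (at s) \<and> 0 < y" using Qlow_derivative[OF s'] by blast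
qed (use assms in \<open>auto intro: continuous_on_subset[OF continuous_on_Qlow]\<close>)

text \<open>The alternating series for \<open>rdilog (- 1)\<close> is twice the even part of the
  series of 1 / n^2 minus the whole, that is pi^2/12 - pi^2/6.\<close>

lemma Qlow_1: "Qlow 1 = pi\<^sup>2 / 6 - 1"
proof -
  define c where "c = (\<lambda>n. 1 / (real n)\<^sup>2)"
  have c: "c sums (pi\<^sup>2 / 6)"
  proof -
    have "(\<lambda>n. c (Suc n)) sums (pi\<^sup>2 / 6)" using inverse_squares_sums by (simp add: c_def add.commute)
    then show ?thesis by (subst (asm) sums_Suc_iff) (simp add: c_def)
  qed
  define e where "e = (\<lambda>n. if even n then 2 * c n else 0)"
  have "(\<lambda>n. 1/2 * c n) sums (1/2 * (pi\<^sup>2 / 6))" by (intro sums_mult c)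
  moreover have "e (2 * n) = 1/2 * c n" for n by (simp add: e_def c_def power2_eq_square)
  ultimately have "(\<lambda>n. e (2 * n)) sums (1/2 * (pi\<^sup>2 / 6))" by (simp only:)
  then have "(\<lambda>n. e (2 * n)) sums (pi\<^sup>2 / 12)" by simp
  moreover have "e n = 0" if "n \<notin> range ((*) 2)" for n
    using that by (auto simp: e_def elim!: evenE)
  moreover have "strict_mono ((*) (2::nat))" by (simp add: strict_mono_def)
  ultimately have "e sums (pi\<^sup>2 / 12)"
    using sums_mono_reindex[of "(*) 2" e "pi\<^sup>2 / 12"] by blast
  then have "(\<lambda>n. e n - c n) sums (pi\<^sup>2 / 12 - pi\<^sup>2 / 6)" by (intro sums_diff c)
  moreover have "e n - c n = (- 1) ^ n / (real n)\<^sup>2" for n by (simp add: e_def c_def)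
  ultimately have "rdilog (- 1) = pi\<^sup>2 / 12 - pi\<^sup>2 / 6"
    using dilog_of_real(2)[of "- 1"] sums_unique2 by fastforce
  then show ?thesis by (simp add: Qlow_def)
qed

lemma f0_norm_real:
  assumes r: "0 \<le> r" "r < 1"
  shows "cmod (f0 (- of_real r)) = Qlow r" "cmod (f0 (of_real r)) = - r + 2 * rdilog r"
proof -
  have "0 \<le> Qlow r" using Qlow_strict_mono[of 0 r] r by (cases "r = 0") auto
  moreover have "f0 (- of_real r) = of_real (- Qlow r)"
    using f0_of_real[of "- r"] r by (simp add: Qlow_def)
  ultimately show "cmod (f0 (- of_real r)) = Qlow r" by (simp del: of_real_minus)
  have "0 \<le> - r + 2 * rdilog r" using rdilog_nonneg[of r] r by simp
  moreover have "f0 (of_real r) = of_real (- r + 2 * rdilog r)" using f0_of_real[of r] r by simp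
  ultimately show "cmod (f0 (of_real r)) = - r + 2 * rdilog r" by (simp only: norm_of_real abs_of_nonneg)
qed

lemma f0_cnj:
  assumes "z \<in> disk" shows "f0 (cnj z) = cnj (f0 z)"
proof -
  have "(\<lambda>n. cnj (coef f0 n * z ^ n)) sums cnj (f0 z)"
    by (rule sums_cnj[THEN iffD2, OF coef_sums[OF f0_holomorphic assms]])
  moreover have "cnj (coef f0 n * z ^ n) = coef f0 n * cnj z ^ n" for n by (simp add: coef_f0)
  ultimately have "(\<lambda>n. coef f0 n * cnj z ^ n) sums cnj (f0 z)" by (simp only:)
  moreover have "(\<lambda>n. coef f0 n * cnj z ^ n) sums f0 (cnj z)"
    using assms by (intro coef_sums f0_holomorphic) auto
  ultimately show ?thesis using sums_unique2 by blast
qed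

text \<open>Real coefficients and injectivity force a preimage of a real value to be real. On the
  real axis f0 is nonnegative for x \<ge> 0, and for x < 0 it equals - \<open>Qlow (- x)\<close>,
  which stays above - \<open>Qlow 1\<close>.\<close>

lemma f0_omits: "- of_real (pi\<^sup>2 / 6 - 1) \<notin> f0 ` disk"
proof
  assume "- of_real (pi\<^sup>2 / 6 - 1) \<in> f0 ` disk"
  then obtain z where z: "z \<in> disk" "f0 z = of_real (- Qlow 1)" by (auto simp: Qlow_1)
  have "f0 (cnj z) = f0 z" using f0_cnj[OF z(1)] z(2) by simp
  moreover have "inj_on f0 disk" using WH0_inj_on[OF f0_WH0, of 1] by simp
  ultimately have "cnj z = z" using z(1) by (auto dest: inj_onD)
  then have zr: "z = of_real (Re z)" by (simp add: complex_eq_iff)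
  define x where "x = Re z"
  have x: "\<bar>x\<bar> < 1" "z = of_real x" using z(1) zr by (auto simp: x_def) (metis norm_of_real)
  have eq: "- x + 2 * rdilog x = - Qlow 1" 
  proof -
    have "complex_of_real (- x + 2 * rdilog x) = of_real (- Qlow 1)"
      using f0_of_real[OF less_imp_le[OF x(1)]] z(2) x(2) by metis
    then show ?thesis by (simp only: of_real_eq_iff)
  qed
  have Q1: "Qlow 1 > 0" using Qlow_strict_mono[of 0 1] by simp
  show False
  proof (cases "x \<ge> 0")
    case True
    then show False using rdilog_nonneg[of x] eq Q1 x by simp
  next
    case False
    then have "Qlow (- x) < Qlow 1" using x by (intro Qlow_strict_mono) auto
    then show False using eq by (simp add: Qlow_def)
  qed
qed

section \<open>Growth and covering\<close>

lemma WH0_norm_lower: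
  assumes hg: "(h, g) \<in> WH0" and z: "z \<in> disk"
  shows "Qlow (cmod z) \<le> cmod (h z + cnj (g z))"
proof (cases "z = 0")
  case False
  have "cmod z * (Qlow (cmod z) / cmod z) \<le> cmod (h z) - cmod (g z)"
    by (rule WH0_norm_diff_ge[OF hg _ z False]) (rule classW_Re_dquot[OF _ z False])
  also have "\<dots> \<le> cmod (h z + cnj (g z))" using norm_diff_ineq[of "h z" "cnj (g z)"] by simp
  finally show ?thesis using False by simp
qed simp

text \<open>Termwise comparison with the series of f0 on the positive axis, using the bound on |a_n|
  + |b_n|.\<close>

lemma WH0_norm_sum_le:
  assumes hg: "(h, g) \<in> WH0" and z: "z \<in> disk"
  shows "cmod (h z) + cmod (g z) \<le> - cmod z + 2 * rdilog (cmod z)"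
proof -
  note H = WH0_holomorphic[OF hg]
  define r where "r = cmod z"
  have r: "0 \<le> r" "r < 1" using z by (auto simp: r_def)
  have s: "summable (\<lambda>n. cmod (coef f n * z ^ n))" if "f holomorphic_on disk" for f
    using coef_abs_summable[OF that, of z] z by (simp only: norm_mult norm_power) simp
  have le: "cmod (f z) \<le> (\<Sum>n. cmod (coef f n * z ^ n))" if "f holomorphic_on disk" for f
    using summable_norm[OF s[OF that]] coef_sums[OF that z] by (simp add: sums_iff)
  \<comment> \<open>The correction at n = 1 lowers 2 r to r, matching h'(0) = 1 and g'(0) = 0; the
    term n = 0 is 0 by division by zero.\<close>
  have "(\<lambda>n. 2 * (r ^ n / (real n)\<^sup>2) + (if n = 1 then - r else 0)) sums (2 * rdilog r + - r)"
    using r by (intro sums_add sums_mult dilog_of_real sums_at[of 1]) auto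
  note b = sums_summable[OF this] sums_unique[OF this]
  have "cmod (h z) + cmod (g z) \<le> (\<Sum>n. cmod (coef h n * z ^ n) + cmod (coef g n * z ^ n))"
    using le[OF H(1)] le[OF H(2)] suminf_add[OF s[OF H(1)] s[OF H(2)]] by linarith
  also have "\<dots> \<le> (\<Sum>n. 2 * (r ^ n / (real n)\<^sup>2) + (if n = 1 then - r else 0))"
  proof (rule suminf_le[OF _ summable_add[OF s[OF H(1)] s[OF H(2)]] b(1)])
    fix n :: nat
    consider "n = 0" | "n = 1" | "n \<ge> 2" by linarith
    then show "cmod (coef h n * z ^ n) + cmod (coef g n * z ^ n) \<le> 2 * (r ^ n / (real n)\<^sup>2) + (if n = 1 then - r else 0)"
    proof cases
      case 3
      have "(cmod (coef h n) + cmod (coef g n)) * r ^ n \<le> 2 / (real n)\<^sup>2 * r ^ n"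
        using WH0_coef_le[OF hg 3] r by (intro mult_right_mono) auto
      then show ?thesis using 3 by (simp add: norm_mult norm_power r_def distrib_right)
    qed (use H in \<open>auto simp: coef_1 r_def\<close>)
  qed
  finally show ?thesis using b(2) by (simp add: r_def)
qed

text \<open>Choose r < 1 with \<open>cmod w < Qlow r\<close>. The circle of radius r is mapped
  outside the ball B of radius \<open>Qlow r\<close>, so the image of the open disk meets B in a set
  that is both open and closed in B; B is connected.\<close>

lemma WH0_covering:
  assumes hg: "(h, g) \<in> WH0"
  shows "ball 0 (pi\<^sup>2 / 6 - 1) \<subseteq> (\<lambda>z. h z + cnj (g z)) ` disk"
proof
  fix w :: complex assume "w \<in> ball 0 (pi\<^sup>2 / 6 - 1)"
  then have w: "cmod w < Qlow 1" by (simp add: Qlow_1)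
  define f where "f = (\<lambda>z. h z + 1 * cnj (g z))"
  have "(Qlow \<longlongrightarrow> Qlow 1) (at 1 within {0..1})"
    using continuous_on_Qlow by (auto simp: continuous_on_def)
  then have "(Qlow \<longlongrightarrow> Qlow 1) (at_left 1)"
    by (simp add: at_within_Icc_at_left)
  then have "eventually (\<lambda>r. cmod w < Qlow r) (at_left 1)" by (rule order_tendstoD(1)[OF _ w])
  moreover have "eventually (\<lambda>r. 0 < r \<and> r < (1::real)) (at_left 1)"
    by (rule eventually_at_leftI[of 0]) auto
  ultimately have "eventually (\<lambda>r. cmod w < Qlow r \<and> 0 < r \<and> r < 1) (at_left 1)"
    by (rule eventually_conj)
  then obtain r where r: "cmod w < Qlow r" "0 < r" "r < 1"
    using eventually_happens'[OF trivial_limit_at_left_real] by blast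
  define B where "B = ball (0::complex) (Qlow r)"
  have sub: "cball 0 r \<subseteq> disk" using r by auto
  have cont: "continuous_on disk f" unfolding f_def by (intro harmonic_continuous_on WH0_holomorphic[OF hg])
  have cl: "closed (f ` cball 0 r)"
    by (intro compact_imp_closed compact_continuous_image continuous_on_subset[OF cont sub]) auto
  have op: "open (f ` ball 0 r)" unfolding f_def by (rule WH0_open_image[OF hg]) (use r in auto)
  have eq: "B \<inter> f ` cball 0 r = B \<inter> f ` ball 0 r"
  proof -
    have "z \<in> ball 0 r" if "f z \<in> B" "z \<in> cball 0 r" for z
    proof (rule ccontr)
      assume "z \<notin> ball 0 r"
      then have "cmod z = r" using that by simp
      then show False using WH0_norm_lower[OF hg, of z] that r by (simp add: B_def f_def)
    qed
    moreover have "ball (0::complex) r \<subseteq> cball 0 r" by auto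
    ultimately show ?thesis by blast
  qed
  have "connected B" by (simp add: B_def)
  moreover have "openin (top_of_set B) (B \<inter> f ` ball 0 r)" using op by (rule openin_open_Int)
  moreover have "closedin (top_of_set B) (B \<inter> f ` ball 0 r)" unfolding eq[symmetric] using cl by (rule closedin_closed_Int)
  moreover have "0 \<in> B \<inter> f ` ball 0 r"
  proof -
    have "f 0 = 0" by (simp add: f_def WH0_holomorphic[OF hg])
    moreover have "0 < Qlow r" using r(1) by (rule le_less_trans[OF norm_ge_zero])
    ultimately show ?thesis using r by (auto simp: B_def intro!: image_eqI[of _ _ 0])
  qed
  ultimately have "B \<inter> f ` ball 0 r = B" unfolding connected_clopen by blast
  moreover have "w \<in> B" using r by (simp add: B_def)
  ultimately have "w \<in> f ` ball 0 r" by blast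
  then show "w \<in> (\<lambda>z. h z + cnj (g z)) ` disk" using r by (auto simp: f_def)
qed

lemma rdilog_le:
  assumes "0 \<le> x" "x \<le> 1"
  shows "rdilog x \<le> rdilog 1"
proof (rule sums_le)
  show "(\<lambda>n. x ^ n / (real n)\<^sup>2) sums rdilog x" by (rule dilog_of_real) (use assms in auto)
  show "(\<lambda>n. 1 ^ n / (real n)\<^sup>2) sums rdilog 1" by (rule dilog_of_real) auto
  show "x ^ n / (real n)\<^sup>2 \<le> 1 ^ n / (real n)\<^sup>2" for n
    using assms by (intro divide_right_mono power_mono) auto
qed

text \<open>A bound uniform in the pair and the point, as needed for Montel's theorem and for the
  Weierstrass test.\<close>

lemma WH0_norm_bound:
  assumes hg: "(h, g) \<in> WH0" and z: "z \<in> disk"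
  shows "cmod (h z) \<le> 2 * rdilog 1" "cmod (g z) \<le> 2 * rdilog 1"
proof -
  have "cmod (h z) + cmod (g z) \<le> 2 * rdilog 1"
    using WH0_norm_sum_le[OF hg z] rdilog_le[OF norm_ge_zero, of z] z norm_ge_zero[of z]
    by (simp del: norm_ge_zero)
  then show "cmod (h z) \<le> 2 * rdilog 1" "cmod (g z) \<le> 2 * rdilog 1"
    using norm_ge_zero[of "h z"] norm_ge_zero[of "g z"] by linarith+
qed

section \<open>Locally uniform limits and compactness\<close>

lemma higher_deriv_locally_uniform_limit:
  assumes hol: "\<And>n. f n holomorphic_on disk"
    and u: "\<And>K. compact K \<Longrightarrow> K \<subseteq> disk \<Longrightarrow> uniform_limit K f F sequentially"
    and z: "z \<in> disk"
  shows "(\<lambda>n. (deriv ^^ m) (f n) z) \<longlonglongrightarrow> (deriv ^^ m) F z"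
proof (rule higher_deriv_complex_uniform_limit)
  define r where "r = (1 + cmod z) / 2"
  have r: "cmod z < r" "r < 1" using z by (auto simp: r_def)
  have sub: "ball 0 r \<subseteq> disk" "cball 0 r \<subseteq> disk" using r by auto
  show "uniform_limit (ball 0 r) f F sequentially"
    by (rule uniform_limit_on_subset[OF u[of "cball 0 r"]]) (use sub in auto)
  show "\<forall>\<^sub>F n in sequentially. f n holomorphic_on ball 0 r"
    using holomorphic_on_subset[OF hol sub(1)] by (intro always_eventually) auto
  show "z \<in> ball 0 r" using r by simp
qed auto

text \<open>The approximating pairs need only the weak inequality, not membership: partial sums of a
  convex series are not normalised. Strictness is recovered from the normalisation of the
  limit.\<close>

lemma WH0_limitI:
  assumes h: "\<And>n. h n holomorphic_on disk" and g: "\<And>n. g n holomorphic_on disk"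
    and ge: "\<And>n c z. cmod c = 1 \<Longrightarrow> z \<in> disk \<Longrightarrow> Re (Lop (h n) z + c * Lop (g n) z) \<ge> 0"
    and uh: "\<And>K. compact K \<Longrightarrow> K \<subseteq> disk \<Longrightarrow> uniform_limit K h H sequentially"
    and ug: "\<And>K. compact K \<Longrightarrow> K \<subseteq> disk \<Longrightarrow> uniform_limit K g G sequentially"
    and cH: "(H, G) \<in> classH"
  shows "(H, G) \<in> WH0"
  unfolding WH0_iff
proof safe
  show "(H, G) \<in> classH" by (rule cH)
  have 1: "H holomorphic_on disk" "G holomorphic_on disk" "H 0 = 0" "G 0 = 0" "deriv H 0 = 1" "deriv G 0 = 0"
    using cH by (auto simp: classH_def)
  fix c :: complex assume c: "cmod c = 1"
  define F where "F = (\<lambda>z. H z + c * G z)"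
  have Fh: "F holomorphic_on disk" unfolding F_def by (intro holomorphic_intros 1)
  have dF: "deriv F 0 = 1" by (simp add: F_def deriv_add_cmult 1)
  have "Re (Lop F z) \<ge> 0" if z: "z \<in> disk" for z
  proof -
    note lh = higher_deriv_locally_uniform_limit[OF h uh z]
    note lg = higher_deriv_locally_uniform_limit[OF g ug z]
    have "(\<lambda>n. Re (Lop (h n) z + c * Lop (g n) z)) \<longlonglongrightarrow> Re (Lop H z + c * Lop G z)"
      unfolding Lop_def using lh[of 1] lg[of 1] lh[of 2] lg[of 2]
      by (intro tendsto_intros) (simp_all add: numeral_2_eq_2)
    then have "Re (Lop H z + c * Lop G z) \<ge> 0"
      by (rule LIMSEQ_le_const) (use ge[OF c z] in blast)
    then show ?thesis by (simp add: F_def Lop_add_cmult[OF 1(1,2) z])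
  qed
  then have "Re (Lop F z) > 0" if "z \<in> disk" for z
    using that Re_pos_of_Re_nonneg[OF holomorphic_Lop[OF Fh]] by (simp add: Lop_0 dF)
  then show "(\<lambda>z. H z + c * G z) \<in> classW"
    using Fh dF 1 by (simp add: classW_iff F_def)
qed

lemma WH0_Re_Lop_nonneg:
  assumes hg: "(h, g) \<in> WH0" and c: "cmod c = 1" and z: "z \<in> disk"
  shows "Re (Lop h z + c * Lop g z) \<ge> 0"
proof -
  have "(\<lambda>z. h z + c * g z) \<in> classW" using hg c by (simp add: WH0_iff)
  then have "Re (Lop (\<lambda>z. h z + c * g z) z) > 0" using z by (simp add: classW_iff)
  then show ?thesis by (simp add: Lop_add_cmult[OF WH0_holomorphic(1,2)[OF hg] z])
qed

lemma WH0_limit: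
  assumes hg: "\<And>n. (h n, g n) \<in> WH0"
    and H: "H holomorphic_on disk" and G: "G holomorphic_on disk"
    and uh: "\<And>K. compact K \<Longrightarrow> K \<subseteq> disk \<Longrightarrow> uniform_limit K h H sequentially"
    and ug: "\<And>K. compact K \<Longrightarrow> K \<subseteq> disk \<Longrightarrow> uniform_limit K g G sequentially"
  shows "(H, G) \<in> WH0"
proof (rule WH0_limitI[OF _ _ WH0_Re_Lop_nonneg[OF hg] uh ug])
  note L = WH0_holomorphic[OF hg]
  show "h n holomorphic_on disk" "g n holomorphic_on disk" for n by (rule L)+
  have z0: "(0::complex) \<in> disk" by simp
  note lh = higher_deriv_locally_uniform_limit[OF L(1) uh z0]
  note lg = higher_deriv_locally_uniform_limit[OF L(2) ug z0]
  have "H 0 = 0" "G 0 = 0" "deriv H 0 = 1" "deriv G 0 = 0"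
    using lh[of 0] lg[of 0] lh[of 1] lg[of 1] by (simp_all add: L LIMSEQ_const_iff)
  then show "(H, G) \<in> classH" using H G by (simp add: classH_def)
qed

text \<open>Sequential compactness suffices because the topology of locally uniform convergence is
  metrizable. Montel's theorem is applied to the analytic parts and then, along that subsequence, to
  the co-analytic parts.\<close>

lemma WH0_compact:
  fixes p :: "nat \<Rightarrow> (complex \<Rightarrow> complex) \<times> (complex \<Rightarrow> complex)"
  assumes p: "\<And>n. p n \<in> WH0"
  shows "\<exists>r q. strict_mono r \<and> q \<in> WH0 \<and>
    (\<forall>K. compact K \<and> K \<subseteq> disk \<longrightarrow> uniform_limit K (\<lambda>n. harmf (p (r n))) (harmf q) sequentially)"
proof -
  define h where "h = (\<lambda>n. fst (p n))"
  define g where "g = (\<lambda>n. snd (p n))"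
  have hg: "(h n, g n) \<in> WH0" for n using p by (simp add: h_def g_def)
  define \<H> where "\<H> = {f. f holomorphic_on disk \<and> (\<forall>z\<in>disk. cmod (f z) \<le> 2 * rdilog 1)}"
  have bd: "\<exists>B. \<forall>f\<in>\<H>. \<forall>z\<in>K. cmod (f z) \<le> B" if "K \<subseteq> disk" for K
    using that by (intro exI[of _ "2 * rdilog 1"]) (auto simp: \<H>_def)
  have hol: "f holomorphic_on disk" if "f \<in> \<H>" for f using that by (simp add: \<H>_def)
  have rh: "range h \<subseteq> \<H>" and rg: "range g \<subseteq> \<H>"
    using WH0_holomorphic[OF hg] WH0_norm_bound[OF hg] by (auto simp: \<H>_def)
  obtain H r1 where H: "H holomorphic_on disk" "strict_mono r1"
      "\<And>K. compact K \<Longrightarrow> K \<subseteq> disk \<Longrightarrow> uniform_limit K (h \<circ> r1) H sequentially"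
    using Montel[OF open_ball hol bd rh] by metis
  have rg': "range (g \<circ> r1) \<subseteq> \<H>" using rg by auto
  obtain G r2 where G: "G holomorphic_on disk" "strict_mono r2"
      "\<And>K. compact K \<Longrightarrow> K \<subseteq> disk \<Longrightarrow> uniform_limit K ((g \<circ> r1) \<circ> r2) G sequentially"
    using Montel[OF open_ball hol bd rg'] by metis
  define r where "r = r1 \<circ> r2"
  have r: "strict_mono r" unfolding r_def using H(2) G(2) by (rule strict_mono_o)
  have uh: "uniform_limit K (\<lambda>n. h (r n)) H sequentially" if "compact K" "K \<subseteq> disk" for K
    using filterlim_compose[OF H(3)[OF that] filterlim_subseq[OF G(2)]] by (simp add: r_def o_def)
  have ug: "uniform_limit K (\<lambda>n. g (r n)) G sequentially" if "compact K" "K \<subseteq> disk" for K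
    using G(3)[OF that] by (simp add: r_def o_def)
  have "(H, G) \<in> WH0" by (rule WH0_limit[OF hg H(1) G(1) uh ug])
  moreover have "uniform_limit K (\<lambda>n. harmf (p (r n))) (harmf (H, G)) sequentially"
    if K: "compact K" "K \<subseteq> disk" for K
  proof -
    have "uniform_limit K (\<lambda>n z. h (r n) z + cnj (g (r n) z)) (\<lambda>z. H z + cnj (G z)) sequentially"
      by (intro uniform_limit_intros bounded_linear.uniform_limit[OF bounded_linear_cnj] uh ug K)
    then show ?thesis by (simp add: harmf_def[abs_def] h_def g_def)
  qed
  ultimately show ?thesis using r by blast
qed

section \<open>Countable convex combinations\<close>

lemma holomorphic_sum_scaled:
  fixes N :: nat
  assumes "\<And>n. f n holomorphic_on disk"
  shows "(\<lambda>z. \<Sum>n<N. c n * f n z) holomorphic_on disk"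
  by (intro holomorphic_intros assms)

lemma deriv_sum_scaled:
  fixes N :: nat
  assumes f: "\<And>n. f n holomorphic_on disk" and z: "z \<in> disk"
  shows "deriv (\<lambda>z. \<Sum>n<N. c n * f n z) z = (\<Sum>n<N. c n * deriv (f n) z)"
proof (induction N)
  case (Suc N)
  then show ?case
    using deriv_add_cmult[OF holomorphic_sum_scaled[OF f, where N=N and c=c] f[of N] z] by simp
qed simp

lemma Lop_sum_scaled:
  fixes N :: nat
  assumes f: "\<And>n. f n holomorphic_on disk" and z: "z \<in> disk"
  shows "Lop (\<lambda>z. \<Sum>n<N. c n * f n z) z = (\<Sum>n<N. c n * Lop (f n) z)"
proof (induction N)
  case 0
  then show ?case by (simp add: Lop_def)
next
  case (Suc N)
  then show ?case
    using Lop_add_cmult[OF holomorphic_sum_scaled[OF f, where N=N and c=c] f[of N] z] by simp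
qed

text \<open>Finite combinations are included by taking the remaining weights 0. Partial sums inherit
  the weak inequality, since the weights are nonnegative.\<close>

lemma WH0_convex_series:
  fixes t :: "nat \<Rightarrow> real" and p :: "nat \<Rightarrow> (complex \<Rightarrow> complex) \<times> (complex \<Rightarrow> complex)"
  assumes t: "\<And>n. t n \<ge> 0" "t sums 1" and p: "\<And>n. p n \<in> WH0"
  shows "((\<lambda>z. \<Sum>n. of_real (t n) * fst (p n) z), (\<lambda>z. \<Sum>n. of_real (t n) * snd (p n) z)) \<in> WH0"
proof -
  define h where "h = (\<lambda>n. fst (p n))"
  define g where "g = (\<lambda>n. snd (p n))"
  have hg: "(h n, g n) \<in> WH0" for n using p by (simp add: h_def g_def)
  note L = WH0_holomorphic[OF hg]
  define S where "S = (\<lambda>(f :: nat \<Rightarrow> complex \<Rightarrow> complex) N z. \<Sum>n<N. complex_of_real (t n) * f n z)"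
  define T where "T = (\<lambda>(f :: nat \<Rightarrow> complex \<Rightarrow> complex) z. \<Sum>n. complex_of_real (t n) * f n z)"
  have Sh: "S f N holomorphic_on disk" if "\<And>n. f n holomorphic_on disk" for f N
    unfolding S_def by (rule holomorphic_sum_scaled) (rule that)
  have uni: "uniform_limit disk (S f) (T f) sequentially"
    if bd: "\<And>n z. z \<in> disk \<Longrightarrow> cmod (f n z) \<le> 2 * rdilog 1" for f
    unfolding S_def T_def
  proof (rule Weierstrass_m_test)
    show "cmod (complex_of_real (t n) * f n z) \<le> t n * (2 * rdilog 1)" if "z \<in> disk" for n z
      using t(1) bd[OF that] by (simp add: norm_mult mult_left_mono)
    show "summable (\<lambda>n. t n * (2 * rdilog 1))" using t(2) by (intro summable_mult2) (rule sums_summable)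
  qed
  note uh = uniform_limit_on_subset[OF uni[OF WH0_norm_bound(1)[OF hg]]]
  note ug = uniform_limit_on_subset[OF uni[OF WH0_norm_bound(2)[OF hg]]]
  have Th: "T f holomorphic_on disk" if "\<And>n. f n holomorphic_on disk" "uniform_limit disk (S f) (T f) sequentially" for f
  proof (rule holomorphic_uniform_sequence[OF open_ball Sh[OF that(1)]])
    fix x :: complex assume "x \<in> disk"
    then obtain d where "d > 0" "cball x d \<subseteq> disk" by (meson open_ball open_contains_cball)
    then show "\<exists>d>0. cball x d \<subseteq> disk \<and> uniform_limit (cball x d) (S f) (T f) sequentially"
      using uniform_limit_on_subset[OF that(2)] by blast
  qed
  have z0: "(0::complex) \<in> disk" by simp
  \<comment> \<open>Evaluated at 0, this recovers the normalisation of the limit from the total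
    weight 1.\<close>
  have dT: "(\<lambda>N. \<Sum>n<N. complex_of_real (t n) * deriv (f n) 0) \<longlonglongrightarrow> deriv (T f) 0"
    if f: "\<And>n. f n holomorphic_on disk" "uniform_limit disk (S f) (T f) sequentially" for f
  proof -
    have "(\<lambda>N. (deriv ^^ 1) (S f N) 0) \<longlonglongrightarrow> (deriv ^^ 1) (T f) 0"
      by (rule higher_deriv_locally_uniform_limit[OF Sh[OF f(1)] _ z0]) (rule uniform_limit_on_subset[OF f(2)])
    then show ?thesis unfolding S_def using deriv_sum_scaled[OF f(1) z0, where c="\<lambda>n. of_real (t n)"] by simp
  qed
  have "(\<lambda>n. complex_of_real (t n)) sums 1" using sums_of_real[OF t(2), where 'a=complex] by simp
  then have one: "(\<lambda>N. \<Sum>n<N. complex_of_real (t n)) \<longlonglongrightarrow> 1" by (simp add: sums_def)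
  have uH: "uniform_limit disk (S h) (T h) sequentially" and uG: "uniform_limit disk (S g) (T g) sequentially"
    by (rule uni[OF WH0_norm_bound(1)[OF hg]] uni[OF WH0_norm_bound(2)[OF hg]]; assumption)+
  have "(T h, T g) \<in> WH0"
  proof (rule WH0_limitI[OF Sh Sh _ uh ug])
    show "h n holomorphic_on disk" "g n holomorphic_on disk" for n by (rule L)+
    show "Re (Lop (S h n) z + c * Lop (S g n) z) \<ge> 0" if c: "cmod c = 1" and z: "z \<in> disk" for n c z
    proof -
      have "Lop (S h n) z + c * Lop (S g n) z = (\<Sum>k<n. complex_of_real (t k) * (Lop (h k) z + c * Lop (g k) z))"
        unfolding S_def Lop_sum_scaled[OF L(1) z] Lop_sum_scaled[OF L(2) z]
        by (simp add: sum_distrib_left sum.distrib algebra_simps)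
      moreover have "Re (complex_of_real (t k) * (Lop (h k) z + c * Lop (g k) z)) \<ge> 0" for k
      proof -
        have "Re (complex_of_real (t k) * w) = t k * Re w" for w by simp
        then show ?thesis using t(1)[of k] WH0_Re_Lop_nonneg[OF hg c z, of k] by (simp only: mult_nonneg_nonneg)
      qed
      ultimately show ?thesis by (simp only: Re_sum sum_nonneg)
    qed
    have "deriv (T h) 0 = 1" using dT[OF L(1) uH] one by (simp add: L LIMSEQ_unique)
    moreover have "deriv (T g) 0 = 0" using dT[OF L(2) uG] by (simp add: L LIMSEQ_const_iff)
    moreover have "T h 0 = 0" "T g 0 = 0" by (simp_all add: T_def L)
    ultimately show "(T h, T g) \<in> classH"
      using Th[OF L(1) uH] Th[OF L(2) uG] by (simp add: classH_def)
  qed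
  then show ?thesis by (simp add: T_def[abs_def] h_def g_def)
qed

theorem theorem3p5:
  shows "(\<forall>h g. (h, g) \<in> WH0 \<longrightarrow>
            (\<forall>n\<ge>2. \<bar>cmod (coef h n) - cmod (coef g n)\<bar> \<le> 2 / (real n)\<^sup>2) \<and>
            (\<forall>z\<in>disk.
               - cmod z + 2 * integral {0..cmod z} (\<lambda>t. ln (1 + t) / t) \<le> cmod (h z + cnj (g z)) \<and>
               cmod (h z + cnj (g z)) \<le> - cmod z - 2 * integral {0..cmod z} (\<lambda>t. ln (1 - t) / t)) \<and>
            ball 0 (pi\<^sup>2 / 6 - 1) \<subseteq> (\<lambda>z. h z + cnj (g z)) ` disk)
   \<and> (\<forall>z\<in>disk. f0 z = - z - 2 * contour_integral (linepath 0 z) (\<lambda>t. Ln (1 - t) / t))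
   \<and> (f0, (\<lambda>_. 0)) \<in> WH0
   \<and> (\<forall>n\<ge>2. \<bar>cmod (coef f0 n) - cmod (coef (\<lambda>_. 0) n)\<bar> = 2 / (real n)\<^sup>2)
   \<and> (\<forall>r. 0 \<le> r \<and> r < 1 \<longrightarrow>
         cmod (f0 (- complex_of_real r)) = - r + 2 * integral {0..r} (\<lambda>t. ln (1 + t) / t) \<and>
         cmod (f0 (complex_of_real r)) = - r - 2 * integral {0..r} (\<lambda>t. ln (1 - t) / t))
   \<and> (\<forall>\<rho>. \<rho> > pi\<^sup>2 / 6 - 1 \<longrightarrow> \<not> ball 0 \<rho> \<subseteq> f0 ` disk)
   \<and> (\<forall>p :: nat \<Rightarrow> (complex \<Rightarrow> complex) \<times> (complex \<Rightarrow> complex). (\<forall>n. p n \<in> WH0) \<longrightarrow>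
         (\<exists>r q. strict_mono r \<and> q \<in> WH0 \<and>
            (\<forall>K. compact K \<and> K \<subseteq> disk \<longrightarrow>
               uniform_limit K (\<lambda>n. harmf (p (r n))) (harmf q) sequentially)))
   \<and> radius_S WH0 = 1 \<and> radius_CC WH0 = 1
   \<and> (\<forall>p q. p \<in> WH0 \<and> q \<in> WH0 \<longrightarrow> harm_conv p q \<in> WH0)
   \<and> (\<forall>\<phi> p. \<phi> \<in> classK \<and> p \<in> WH0 \<longrightarrow> tconv \<phi> p \<in> WH0)
   \<and> (\<forall>\<phi> p. \<phi> \<in> classA \<and> (\<forall>z\<in>disk - {0}. Re (\<phi> z / z) > 1 / 2) \<and> p \<in> WH0
         \<longrightarrow> tconv \<phi> p \<in> WH0)
   \<and> (\<forall>\<phi> p. \<phi> \<in> classW \<and> p \<in> WH0 \<longrightarrow> tconv \<phi> p \<in> WH0 \<inter> SKH0)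
   \<and> (\<forall>(t :: nat \<Rightarrow> real) (p :: nat \<Rightarrow> (complex \<Rightarrow> complex) \<times> (complex \<Rightarrow> complex)).
         (\<forall>n. t n \<ge> 0) \<and> t sums 1 \<and> (\<forall>n. p n \<in> WH0) \<longrightarrow>
         ((\<lambda>z. \<Sum>n. of_real (t n) * fst (p n) z), (\<lambda>z. \<Sum>n. of_real (t n) * snd (p n) z)) \<in> WH0)"
proof (intro conjI)
  show "\<forall>h g. (h, g) \<in> WH0 \<longrightarrow>
            (\<forall>n\<ge>2. \<bar>cmod (coef h n) - cmod (coef g n)\<bar> \<le> 2 / (real n)\<^sup>2) \<and>
            (\<forall>z\<in>disk.
               - cmod z + 2 * integral {0..cmod z} (\<lambda>t. ln (1 + t) / t) \<le> cmod (h z + cnj (g z)) \<and>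
               cmod (h z + cnj (g z)) \<le> - cmod z - 2 * integral {0..cmod z} (\<lambda>t. ln (1 - t) / t)) \<and>
            ball 0 (pi\<^sup>2 / 6 - 1) \<subseteq> (\<lambda>z. h z + cnj (g z)) ` disk"
  proof (intro allI impI conjI ballI)
    fix h g assume hg: "(h, g) \<in> WH0"
    show "ball 0 (pi\<^sup>2 / 6 - 1) \<subseteq> (\<lambda>z. h z + cnj (g z)) ` disk" by (rule WH0_covering[OF hg])
    show "\<bar>cmod (coef h n) - cmod (coef g n)\<bar> \<le> 2 / (real n)\<^sup>2" if "n \<ge> 2" for n
      using WH0_coef_le[OF hg that] norm_ge_zero[of "coef h n"] norm_ge_zero[of "coef g n"] by linarith
    fix z :: complex assume z: "z \<in> disk"
    then have r: "0 \<le> cmod z" "cmod z < 1" by auto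
    show "- cmod z + 2 * integral {0..cmod z} (\<lambda>t. ln (1 + t) / t) \<le> cmod (h z + cnj (g z))"
      using WH0_norm_lower[OF hg z] integral_rdilog(2)[OF r] by (simp add: Qlow_def)
    show "cmod (h z + cnj (g z)) \<le> - cmod z - 2 * integral {0..cmod z} (\<lambda>t. ln (1 - t) / t)"
      using WH0_norm_sum_le[OF hg z] integral_rdilog(1)[OF r] norm_triangle_ineq[of "h z" "cnj (g z)"] by simp
  qed
  show "\<forall>z\<in>disk. f0 z = - z - 2 * contour_integral (linepath 0 z) (\<lambda>t. Ln (1 - t) / t)"
    using f0_integral by blast
  show "(f0, \<lambda>_. 0) \<in> WH0" by (rule f0_WH0)
  show "\<forall>n\<ge>2. \<bar>cmod (coef f0 n) - cmod (coef (\<lambda>_. 0) n)\<bar> = 2 / (real n)\<^sup>2"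
    by (auto simp: coef_f0 coef_def[of "\<lambda>_. 0"] norm_divide norm_power)
  show "\<forall>r. 0 \<le> r \<and> r < 1 \<longrightarrow>
         cmod (f0 (- complex_of_real r)) = - r + 2 * integral {0..r} (\<lambda>t. ln (1 + t) / t) \<and>
         cmod (f0 (complex_of_real r)) = - r - 2 * integral {0..r} (\<lambda>t. ln (1 - t) / t)"
    by (simp add: f0_norm_real integral_rdilog Qlow_def)
  show "\<forall>\<rho>. \<rho> > pi\<^sup>2 / 6 - 1 \<longrightarrow> \<not> ball 0 \<rho> \<subseteq> f0 ` disk"
  proof (intro allI impI notI)
    fix \<rho> :: real assume \<rho>: "\<rho> > pi\<^sup>2 / 6 - 1" and sub: "ball 0 \<rho> \<subseteq> f0 ` disk"
    have "0 < Qlow 1" using Qlow_strict_mono[of 0 1] by simp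
    then have "cmod (- of_real (pi\<^sup>2 / 6 - 1)) = pi\<^sup>2 / 6 - 1"
      unfolding norm_minus_cancel norm_of_real Qlow_1 by simp
    then have "- of_real (pi\<^sup>2 / 6 - 1) \<in> ball (0::complex) \<rho>" using \<rho> by (simp only: mem_ball_0)
    then show False using sub f0_omits by blast
  qed
  show "\<forall>p :: nat \<Rightarrow> (complex \<Rightarrow> complex) \<times> (complex \<Rightarrow> complex). (\<forall>n. p n \<in> WH0) \<longrightarrow>
         (\<exists>r q. strict_mono r \<and> q \<in> WH0 \<and>
            (\<forall>K. compact K \<and> K \<subseteq> disk \<longrightarrow>
               uniform_limit K (\<lambda>n. harmf (p (r n))) (harmf q) sequentially))"
    by (intro allI impI WH0_compact) simp
  show "radius_S WH0 = 1" "radius_CC WH0 = 1" by (rule radius_WH0)+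
  show "\<forall>p q. p \<in> WH0 \<and> q \<in> WH0 \<longrightarrow> harm_conv p q \<in> WH0"
    using WH0_harm_conv by blast
  show "\<forall>\<phi> p. \<phi> \<in> classK \<and> p \<in> WH0 \<longrightarrow> tconv \<phi> p \<in> WH0"
    by (auto simp del: mem_ball intro!: WH0_tconv classK_Re_dquot) (simp add: classK_def)
  show "\<forall>\<phi> p. \<phi> \<in> classA \<and> (\<forall>z\<in>disk - {0}. Re (\<phi> z / z) > 1 / 2) \<and> p \<in> WH0 \<longrightarrow> tconv \<phi> p \<in> WH0"
  proof (intro allI impI, elim conjE)
    fix \<phi> p assume "\<phi> \<in> classA" "\<forall>z\<in>disk - {0}. Re (\<phi> z / z) > 1 / 2" "p \<in> WH0"
    \<comment> \<open>At the origin, which the hypothesis leaves out, \<open>dquot\<close> has the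
      value \<open>deriv \<phi> 0\<close> = 1.\<close>
    then show "tconv \<phi> p \<in> WH0"
      by (intro WH0_tconv) (auto simp: dquot_def classA_def less_imp_le)
  qed
  show "\<forall>\<phi> p. \<phi> \<in> classW \<and> p \<in> WH0 \<longrightarrow> tconv \<phi> p \<in> WH0 \<inter> SKH0"
    using SKH0_tconv WH0_tconv[OF _ classW_classA classW_dquot] by blast
  show "\<forall>(t :: nat \<Rightarrow> real) (p :: nat \<Rightarrow> (complex \<Rightarrow> complex) \<times> (complex \<Rightarrow> complex)).
         (\<forall>n. t n \<ge> 0) \<and> t sums 1 \<and> (\<forall>n. p n \<in> WH0) \<longrightarrow>
         ((\<lambda>z. \<Sum>n. of_real (t n) * fst (p n) z), (\<lambda>z. \<Sum>n. of_real (t n) * snd (p n) z)) \<in> WH0"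
    using WH0_convex_series by blast
qed

end
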